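(* Let $L=\{0,1,+,-,*,=,<\}$ and consider $\mathbb{Z}$ as an $L$-structure with the standard interpretation. Let $r\ge 1$ and let $\Omega\subseteq\mathbb{Z}^r$. Then the following are equivalent: (i) $\Omega$ has a functional conceptual substratum in the $L$-structure $\mathbb{Z}$; (ii) $\Omega$ is recursively enumerable; (iii) $\Omega$ is Diophantine.
   Context: Let $L$ be a first-order language and $M$ an $L$-structure. A relation $\Omega\subseteq M^r$ has a functional conceptual substratum (in $M$, with language $L$) if there exist $L$-terms $t_1,\ldots,t_r$ and atomic $L$-formulas $A_1,\ldots,A_m$, all of whose variables are contained in $\{x_1,\ldots,x_n\}$, such that for all $a_1,\ldots,a_r\in M$: $(a_1,\ldots,a_r)\in\Omega$ if and only if $$M\models(\exists x_1)\cdots(\exists x_n)(a_1=t_1\wedge\cdots\wedge a_r=t_r\wedge A_1\wedge\cdots\wedge A_m).$$ In $L=\{0,1,+,-,*,=,<\}$, $-$ denotes the additive inverse operation. A set $\Omega\subseteq\mathbb{Z}^r$ is Diophantine if there is a polynomial $H(y_1,\ldots,y_r,x_1,\ldots,x_w)$ with integer coefficients such that for all $(y_1,\ldots,y_r)\in\mathbb{Z}^r$: $(y_1,\ldots,y_r)\in\Omega$ if and only if there exist $x_1,\ldots,x_w\in\mathbb{Z}$ with $H(y_1,\ldots,y_r,x_1,\ldots,x_w)=0$. *)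

theory Defs
  imports Main "HOL-Library.Nat_Bijection" "HOL-Library.Poly_Mapping"
begin

section \<open>First-order languages and structures\<close>

text \<open>Constants are function symbols of arity 0. Equality is a logical symbol: it occurs in
  \<open>atom\<close>, not among the relation symbols of a language, and always denotes equality.\<close>

record ('f, 'p) language =
  fun_arity :: "'f \<Rightarrow> nat"
  rel_arity :: "'p \<Rightarrow> nat"

datatype 'f trm = Var nat | Fn 'f "'f trm list"

datatype ('f, 'p) atom = Eq "'f trm" "'f trm" | Rel 'p "'f trm list"

fun is_term :: "('f, 'p) language \<Rightarrow> 'f trm \<Rightarrow> bool" where
  "is_term L (Var i) \<longleftrightarrow> True"
| "is_term L (Fn f ts) \<longleftrightarrow> length ts = fun_arity L f \<and> (\<forall>t\<in>set ts. is_term L t)"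

fun is_atom :: "('f, 'p) language \<Rightarrow> ('f, 'p) atom \<Rightarrow> bool" where
  "is_atom L (Eq s t) \<longleftrightarrow> is_term L s \<and> is_term L t"
| "is_atom L (Rel p ts) \<longleftrightarrow> length ts = rel_arity L p \<and> (\<forall>t\<in>set ts. is_term L t)"

fun vars_term :: "'f trm \<Rightarrow> nat set" where
  "vars_term (Var i) = {i}"
| "vars_term (Fn f ts) = (\<Union>t\<in>set ts. vars_term t)"

fun vars_atom :: "('f, 'p) atom \<Rightarrow> nat set" where
  "vars_atom (Eq s t) = vars_term s \<union> vars_term t"
| "vars_atom (Rel p ts) = (\<Union>t\<in>set ts. vars_term t)"

text \<open>The universe of a structure is the type \<open>'m\<close>. An interpretation matters only on argument
  lists whose length is the arity of the symbol.\<close>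

record ('f, 'p, 'm) struct =
  fun_interp :: "'f \<Rightarrow> 'm list \<Rightarrow> 'm"
  rel_interp :: "'p \<Rightarrow> 'm list \<Rightarrow> bool"

fun eval_term :: "('f, 'p, 'm) struct \<Rightarrow> (nat \<Rightarrow> 'm) \<Rightarrow> 'f trm \<Rightarrow> 'm" where
  "eval_term M e (Var i) = e i"
| "eval_term M e (Fn f ts) = fun_interp M f (map (eval_term M e) ts)"

fun sat_atom :: "('f, 'p, 'm) struct \<Rightarrow> (nat \<Rightarrow> 'm) \<Rightarrow> ('f, 'p) atom \<Rightarrow> bool" where
  "sat_atom M e (Eq s t) \<longleftrightarrow> eval_term M e s = eval_term M e t"
| "sat_atom M e (Rel p ts) \<longleftrightarrow> rel_interp M p (map (eval_term M e) ts)"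

text \<open>Tuples in $M^r$ are lists of length \<open>r\<close>. The variables $x_1, \ldots, x_n$ are
  \<open>Var 0, \<dots>, Var (n - 1)\<close>; the list \<open>x\<close> holds their values.\<close>

definition has_functional_conceptual_substratum ::
    "('f, 'p) language \<Rightarrow> ('f, 'p, 'm) struct \<Rightarrow> nat \<Rightarrow> 'm list set \<Rightarrow> bool" where
  "has_functional_conceptual_substratum L M r \<Omega> \<longleftrightarrow>
    (\<exists>n (ts :: 'f trm list) (As :: ('f, 'p) atom list).
       length ts = r \<and>
       (\<forall>t\<in>set ts. is_term L t \<and> vars_term t \<subseteq> {..<n}) \<and>
       (\<forall>A\<in>set As. is_atom L A \<and> vars_atom A \<subseteq> {..<n}) \<and>
       (\<forall>a. length a = r \<longrightarrow>
          (a \<in> \<Omega> \<longleftrightarrow>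
             (\<exists>x. length x = n \<and>
                (\<forall>i<r. a ! i = eval_term M (nth x) (ts ! i)) \<and>
                (\<forall>A\<in>set As. sat_atom M (nth x) A)))))"


section \<open>The integers as a structure for the language of ordered rings\<close>

datatype ring_fun = Zero_sym | One_sym | Plus_sym | Minus_sym | Times_sym

datatype ring_rel = Less_sym

fun ring_fun_arity :: "ring_fun \<Rightarrow> nat" where
  "ring_fun_arity Zero_sym = 0"
| "ring_fun_arity One_sym = 0"
| "ring_fun_arity Plus_sym = 2"
| "ring_fun_arity Minus_sym = 1"
| "ring_fun_arity Times_sym = 2"

fun ring_rel_arity :: "ring_rel \<Rightarrow> nat" where
  "ring_rel_arity Less_sym = 2"

definition ordered_ring_language :: "(ring_fun, ring_rel) language" where
  "ordered_ring_language = \<lparr>fun_arity = ring_fun_arity, rel_arity = ring_rel_arity\<rparr>"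

fun int_fun_interp :: "ring_fun \<Rightarrow> int list \<Rightarrow> int" where
  "int_fun_interp Zero_sym [] = 0"
| "int_fun_interp One_sym [] = 1"
| "int_fun_interp Plus_sym [a, b] = a + b"
| "int_fun_interp Minus_sym [a] = - a"
| "int_fun_interp Times_sym [a, b] = a * b"
| "int_fun_interp _ _ = undefined"

fun int_rel_interp :: "ring_rel \<Rightarrow> int list \<Rightarrow> bool" where
  "int_rel_interp Less_sym [a, b] \<longleftrightarrow> a < b"
| "int_rel_interp _ _ \<longleftrightarrow> undefined"

definition int_struct :: "(ring_fun, ring_rel, int) struct" where
  "int_struct = \<lparr>fun_interp = int_fun_interp, rel_interp = int_rel_interp\<rparr>"


section \<open>Recursively enumerable sets\<close>

text \<open>Programs for the partial recursive functions: basic functions, composition, primitive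
  recursion (on the first argument) and unbounded minimisation (over the first argument).\<close>

datatype recf =
    RZero
  | RSucc
  | RProj nat
  | RComp recf "recf list"
  | RPrim recf recf
  | RMu recf

inductive has_arity :: "recf \<Rightarrow> nat \<Rightarrow> bool" where
  "has_arity RZero k"
| "has_arity RSucc 1"
| "i < k \<Longrightarrow> has_arity (RProj i) k"
| "has_arity f (length gs) \<Longrightarrow> (\<And>g. g \<in> set gs \<Longrightarrow> has_arity g k) \<Longrightarrow> has_arity (RComp f gs) k"
| "has_arity f k \<Longrightarrow> has_arity g (k + 2) \<Longrightarrow> has_arity (RPrim f g) (k + 1)"
| "has_arity f (k + 1) \<Longrightarrow> has_arity (RMu f) k"

text \<open>\<open>computes f xs y\<close>: the partial function given by \<open>f\<close> is defined at \<open>xs\<close> with value \<open>y\<close>.\<close>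

inductive computes :: "recf \<Rightarrow> nat list \<Rightarrow> nat \<Rightarrow> bool" where
  zero: "computes RZero xs 0"
| succ: "computes RSucc [x] (Suc x)"
| proj: "i < length xs \<Longrightarrow> computes (RProj i) xs (xs ! i)"
| comp: "list_all2 (\<lambda>g y. computes g xs y) gs ys \<Longrightarrow> computes f ys z
    \<Longrightarrow> computes (RComp f gs) xs z"
| prim_0: "computes f xs y \<Longrightarrow> computes (RPrim f g) (0 # xs) y"
| prim_Suc: "computes (RPrim f g) (n # xs) y \<Longrightarrow> computes g (n # y # xs) z
    \<Longrightarrow> computes (RPrim f g) (Suc n # xs) z"
| mu: "computes f (n # xs) 0 \<Longrightarrow> (\<And>i. i < n \<Longrightarrow> \<exists>y. computes f (i # xs) (Suc y))
    \<Longrightarrow> computes (RMu f) xs n"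

definition recursively_enumerable_nat :: "nat \<Rightarrow> nat list set \<Rightarrow> bool" where
  "recursively_enumerable_nat r S \<longleftrightarrow>
    (\<exists>f. has_arity f r \<and>
       (\<forall>xs. length xs = r \<longrightarrow> (xs \<in> S \<longleftrightarrow> (\<exists>y. computes f xs y))))"

text \<open>Computability over the integers is transported along the effective bijection
  \<open>int_encode\<close>, applied to each coordinate.\<close>

definition recursively_enumerable :: "nat \<Rightarrow> int list set \<Rightarrow> bool" where
  "recursively_enumerable r \<Omega> \<longleftrightarrow> recursively_enumerable_nat r (map int_encode ` \<Omega>)"


section \<open>Diophantine sets\<close>

text \<open>Integer polynomials in variables indexed by \<open>nat\<close>: a finitely supported map from monomials
  to coefficients, where a monomial is a finitely supported map from variables to exponents.\<close>

type_synonym int_mpoly = "(nat \<Rightarrow>\<^sub>0 nat) \<Rightarrow>\<^sub>0 int"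

definition vars_mpoly :: "int_mpoly \<Rightarrow> nat set" where
  "vars_mpoly H = (\<Union>m\<in>Poly_Mapping.keys H. Poly_Mapping.keys m)"

definition eval_mpoly :: "(nat \<Rightarrow> int) \<Rightarrow> int_mpoly \<Rightarrow> int" where
  "eval_mpoly e H =
    (\<Sum>m\<in>Poly_Mapping.keys H. Poly_Mapping.lookup H m *
       (\<Prod>i\<in>Poly_Mapping.keys m. e i ^ Poly_Mapping.lookup m i))"

text \<open>In $H(y_1, \ldots, y_r, x_1, \ldots, x_w)$ the variables $y$ have the indices below \<open>r\<close>
  and the variables $x$ the indices from \<open>r\<close> to \<open>r + w - 1\<close>.\<close>

definition diophantine :: "nat \<Rightarrow> int list set \<Rightarrow> bool" where
  "diophantine r \<Omega> \<longleftrightarrow>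
    (\<exists>w (H :: int_mpoly). vars_mpoly H \<subseteq> {..<r + w} \<and>
       (\<forall>y. length y = r \<longrightarrow>
          (y \<in> \<Omega> \<longleftrightarrow> (\<exists>x. length x = w \<and> eval_mpoly (nth (y @ x)) H = 0))))"

end

theory Submission
  imports Defs "HOL-Number_Theory.Cong"
begin

text \<open>All three notions are compared with sets of the form
  \<open>{a. \<exists>z. P(a, z) = 0}\<close>, where \<open>P\<close> is an integer polynomial and the unknowns \<open>z\<close> are natural
  numbers. A substratum takes this form because atomic formulas are polynomial equations and
  inequalities, and a sum of squares replaces their conjunction. A set of this form is recursively
  enumerable by searching for \<open>z\<close>. Conversely, induction on programs shows that the graph of every
  partial recursive function has this form. Composition is clear, and minimisation and primitive
  recursion (through digits of a number) reduce to bounded universal quantifiers. These are eliminated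
  by the Chinese remainder theorem with moduli whose product is a binomial coefficient. Binomial
  coefficients and factorials are Diophantine because exponentiation is, which follows from the
  divisibility properties of the solutions of the Pell equation. Finally, Lagrange's theorem on four
  squares turns natural unknowns into integer ones, and a polynomial equation is a substratum.\<close>

section \<open>The Pell equation\<close>

text \<open>The obstacle that shapes the proof is the bounded universal quantifier: a polynomial has
  a fixed number of unknowns, whereas the witnesses for all k up to a variable bound form a list of
  unbounded length. Coding such a list by residues needs a modulus that is a product of variably
  many factors, and expressing that product is what calls for exponentiation. Pell solutions give
  access to it because \<open>pell_y a n\<close> grows exponentially in n and yet satisfies
  congruences in which n itself occurs linearly, so that an index can be pinned down without naming
  an exponent. Unknowns are natural numbers in the middle of the proof because digits, remainders
  and size bounds need an order with a least element.\<close>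

fun pell_x :: "int \<Rightarrow> nat \<Rightarrow> int" and pell_y :: "int \<Rightarrow> nat \<Rightarrow> int" where
  "pell_x a 0 = 1"
| "pell_x a (Suc n) = a * pell_x a n + (a\<^sup>2 - 1) * pell_y a n"
| "pell_y a 0 = 0"
| "pell_y a (Suc n) = pell_x a n + a * pell_y a n"

text \<open>With d = a^2 - 1 the recursion multiplies by a + sqrt d, so
  \<open>pell_x a n + pell_y a n * sqrt d\<close> is (a + sqrt d)^n. That element has norm a^2 - d =
  1, and the norm is multiplicative.\<close>

lemma pell_equation: "(pell_x a n)\<^sup>2 = 1 + (a\<^sup>2 - 1) * (pell_y a n)\<^sup>2"
proof (induction n)
  case (Suc n)
  have "(pell_x a (Suc n))\<^sup>2 - (a\<^sup>2 - 1) * (pell_y a (Suc n))\<^sup>2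
      = (pell_x a n)\<^sup>2 - (a\<^sup>2 - 1) * (pell_y a n)\<^sup>2"
    by (simp add: power2_eq_square algebra_simps)
  then show ?case unfolding Suc by simp
qed simp

lemma
  shows pell_x_add: "pell_x a (m + n) = pell_x a m * pell_x a n + (a\<^sup>2 - 1) * pell_y a m * pell_y a n"
    and pell_y_add: "pell_y a (m + n) = pell_x a m * pell_y a n + pell_y a m * pell_x a n"
proof (induction m)
  case (Suc m)
  case 1
  show ?case unfolding add_Suc pell_x.simps Suc by (simp add: algebra_simps power2_eq_square)
  case 2
  show ?case unfolding add_Suc pell_y.simps Suc by (simp add: algebra_simps power2_eq_square)
qed simp_all

lemma pell_x_double: "pell_x a (2 * n) = 2 * (pell_x a n)\<^sup>2 - 1"
proof -
  have "pell_x a (2 * n) = (pell_x a n)\<^sup>2 + (a\<^sup>2 - 1) * (pell_y a n)\<^sup>2"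
    unfolding mult_2 pell_x_add power2_eq_square by simp
  then show ?thesis using pell_equation[of a n] by linarith
qed

lemma pell_y_double: "pell_y a (2 * n) = 2 * pell_x a n * pell_y a n"
  unfolding mult_2[of n] pell_y_add by simp

text \<open>Multiplication by the conjugate, which is the inverse because the norm is 1.\<close>

lemma pell_x_diff:
  assumes "n \<le> m"
  shows "pell_x a (m - n) = pell_x a m * pell_x a n - (a\<^sup>2 - 1) * pell_y a m * pell_y a n"
proof -
  obtain k where m: "m = n + k" using assms le_Suc_ex by blast
  have "pell_x a m * pell_x a n - (a\<^sup>2 - 1) * pell_y a m * pell_y a n
      = pell_x a k * ((pell_x a n)\<^sup>2 - (a\<^sup>2 - 1) * (pell_y a n)\<^sup>2)"
    unfolding m pell_x_add pell_y_add by (simp add: algebra_simps power2_eq_square)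
  then show ?thesis using pell_equation[of a n] m by simp
qed

lemma pell_x_pos: "a \<ge> 1 \<Longrightarrow> pell_x a n \<ge> 1"
  and pell_y_nonneg: "a \<ge> 1 \<Longrightarrow> pell_y a n \<ge> 0"
proof (induction n)
  case (Suc n)
  case 1
  have "a * pell_x a n \<ge> 1 * 1" using Suc 1 by (intro mult_mono) auto
  moreover have "(a\<^sup>2 - 1) * pell_y a n \<ge> 0" using Suc 1 by (intro mult_nonneg_nonneg) auto
  ultimately show ?case by simp
next
  case (Suc n)
  case 2
  have "a * pell_y a n \<ge> 0" using Suc 2 by (intro mult_nonneg_nonneg) auto
  then show ?case using Suc(1)[OF 2] by simp
qed auto

lemma pell_x_Suc_ge: "a \<ge> 1 \<Longrightarrow> pell_x a (Suc n) \<ge> a * pell_x a n"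
  using pell_y_nonneg[of a n] by simp

lemma pell_y_less_Suc:
  assumes "a \<ge> 1"
  shows "pell_y a n < pell_y a (Suc n)"
proof -
  have "a * pell_y a n \<ge> 1 * pell_y a n"
    using assms pell_y_nonneg by (intro mult_right_mono) auto
  then show ?thesis using pell_x_pos[OF assms, of n] by simp
qed

lemma strict_mono_pell_y: "a \<ge> 1 \<Longrightarrow> strict_mono (pell_y a)"
  unfolding strict_mono_Suc_iff using pell_y_less_Suc by blast

lemma strict_mono_pell_x:
  assumes "a \<ge> 2"
  shows "strict_mono (pell_x a)"
proof -
  have "pell_x a n < pell_x a (Suc n)" for n
  proof -
    have "a * pell_x a n \<ge> 2 * pell_x a n"
      using assms pell_x_pos[of a n] by (intro mult_right_mono) auto
    then show ?thesis using pell_x_Suc_ge[of a n] pell_x_pos[of a n] assms by linarith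
  qed
  then show ?thesis by (simp add: strict_mono_Suc_iff)
qed

lemma pell_y_ge_index: "a \<ge> 1 \<Longrightarrow> pell_y a n \<ge> int n"
proof (induction n)
  case (Suc n)
  then show ?case using pell_y_less_Suc[of a n] by simp
qed simp

lemma pell_x_ge_power: "a \<ge> 1 \<Longrightarrow> pell_x a n \<ge> a ^ n"
proof (induction n)
  case (Suc n)
  have "a * pell_x a n \<ge> a * a ^ n" using Suc by (intro mult_left_mono) auto
  then show ?case using pell_x_Suc_ge[OF Suc.prems, of n] by simp
qed simp

lemma pell_y_Suc_ge_power: "a \<ge> 1 \<Longrightarrow> pell_y a (Suc n) \<ge> a ^ n"
  using pell_x_ge_power[of a n] mult_nonneg_nonneg[OF _ pell_y_nonneg, of a a n] by simp

text \<open>Descent: dividing a solution with y > 0 by a + sqrt d gives a non-negative solution with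
  smaller y, so every solution is reached from (1, 0).\<close>

lemma pell_solutions:
  assumes "a \<ge> 2" "x \<ge> 0" "y \<ge> 0" "x\<^sup>2 = 1 + (a\<^sup>2 - 1) * y\<^sup>2"
  shows "\<exists>n. x = pell_x a n \<and> y = pell_y a n"
  using assms(2-)
proof (induction "nat y" arbitrary: x y rule: less_induct)
  case less
  show ?case
  proof (cases "y = 0")
    case True
    then have "x = 1" using less.prems by (simp add: power2_eq_1_iff)
    then show ?thesis using True by (intro exI[of _ 0]) simp
  next
    case False
    \<comment> \<open>Coordinates of (x + y sqrt d)(a - sqrt d).\<close>
    define x' y' where "x' = a * x - (a\<^sup>2 - 1) * y" and "y' = a * y - x"
    have "x'\<^sup>2 - (a\<^sup>2 - 1) * y'\<^sup>2 = x\<^sup>2 - (a\<^sup>2 - 1) * y\<^sup>2"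
      unfolding x'_def y'_def by (simp add: power2_eq_square algebra_simps)
    then have eq: "x'\<^sup>2 = 1 + (a\<^sup>2 - 1) * y'\<^sup>2" using less.prems(3) by simp
    have y: "y \<ge> 1" using False less.prems by simp
    have y2: "y\<^sup>2 \<ge> 1" using y by (rule one_le_power)
    have "x\<^sup>2 \<le> (a * y)\<^sup>2" using less.prems(3) y2 by (simp add: algebra_simps power2_eq_square)
    moreover have "a * y \<ge> 0" using assms y by simp
    ultimately have "x \<le> a * y" by (rule power2_le_imp_le)
    then have y'0: "y' \<ge> 0" unfolding y'_def by linarith
    \<comment> \<open>Lower bound on x that makes y' = a y - x drop below y.\<close>
    have "((a - 1) * y)\<^sup>2 < x\<^sup>2"
    proof -
      have "(2 * a - 2) * y\<^sup>2 \<ge> 0" using assms(1) y2 by simp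
      then show ?thesis using less.prems(3) by (simp add: algebra_simps power2_eq_square)
    qed
    then have "(a - 1) * y < x" using less.prems(1) by (rule power2_less_imp_less)
    then have y'y: "y' < y" unfolding y'_def left_diff_distrib by linarith
    have "((a\<^sup>2 - 1) * y)\<^sup>2 \<le> (a * x)\<^sup>2"
    proof -
      have "((a\<^sup>2 - 1) * y)\<^sup>2 = (a\<^sup>2 - 1) * ((a\<^sup>2 - 1) * y\<^sup>2)" by (simp add: power2_eq_square)
      also have "\<dots> = (a\<^sup>2 - 1) * (x\<^sup>2 - 1)" using less.prems(3) by simp
      also have "\<dots> = (a * x)\<^sup>2 - (a\<^sup>2 + x\<^sup>2 - 1)" by (simp add: power_mult_distrib algebra_simps)
      also have "\<dots> \<le> (a * x)\<^sup>2"
      proof -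
        have "a\<^sup>2 \<ge> 1" using assms(1) by simp
        then show ?thesis using zero_le_power2[of x] by linarith
      qed
      finally show ?thesis .
    qed
    moreover have "a * x \<ge> 0" using assms less.prems by simp
    ultimately have "(a\<^sup>2 - 1) * y \<le> a * x" by (rule power2_le_imp_le)
    then have x'0: "x' \<ge> 0" unfolding x'_def by linarith
    have "nat y' < nat y" using y'y y by simp
    then obtain n where n: "x' = pell_x a n" "y' = pell_y a n"
      using less.hyps[OF _ x'0 y'0 eq] by blast
    have "x = a * x' + (a\<^sup>2 - 1) * y'" "y = x' + a * y'"
      unfolding x'_def y'_def by (simp_all add: algebra_simps power2_eq_square)
    then show ?thesis using n by (intro exI[of _ "Suc n"]) simp
  qed
qed

section \<open>Congruences between Pell solutions\<close>

lemma pell_cong_base: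
  assumes "[a = b] (mod c)"
  shows "[pell_x a n = pell_x b n] (mod c) \<and> [pell_y a n = pell_y b n] (mod c)"
proof (induction n)
  case (Suc n)
  then show ?case using assms
    by (auto intro!: cong_add cong_mult cong_diff cong_pow)
qed simp

text \<open>Modulo a - 1 the base is 1 and a^2 - 1 vanishes, so each step adds 1 to
  \<open>pell_y\<close>. This reads the index off a value without any exponential
  expression.\<close>

lemma pell_cong_index:
  "[pell_x a n = 1] (mod (a - 1)) \<and> [pell_y a n = int n] (mod (a - 1))"
proof (induction n)
  case (Suc n)
  have a: "[a = 1] (mod (a - 1))" by (simp add: cong_iff_dvd_diff)
  have "[a\<^sup>2 - 1 = 1\<^sup>2 - 1] (mod (a - 1))" by (intro cong_diff cong_pow a cong_refl)
  then have d: "[a\<^sup>2 - 1 = 0] (mod (a - 1))" by simp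
  have "[pell_x a (Suc n) = 1 * 1 + 0 * int n] (mod (a - 1))"
    unfolding pell_x.simps using Suc by (intro cong_add cong_mult a d) auto
  moreover have "[pell_y a (Suc n) = 1 + 1 * int n] (mod (a - 1))"
    unfolding pell_y.simps using Suc by (intro cong_add cong_mult a) auto
  ultimately show ?case by (simp add: add.commute)
qed simp

lemma coprime_pell: "coprime (pell_x a n) (pell_y a n)"
proof (rule coprimeI)
  fix c assume c: "c dvd pell_x a n" "c dvd pell_y a n"
  have "c dvd (pell_x a n)\<^sup>2 - (a\<^sup>2 - 1) * (pell_y a n)\<^sup>2"
    using c by (intro dvd_diff dvd_mult) (auto simp: power2_eq_square)
  then show "is_unit c" by (simp add: pell_equation)
qed

text \<open>The binomial expansion of (x + y sqrt d)^k modulo y^2, where only the terms of degree at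
  most 1 in y survive.\<close>

lemma pell_mult_cong:
  fixes a :: int and n :: nat
  defines "y \<equiv> pell_y a n" and "x \<equiv> pell_x a n"
  shows "[pell_x a (n * k) = x ^ k] (mod y\<^sup>2) \<and> [pell_y a (n * k) = int k * x ^ (k - 1) * y] (mod y\<^sup>2)"
proof (induction k)
  case (Suc k)
  have xs: "pell_x a (n * Suc k) = (a\<^sup>2 - 1) * (y * pell_y a (n * k)) + x * pell_x a (n * k)"
    and ys: "pell_y a (n * Suc k) = pell_x a (n * k) * y + x * pell_y a (n * k)"
    unfolding x_def y_def by (simp_all add: pell_x_add pell_y_add)
  have "[y * pell_y a (n * k) = y * (int k * x ^ (k - 1) * y)] (mod y\<^sup>2)"
    using Suc by (intro cong_mult) auto
  moreover have "[y * (int k * x ^ (k - 1) * y) = 0] (mod y\<^sup>2)"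
    by (auto simp: cong_0_iff power2_eq_square)
  ultimately have 0: "[y * pell_y a (n * k) = 0] (mod y\<^sup>2)" by (rule cong_trans)
  have "[pell_x a (n * Suc k) = (a\<^sup>2 - 1) * 0 + x * x ^ k] (mod y\<^sup>2)"
    unfolding xs using Suc by (intro cong_add cong_mult 0) auto
  moreover have "[pell_y a (n * Suc k) = x ^ k * y + x * (int k * x ^ (k - 1) * y)] (mod y\<^sup>2)"
    unfolding ys using Suc by (intro cong_add cong_mult) auto
  \<comment> \<open>At k = 0 the truncated exponent k - 1 is harmless because of the factor
    k.\<close>
  moreover have "x ^ k * y + x * (int k * x ^ (k - 1) * y) = int (Suc k) * x ^ (Suc k - 1) * y"
    by (cases k) (simp_all add: algebra_simps)
  ultimately show ?case by simp
qed simp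

section \<open>Divisibility between Pell solutions\<close>

lemma pell_y_dvd_mult: "pell_y a n dvd pell_y a (n * k)"
proof (induction k)
  case (Suc k)
  then show ?case by (simp add: pell_y_add)
qed simp

text \<open>With r = m mod n the addition formula and coprimality leave \<open>pell_y a n\<close>
  dividing \<open>pell_y a r\<close>, which is smaller and hence 0.\<close>

lemma pell_y_dvd_imp_dvd:
  assumes "a \<ge> 2" "n \<ge> 1" "pell_y a n dvd pell_y a m"
  shows "n dvd m"
proof -
  define q r where "q = m div n" and "r = m mod n"
  have m: "m = n * q + r" and r: "r < n" using assms unfolding q_def r_def by auto
  have "pell_y a n dvd pell_x a (n * q) * pell_y a r + pell_y a (n * q) * pell_x a r"
    using assms(3) unfolding m pell_y_add .
  then have "pell_y a n dvd pell_x a (n * q) * pell_y a r"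
    using pell_y_dvd_mult[of a n q] by (simp add: dvd_add_left_iff)
  moreover have "coprime (pell_y a n) (pell_x a (n * q))"
    using coprime_pell[of a "n * q"] pell_y_dvd_mult[of a n q]
    by (meson coprime_commute coprime_divisors dvd_refl)
  ultimately have "pell_y a n dvd pell_y a r" by (simp add: coprime_dvd_mult_right_iff)
  moreover have "pell_y a r < pell_y a n" "pell_y a r \<ge> 0"
    using r assms strict_mono_pell_y[of a] pell_y_nonneg[of a r] by (auto simp: strict_mono_less)
  ultimately have "pell_y a r = 0" using zdvd_not_zless[of "pell_y a r" "pell_y a n"] by fastforce
  then have "r = 0" using pell_y_ge_index[of a r] assms by simp
  then show ?thesis using m by simp
qed

text \<open>Writing m = n k, \<open>pell_mult_cong\<close> leaves y dividing k x^(k - 1), and x is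
  coprime to y.\<close>

lemma pell_y_square_dvd:
  assumes "a \<ge> 2" "n \<ge> 1" "(pell_y a n)\<^sup>2 dvd pell_y a m"
  shows "pell_y a n dvd int m"
proof -
  have "pell_y a n dvd pell_y a m" using assms(3) by (auto simp: power2_eq_square dvd_mult_left)
  then have "n dvd m" by (rule pell_y_dvd_imp_dvd[OF assms(1,2)])
  then obtain k where m: "m = n * k" ..
  have "[pell_y a m = int k * pell_x a n ^ (k - 1) * pell_y a n] (mod (pell_y a n)\<^sup>2)"
    unfolding m using pell_mult_cong by blast
  then have "(pell_y a n)\<^sup>2 dvd int k * pell_x a n ^ (k - 1) * pell_y a n"
    using assms(3) by (meson cong_dvd_iff cong_sym cong_trans cong_0_iff)
  moreover have "pell_y a n > 0" using pell_y_ge_index[of a n] assms by simp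
  ultimately have "pell_y a n dvd int k * pell_x a n ^ (k - 1)" by (simp add: power2_eq_square)
  moreover have "coprime (pell_y a n) (pell_x a n ^ (k - 1))"
    using coprime_pell[of a n] by (simp add: coprime_commute)
  ultimately have "pell_y a n dvd int k" by (simp add: coprime_dvd_mult_left_iff)
  then show ?thesis unfolding m by simp
qed

text \<open>The choice k = y in \<open>pell_mult_cong\<close> supplies the second factor y.\<close>

lemma pell_y_square_dvd_self: "(pell_y a n)\<^sup>2 dvd pell_y a (n * nat (pell_y a n))"
proof (cases "pell_y a n \<ge> 0")
  case True
  have "[pell_y a (n * nat (pell_y a n))
      = int (nat (pell_y a n)) * pell_x a n ^ (nat (pell_y a n) - 1) * pell_y a n] (mod (pell_y a n)\<^sup>2)"
    using pell_mult_cong by blast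
  moreover have "(pell_y a n)\<^sup>2 dvd int (nat (pell_y a n)) * pell_x a n ^ (nat (pell_y a n) - 1) * pell_y a n"
    using True by (simp add: power2_eq_square)
  ultimately show ?thesis using cong_dvd_iff cong_sym cong_0_iff cong_trans by blast
qed simp

section \<open>Periodicity and symmetry of \<open>pell_x\<close> modulo
  \<open>pell_x a n\<close>\<close>

lemma pell_x_cong_2n_plus: "[pell_x a (2 * n + j) = - pell_x a j] (mod pell_x a n)"
proof -
  have "pell_x a (2 * n + j) - (- pell_x a j)
      = pell_x a n * (2 * pell_x a n * pell_x a j + (a\<^sup>2 - 1) * (2 * pell_y a n) * pell_y a j)"
    unfolding pell_x_add pell_x_double pell_y_double by (simp add: algebra_simps power2_eq_square)
  then show ?thesis by (simp add: cong_iff_dvd_diff)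
qed

lemma pell_x_cong_2n_minus:
  assumes "j \<le> 2 * n"
  shows "[pell_x a (2 * n - j) = - pell_x a j] (mod pell_x a n)"
proof -
  have "pell_x a (2 * n - j) - (- pell_x a j)
      = pell_x a n * (2 * pell_x a n * pell_x a j - (a\<^sup>2 - 1) * (2 * pell_y a n) * pell_y a j)"
    unfolding pell_x_diff[OF assms] pell_x_double pell_y_double
    by (simp add: algebra_simps power2_eq_square)
  then show ?thesis by (simp add: cong_iff_dvd_diff)
qed

text \<open>Modulo \<open>pell_x a n\<close> the solution of index 2 n is (-1, 0), so a shift by 2 n
  changes the sign and a shift by 4 n is a period.\<close>

lemma pell_x_cong_4n_plus: "[pell_x a (4 * n + j) = pell_x a j] (mod pell_x a n)"
proof -
  have "[pell_x a (2 * n + (2 * n + j)) = - pell_x a (2 * n + j)] (mod pell_x a n)"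
    by (rule pell_x_cong_2n_plus)
  also have "[- pell_x a (2 * n + j) = - (- pell_x a j)] (mod pell_x a n)"
    using pell_x_cong_2n_plus cong_minus_minus_iff by blast
  finally show ?thesis by (simp add: algebra_simps)
qed

lemma pell_x_cong_mod: "[pell_x a j = pell_x a (j mod (4 * n))] (mod pell_x a n)"
proof -
  have "[pell_x a (4 * n * q + r) = pell_x a r] (mod pell_x a n)" for q r
  proof (induction q)
    case (Suc q)
    have "[pell_x a (4 * n + (4 * n * q + r)) = pell_x a (4 * n * q + r)] (mod pell_x a n)"
      by (rule pell_x_cong_4n_plus)
    also note Suc
    finally show ?case by (simp add: algebra_simps)
  qed simp
  from this[of "j div (4 * n)" "j mod (4 * n)"] show ?thesis by simp
qed

text \<open>Within one period r < 4 n the residues are, up to sign, \<open>pell_x a l\<close> with l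
  <= n: positive in the outer quarters, negative in the middle half. The bound on
  \<open>pell_x a i\<close> excludes the negative ones, and the positive ones give r = i or r = 4 n
  - i.\<close>

lemma pell_x_cong_imp_index:
  assumes a: "a \<ge> 2" and ui: "2 * pell_x a i < pell_x a n"
    and c: "[pell_x a j = pell_x a i] (mod pell_x a n)"
  shows "int (4 * n) dvd int j - int i \<or> int (4 * n) dvd int j + int i"
proof -
  let ?X = "pell_x a"
  define r where "r = j mod (4 * n)"
  have xp: "?X l \<ge> 1" for l using a by (simp add: pell_x_pos)
  have inj: "?X l = ?X l' \<longleftrightarrow> l = l'" for l l' using strict_mono_pell_x[OF a] by (simp add: strict_mono_eq)
  have n: "n \<noteq> 0"
  proof
    assume "n = 0" then show False using ui xp[of i] by simp
  qed
  have r: "r < 4 * n" using n by (simp add: r_def)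
  have cr: "[?X r = ?X i] (mod ?X n)"
    using pell_x_cong_mod c cong_sym cong_trans unfolding r_def by blast
  have same: "l = i" if "l \<le> n" "[?X l = ?X i] (mod ?X n)" for l
  proof -
    have "l \<noteq> n"
    proof
      assume "l = n"
      then have "?X n dvd ?X i" using that(2) by (simp add: cong_sym_eq cong_0_iff cong_def mod_0_imp_dvd)
      then have "?X n \<le> ?X i" using xp[of i] by (intro zdvd_imp_le) auto
      then show False using ui xp[of i] by linarith
    qed
    then have "?X l < ?X n" using that strict_mono_pell_x[OF a] by (simp add: strict_mono_less)
    then have "?X l = ?X i" using that(2) xp[of l] xp[of i] ui by (simp add: cong_def)
    then show ?thesis by (simp add: inj)
  qed
  \<comment> \<open>Such a congruence forces \<open>?X n\<close> to be at most
    \<open>?X i + ?X l\<close>, yet both summands are at most half of \<open>?X n\<close>, the first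
    one strictly less.\<close>
  have opp: False if "l < n" "[- ?X l = ?X i] (mod ?X n)" for l
  proof -
    have "?X n dvd ?X i + ?X l" using that(2) by (simp add: cong_iff_dvd_diff)
      (metis add.commute dvd_minus_iff minus_add_distrib diff_conv_add_uminus)
    then have le: "?X n \<le> ?X i + ?X l" using xp[of i] xp[of l] by (intro zdvd_imp_le) auto
    have "2 * ?X l \<le> a * ?X l" using a xp[of l] by (intro mult_right_mono) auto
    also have "\<dots> \<le> ?X (Suc l)" using a by (intro pell_x_Suc_ge) simp
    also have "\<dots> \<le> ?X n"
      using that strict_mono_pell_x[OF a] by (simp add: strict_mono_less_eq del: pell_x.simps)
    finally show False using le ui by linarith
  qed
  have jr: "int (4 * n) dvd int j - int r"
    unfolding r_def by (simp add: zmod_int flip: minus_mod_eq_mult_div)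
  consider "r \<le> n" | "n < r" "r \<le> 2 * n" | "2 * n < r" "r < 3 * n" | "3 * n \<le> r" by linarith
  then show ?thesis
  proof cases
    case 1
    then have "r = i" using same cr by blast
    then show ?thesis using jr by simp
  next
    case 2
    have "[?X r = - ?X (2 * n - r)] (mod ?X n)"
      using pell_x_cong_2n_minus[of "2 * n - r" n a] 2 by simp
    then have "[- ?X (2 * n - r) = ?X i] (mod ?X n)" using cr cong_sym cong_trans by blast
    moreover have "2 * n - r < n" using 2 by linarith
    ultimately show ?thesis using opp by blast
  next
    case 3
    have "[?X r = - ?X (r - 2 * n)] (mod ?X n)"
      using pell_x_cong_2n_plus[of a n "r - 2 * n"] 3 by simp
    then have "[- ?X (r - 2 * n) = ?X i] (mod ?X n)" using cr cong_sym cong_trans by blast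
    moreover have "r - 2 * n < n" using 3 by linarith
    ultimately show ?thesis using opp by blast
  next
    case 4
    \<comment> \<open>Modulo the period r is -l: a shift by 2 n and a reflection at 2 n, each
      changing the sign.\<close>
    define l where "l = 4 * n - r"
    have "[?X r = - ?X (2 * n - l)] (mod ?X n)"
    proof -
      have "2 * n + (r - 2 * n) = r" "r - 2 * n = 2 * n - l" using 4 r by (simp_all add: l_def)
      then show ?thesis using pell_x_cong_2n_plus[of a n "r - 2 * n"] by metis
    qed
    also have "[- ?X (2 * n - l) = - (- ?X l)] (mod ?X n)"
    proof -
      have "l \<le> 2 * n" using 4 r unfolding l_def by linarith
      from pell_x_cong_2n_minus[OF this] show ?thesis using cong_minus_minus_iff by blast
    qed
    finally have "[?X r = ?X l] (mod ?X n)" by simp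
    then have "[?X l = ?X i] (mod ?X n)" using cr cong_sym cong_trans by blast
    then have "l = i" using same[of l] 4 by (simp add: l_def)
    then have eq: "int j + int i = (int j - int r) + int (4 * n)" using r by (simp add: l_def)
    have "int (4 * n) dvd int j + int i" unfolding eq using jr by (rule dvd_add) simp
    then show ?thesis ..
  qed
qed


section \<open>Exponentiation through the Pell equation\<close>

text \<open>Every term is moved to the side where it is positive, so that the equation needs no
  subtraction and can stand in a system over the natural numbers.\<close>

lemma pell_equation_nat:
  fixes a x y :: nat
  assumes "a \<ge> 2"
  shows "x\<^sup>2 + y\<^sup>2 = a\<^sup>2 * y\<^sup>2 + 1 \<longleftrightarrow> (\<exists>n. int x = pell_x (int a) n \<and> int y = pell_y (int a) n)"
proof -
  have "x\<^sup>2 + y\<^sup>2 = a\<^sup>2 * y\<^sup>2 + 1 \<longleftrightarrow> int (x\<^sup>2 + y\<^sup>2) = int (a\<^sup>2 * y\<^sup>2 + 1)"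
    by (simp only: of_nat_eq_iff)
  also have "\<dots> \<longleftrightarrow> (int x)\<^sup>2 = 1 + ((int a)\<^sup>2 - 1) * (int y)\<^sup>2"
    by (auto simp: algebra_simps)
  also have "\<dots> \<longleftrightarrow> (\<exists>n. int x = pell_x (int a) n \<and> int y = pell_y (int a) n)"
    using pell_solutions[of "int a" "int x" "int y"] pell_equation[of "int a"] assms by auto
  finally show ?thesis .
qed

text \<open>Davis's system for \<open>y = pell_y a k\<close>. Divisibility by \<open>y\<^sup>2\<close> makes the index \<open>n\<close> of the
  solution \<open>(u, v)\<close> a multiple of \<open>y\<close>. The index \<open>j\<close> of \<open>(s, t)\<close> is \<open>k\<close> modulo \<open>4 y\<close> because
  \<open>b \<equiv> 1\<close>, and it is plus or minus the index of \<open>(x, y)\<close> modulo \<open>4 n\<close> because \<open>b \<equiv> a\<close> and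
  \<open>s \<equiv> x\<close> modulo \<open>u\<close>.\<close>

lemma pell_y_imp_system:
  fixes a k y :: nat
  assumes a: "a \<ge> 2" and k: "k \<ge> 1" and y: "int y = pell_y (int a) k"
  shows "\<exists>x u v b s t. x\<^sup>2 + y\<^sup>2 = a\<^sup>2 * y\<^sup>2 + 1 \<and> u\<^sup>2 + v\<^sup>2 = a\<^sup>2 * v\<^sup>2 + 1 \<and> s\<^sup>2 + t\<^sup>2 = b\<^sup>2 * t\<^sup>2 + 1
    \<and> y\<^sup>2 dvd v \<and> v > 0 \<and> b \<ge> 2 \<and> [b = 1] (mod (4 * y)) \<and> [b = a] (mod u) \<and> [s = x] (mod u)
    \<and> [t = k] (mod (4 * y)) \<and> k \<le> y \<and> 2 * x < u"
proof -
  \<comment> \<open>The part k y yields y^2 dvd v. The 2 makes v even, hence u odd and coprime to 4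
    y as the choice of b requires, and it gives 2 k <= n, from which 2 x < u follows.\<close>
  define n where "n = 2 * (k * y)"
  define x u v where "x = nat (pell_x (int a) k)" and "u = nat (pell_x (int a) n)"
    and "v = nat (pell_y (int a) n)"
  have ia: "int a \<ge> 1" using a by simp
  have x: "int x = pell_x (int a) k" and u: "int u = pell_x (int a) n" and v: "int v = pell_y (int a) n"
    using pell_x_pos[OF ia, of k] pell_x_pos[OF ia, of n] pell_y_nonneg[OF ia, of n]
    by (simp_all add: x_def u_def v_def)
  have ky: "k \<le> y" using pell_y_ge_index[OF ia, of k] y by simp
  have e1: "x\<^sup>2 + y\<^sup>2 = a\<^sup>2 * y\<^sup>2 + 1" using pell_equation_nat[OF a] x y by blast
  have e2: "u\<^sup>2 + v\<^sup>2 = a\<^sup>2 * v\<^sup>2 + 1" using pell_equation_nat[OF a] u v by blast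
  have v2: "int v = 2 * pell_x (int a) (k * y) * pell_y (int a) (k * y)"
    unfolding v n_def pell_y_double ..
  have "(int y)\<^sup>2 dvd pell_y (int a) (k * y)"
    using pell_y_square_dvd_self[of "int a" k] y by (metis nat_int)
  then have "(int y)\<^sup>2 dvd int v" unfolding v2 by (rule dvd_mult)
  then have yv: "y\<^sup>2 dvd v" by (metis of_nat_power of_nat_dvd_iff)
  have "n \<ge> 1" using k ky by (simp add: n_def)
  then have v0: "v > 0" using pell_y_ge_index[OF ia, of n] v by simp
  have "2 * k \<le> n" unfolding n_def using k ky by (cases y) auto
  then have "pell_x (int a) (2 * k) \<le> int u"
    unfolding u using strict_mono_pell_x[of "int a"] a by (simp add: strict_mono_less_eq)
  then have "2 * (int x)\<^sup>2 - 1 \<le> int u" using pell_x_double[of "int a" k] x by simp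
  moreover have "int x \<ge> 2"
  proof -
    have "int x \<ge> int a ^ k" using pell_x_ge_power[OF ia, of k] x by simp
    moreover have "int a ^ k \<ge> int a ^ 1" using ia k by (intro power_increasing) auto
    ultimately show ?thesis using a by simp
  qed
  then have "(int x)\<^sup>2 \<ge> 2 * int x" by (simp add: power2_eq_square mult_right_mono)
  ultimately have xu: "2 * x < u" using \<open>int x \<ge> 2\<close> by linarith
  have "coprime u (4 * y)"
  proof -
    have cuv: "coprime (int u) (int v)" unfolding u v by (rule coprime_pell)
    have "even v" using v2 by (metis dvd_triv_left even_of_nat mult.assoc)
    then have "coprime u 2" using cuv by (metis coprime_int_iff coprime_divisors dvd_refl)
    moreover have "coprime u y"
      using cuv yv by (metis coprime_int_iff coprime_divisors dvd_refl dvd_trans dvd_triv_left power2_eq_square)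
    ultimately have "coprime u (2 * 2 * y)" by (simp only: coprime_mult_right_iff)
    then show ?thesis by simp
  qed
  then obtain b0 where b0: "[b0 = a] (mod u)" "[b0 = 1] (mod (4 * y))"
    using binary_chinese_remainder_nat by blast
  \<comment> \<open>A common multiple of both moduli is added to reach b >= 2.\<close>
  define b where "b = b0 + 2 * (u * (4 * y))"
  have u0: "u > 0" using xu by simp
  have "u * (4 * y) > 0" using u0 ky k by simp
  then have b2: "b \<ge> 2" unfolding b_def by linarith
  have bu: "[b = a] (mod u)" and b1: "[b = 1] (mod (4 * y))"
  proof -
    have "[b = b0 + 0] (mod u)" "[b = b0 + 0] (mod (4 * y))"
      unfolding b_def by (intro cong_add cong_refl; simp add: cong_0_iff)+
    then show "[b = a] (mod u)" "[b = 1] (mod (4 * y))" using b0 by (metis add_0_right cong_trans)+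
  qed
  define s t where "s = nat (pell_x (int b) k)" and "t = nat (pell_y (int b) k)"
  have ib: "int b \<ge> 1" using b2 by simp
  have s: "int s = pell_x (int b) k" and t: "int t = pell_y (int b) k"
    using pell_x_pos[OF ib, of k] pell_y_nonneg[OF ib, of k] by (simp_all add: s_def t_def)
  have e3: "s\<^sup>2 + t\<^sup>2 = b\<^sup>2 * t\<^sup>2 + 1" using pell_equation_nat[OF b2] s t by blast
  have "[int b = int a] (mod int u)" using bu by (simp add: cong_int_iff)
  then have "[int s = int x] (mod int u)" unfolding s x using pell_cong_base by blast
  then have sx: "[s = x] (mod u)" by (simp add: cong_int_iff)
  have "[int t = int k] (mod (int b - 1))" unfolding t using pell_cong_index by blast
  moreover have "int (4 * y) dvd int b - 1"
    using b1 by (metis cong_iff_dvd_diff cong_int_iff of_nat_1)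
  ultimately have "[int t = int k] (mod int (4 * y))" by (rule cong_dvd_modulus)
  then have tk: "[t = k] (mod (4 * y))" using cong_int_iff by blast
  show ?thesis
    by (intro exI conjI) (fact e1 e2 e3 yv v0 b2 b1 bu sx tk ky xu)+
qed

lemma system_imp_pell_y:
  fixes a k y x u v b s t :: nat
  assumes a: "a \<ge> 2" and k: "k \<ge> 1"
    and e1: "x\<^sup>2 + y\<^sup>2 = a\<^sup>2 * y\<^sup>2 + 1" and e2: "u\<^sup>2 + v\<^sup>2 = a\<^sup>2 * v\<^sup>2 + 1"
    and e3: "s\<^sup>2 + t\<^sup>2 = b\<^sup>2 * t\<^sup>2 + 1"
    and yv: "y\<^sup>2 dvd v" and v0: "v > 0" and b: "b \<ge> 2"
    and b1: "[b = 1] (mod (4 * y))" and bu: "[b = a] (mod u)" and sx: "[s = x] (mod u)"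
    and tk: "[t = k] (mod (4 * y))" and ky: "k \<le> y" and xu: "2 * x < u"
  shows "int y = pell_y (int a) k"
proof -
  obtain i where i: "int x = pell_x (int a) i" "int y = pell_y (int a) i"
    using pell_equation_nat[OF a] e1 by blast
  obtain n where n: "int u = pell_x (int a) n" "int v = pell_y (int a) n"
    using pell_equation_nat[OF a] e2 by blast
  obtain j where j: "int s = pell_x (int b) j" "int t = pell_y (int b) j"
    using pell_equation_nat[OF b] e3 by blast
  have ia: "int a \<ge> 2" using a by simp
  have i1: "i \<ge> 1" using i k ky by (cases i) auto
  have "[int b = int a] (mod int u)" using bu by (simp add: cong_int_iff)
  then have "[int s = pell_x (int a) j] (mod int u)" unfolding j using pell_cong_base by blast
  moreover have "[int s = int x] (mod int u)" using sx by (simp add: cong_int_iff)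
  ultimately have "[pell_x (int a) j = pell_x (int a) i] (mod pell_x (int a) n)"
    unfolding i(1)[symmetric] n(1)[symmetric] by (metis cong_sym cong_trans)
  moreover have "2 * pell_x (int a) i < pell_x (int a) n" using xu i n by linarith
  ultimately have ji: "int (4 * n) dvd int j - int i \<or> int (4 * n) dvd int j + int i"
    by (intro pell_x_cong_imp_index[OF ia])
  have "(pell_y (int a) i)\<^sup>2 dvd pell_y (int a) n"
    unfolding i(2)[symmetric] n(2)[symmetric] using yv by (metis of_nat_power of_nat_dvd_iff)
  then have "int y dvd int n" unfolding i(2) by (rule pell_y_square_dvd[OF ia i1])
  then have "int (4 * y) dvd int (4 * n)" by simp
  then have ji': "int (4 * y) dvd int j - int i \<or> int (4 * y) dvd int j + int i"
    using ji dvd_trans by blast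
  have "[int t = int j] (mod (int b - 1))" unfolding j using pell_cong_index by blast
  moreover have "int (4 * y) dvd int b - 1"
    using b1 by (metis cong_iff_dvd_diff cong_int_iff of_nat_1)
  ultimately have "[int t = int j] (mod int (4 * y))" by (rule cong_dvd_modulus)
  moreover have "[int t = int k] (mod int (4 * y))" using tk cong_int_iff by blast
  ultimately have "[int j = int k] (mod int (4 * y))" by (metis cong_sym cong_trans)
  then have jk: "int (4 * y) dvd int j - int k" by (simp only: cong_iff_dvd_diff)
  have iy: "int i \<le> int y" using pell_y_ge_index[of "int a" i] ia i by simp
  \<comment> \<open>The congruences for j modulo 4 n and modulo 4 y meet modulo 4 y because y
    divides n; this eliminates j.\<close>
  have "int (4 * y) dvd int k - int i \<or> int (4 * y) dvd int k + int i"
  proof (cases "int (4 * y) dvd int j - int i")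
    case True
    then have "int (4 * y) dvd (int j - int i) - (int j - int k)" using jk by (rule dvd_diff)
    then show ?thesis by simp
  next
    case False
    then have "int (4 * y) dvd (int j + int i) - (int j - int k)" using ji' jk dvd_diff by blast
    then show ?thesis by (simp add: add.commute)
  qed
  \<comment> \<open>Both indices are at most y and k is positive, so 4 y exceeds |k - i| and the
    positive number k + i: it cannot divide the sum, and it divides the difference only if that is
    0.\<close>
  then have "int k = int i"
  proof
    assume "int (4 * y) dvd int k - int i"
    moreover have "\<bar>int k - int i\<bar> < int (4 * y)" using k ky iy by linarith
    ultimately have "int k - int i = 0" using dvd_imp_le_int[of "int k - int i" "int (4 * y)"] by linarith
    then show ?thesis by simp
  next
    assume "int (4 * y) dvd int k + int i"
    then have "int (4 * y) \<le> int k + int i" using k by (intro zdvd_imp_le) auto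
    then show ?thesis using k ky iy by linarith
  qed
  then show ?thesis using i by simp
qed

text \<open>The modulus is -(p^2 - 2 a p + 1), so modulo it p is a root of t^2 - 2 a t + 1, as a +
  sqrt d is. Sending sqrt d to p - a turns (a + sqrt d)^n into p^n.\<close>

lemma pell_power_cong: "[pell_x a n = (a - p) * pell_y a n + p ^ n] (mod (2 * a * p - p\<^sup>2 - 1))"
proof (induction n)
  case (Suc n)
  let ?w = "2 * a * p - p\<^sup>2 - 1"
  have "pell_x a (Suc n) - (a - p) * pell_y a (Suc n)
      = ?w * pell_y a n + p * (pell_x a n - (a - p) * pell_y a n)"
    by (simp add: algebra_simps power2_eq_square)
  moreover have "[p * (pell_x a n - (a - p) * pell_y a n) = p * p ^ n] (mod ?w)"
    using Suc by (intro cong_mult cong_refl) (simp add: cong_iff_dvd_diff algebra_simps)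
  then have "[?w * pell_y a n + p * (pell_x a n - (a - p) * pell_y a n) = 0 + p * p ^ n] (mod ?w)"
    by (intro cong_add) (auto simp: cong_0_iff)
  ultimately have "[pell_x a (Suc n) - (a - p) * pell_y a (Suc n) = p ^ Suc n] (mod ?w)" by simp
  then show ?case unfolding cong_iff_dvd_diff by (simp add: algebra_simps)
qed simp

text \<open>The value \<open>a = pell_y (p + 2) (k + 1)\<close> is only there to be large: it makes the modulus \<open>w\<close> of
  \<open>pell_power_cong\<close> exceed \<open>p ^ k\<close>.\<close>

lemma power_iff_pell:
  fixes p k m :: nat
  assumes p: "p \<ge> 1" and k: "k \<ge> 1"
  shows "m = p ^ k \<longleftrightarrow> (\<exists>a x y w. int a = pell_y (int (p + 2)) (k + 1) \<and> int y = pell_y (int a) k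
    \<and> x\<^sup>2 + y\<^sup>2 = a\<^sup>2 * y\<^sup>2 + 1 \<and> w + p\<^sup>2 + 1 = 2 * a * p \<and> m < w \<and> [x + p * y = m + a * y] (mod w))"
    (is "_ \<longleftrightarrow> (\<exists>a x y w. ?S a x y w)")
proof -
  have key: "a \<ge> 2 \<and> p ^ k + p\<^sup>2 + 1 < 2 * a * p" if "int a = pell_y (int (p + 2)) (k + 1)" for a :: nat
  proof -
    have "int a \<ge> int (p + 2) ^ k"
      using pell_y_Suc_ge_power[of "int (p + 2)" k] that by simp
    then have "int a \<ge> int ((p + 2) ^ k)" by simp
    then have ak: "a \<ge> (p + 2) ^ k" by linarith
    have "(p + 2) ^ k \<ge> (p + 2) ^ 1" using k by (intro power_increasing) auto
    then have ap: "a \<ge> p + 2" using ak by simp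
    have "p ^ k < (p + 2) ^ k" using k by (intro power_strict_mono) auto
    then have 1: "p ^ k < a" using ak by simp
    have "a * p \<ge> (p + 2) * p" using ap by (rule mult_right_mono) simp
    then have 2: "a * p \<ge> p\<^sup>2 + 2 * p" by (simp add: power2_eq_square algebra_simps)
    have 3: "a * p \<ge> a" using p by simp
    have "2 * a * p = a * p + a * p" by simp
    then show ?thesis using 1 2 3 p ap by linarith
  qed
  have cong: "[x + p * y = p ^ k + a * y] (mod w)"
    if "int x = pell_x (int a) k" "int y = pell_y (int a) k" "w + p\<^sup>2 + 1 = 2 * a * p" for a x y w :: nat
  proof -
    have "int w + (int p)\<^sup>2 + 1 = 2 * int a * int p" using that(3)
      by (metis of_nat_1 of_nat_add of_nat_mult of_nat_numeral of_nat_power)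
    then have w: "2 * int a * int p - (int p)\<^sup>2 - 1 = int w" by linarith
    have "[int x = (int a - int p) * int y + int p ^ k] (mod int w)"
      unfolding that(1,2) w[symmetric] by (rule pell_power_cong)
    then have "[int (x + p * y) = int (p ^ k + a * y)] (mod int w)"
      unfolding cong_iff_dvd_diff by (simp add: algebra_simps)
    then show ?thesis using cong_int_iff by blast
  qed
  show ?thesis
  proof
    assume m: "m = p ^ k"
    have "pell_y (int (p + 2)) (k + 1) \<ge> 0" by (rule pell_y_nonneg) simp
    then obtain a where a: "int a = pell_y (int (p + 2)) (k + 1)" by (metis zero_le_imp_eq_int)
    have a1: "int a \<ge> 1" and a2: "a \<ge> 2" using key[OF a] by linarith+
    obtain y where y: "int y = pell_y (int a) k"
      using pell_y_nonneg[OF a1, of k] by (metis zero_le_imp_eq_int)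
    have "pell_x (int a) k \<ge> 0" using pell_x_pos[OF a1, of k] by simp
    then obtain x where x: "int x = pell_x (int a) k" by (metis zero_le_imp_eq_int)
    define w where "w = 2 * a * p - (p\<^sup>2 + 1)"
    have w: "w + p\<^sup>2 + 1 = 2 * a * p" using key[OF a] unfolding w_def by linarith
    have "x\<^sup>2 + y\<^sup>2 = a\<^sup>2 * y\<^sup>2 + 1" using pell_equation_nat[OF a2] x y by blast
    moreover have "m < w" using key[OF a] w m by linarith
    ultimately have "?S a x y w"
      unfolding m using a y w cong[OF x y w] by (intro conjI)
    then show "\<exists>a x y w. ?S a x y w" by blast
  next
    assume "\<exists>a x y w. ?S a x y w"
    then obtain a x y w where a: "int a = pell_y (int (p + 2)) (k + 1)" and y: "int y = pell_y (int a) k"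
      and e: "x\<^sup>2 + y\<^sup>2 = a\<^sup>2 * y\<^sup>2 + 1" and w: "w + p\<^sup>2 + 1 = 2 * a * p" and mw: "m < w"
      and c: "[x + p * y = m + a * y] (mod w)" by blast
    have a2: "a \<ge> 2" using key[OF a] by (rule conjunct1)
    then obtain n where n: "int x = pell_x (int a) n" "int y = pell_y (int a) n"
      using pell_equation_nat e by blast
    \<comment> \<open>The system fixes y directly; strict growth of \<open>pell_y\<close> then makes
      the Pell equation force x to be the companion of the same index.\<close>
    have "n = k" using n y strict_mono_pell_y[of "int a"] a2 by (simp add: strict_mono_eq)
    then have "[x + p * y = p ^ k + a * y] (mod w)" using cong[OF _ y w] n by simp
    then have "[m + a * y = p ^ k + a * y] (mod w)" using c by (metis cong_sym cong_trans)
    then have "[m = p ^ k] (mod w)" by (simp add: cong_add_rcancel_nat)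
    moreover have "p ^ k < w" using key[OF a] w by linarith
    ultimately show "m = p ^ k" using mw by (simp add: cong_def)
  qed
qed


section \<open>Diophantine relations over the natural numbers\<close>

text \<open>\<open>Par\<close> stands for the parameters of a relation and \<open>Unk\<close> for the existentially quantified
  unknowns. A relation is a predicate on environments \<open>nat \<Rightarrow> nat\<close>, and both environments and
  unknowns are total sequences, so no arities have to be tracked: a polynomial only looks at finitely
  many entries. Quantifiers shift the environment as with de Bruijn indices.\<close>

datatype pexp = Par nat | Unk nat | Cst int | Add pexp pexp | Mul pexp pexp

primrec peval :: "(nat \<Rightarrow> int) \<Rightarrow> (nat \<Rightarrow> int) \<Rightarrow> pexp \<Rightarrow> int" where
  "peval e z (Par i) = e i"
| "peval e z (Unk i) = z i"
| "peval e z (Cst c) = c"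
| "peval e z (Add p q) = peval e z p + peval e z q"
| "peval e z (Mul p q) = peval e z p * peval e z q"

primrec psubst :: "(nat \<Rightarrow> pexp) \<Rightarrow> (nat \<Rightarrow> pexp) \<Rightarrow> pexp \<Rightarrow> pexp" where
  "psubst s t (Par i) = s i"
| "psubst s t (Unk i) = t i"
| "psubst s t (Cst c) = Cst c"
| "psubst s t (Add p q) = Add (psubst s t p) (psubst s t q)"
| "psubst s t (Mul p q) = Mul (psubst s t p) (psubst s t q)"

primrec pars :: "pexp \<Rightarrow> nat set" where
  "pars (Par i) = {i}"
| "pars (Unk i) = {}"
| "pars (Cst c) = {}"
| "pars (Add p q) = pars p \<union> pars q"
| "pars (Mul p q) = pars p \<union> pars q"

primrec unks :: "pexp \<Rightarrow> nat set" where
  "unks (Par i) = {}"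
| "unks (Unk i) = {i}"
| "unks (Cst c) = {}"
| "unks (Add p q) = unks p \<union> unks q"
| "unks (Mul p q) = unks p \<union> unks q"

lemma peval_psubst:
  "peval e z (psubst s t p) = peval (\<lambda>i. peval e z (s i)) (\<lambda>i. peval e z (t i)) p"
  by (induction p) auto

lemma peval_cong:
  assumes "\<And>i. i \<in> pars p \<Longrightarrow> e i = e' i" "\<And>i. i \<in> unks p \<Longrightarrow> z i = z' i"
  shows "peval e z p = peval e' z' p"
  using assms by (induction p) auto

lemma finite_pars: "finite (pars p)" and finite_unks: "finite (unks p)"
  by (induction p) auto

lemma pars_bounded: "\<exists>n. pars p \<subseteq> {..<n}" and unks_bounded: "\<exists>n. unks p \<subseteq> {..<n}"
  using finite_pars[of p] finite_unks[of p] unfolding finite_nat_set_iff_bounded by auto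

lemma peval_congruence:
  assumes "\<And>i. i \<in> pars p \<Longrightarrow> [e i = e' i] (mod m)" "\<And>i. i \<in> unks p \<Longrightarrow> [z i = z' i] (mod m)"
  shows "[peval e z p = peval e' z' p] (mod m)"
  using assms by (induction p) (auto intro: cong_add cong_mult)

definition dio :: "((nat \<Rightarrow> nat) \<Rightarrow> bool) \<Rightarrow> bool" where
  "dio P \<longleftrightarrow> (\<exists>p. \<forall>e. P e \<longleftrightarrow> (\<exists>z::nat \<Rightarrow> nat. peval (\<lambda>i. int (e i)) (\<lambda>i. int (z i)) p = 0))"

text \<open>A function is handled through its graph. The value sits at entry 0 and pushes the
  arguments up by one, the same shift as for a quantifier.\<close>

definition dfun :: "((nat \<Rightarrow> nat) \<Rightarrow> nat) \<Rightarrow> bool" where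
  "dfun F \<longleftrightarrow> dio (\<lambda>e. e 0 = F (\<lambda>i. e (Suc i)))"

lemma dioI:
  assumes "\<And>e. P e \<longleftrightarrow> (\<exists>z::nat \<Rightarrow> nat. peval (\<lambda>i. int (e i)) (\<lambda>i. int (z i)) p = 0)"
  shows "dio P"
  using assms unfolding dio_def by blast

lemma dioE:
  assumes "dio P"
  obtains p where "\<And>e. P e \<longleftrightarrow> (\<exists>z::nat \<Rightarrow> nat. peval (\<lambda>i. int (e i)) (\<lambda>i. int (z i)) p = 0)"
  using assms unfolding dio_def by blast

section \<open>Closure under renaming, quantifiers, connectives and composition\<close>

lemma dio_rename:
  assumes "dio P"
  shows "dio (\<lambda>e. P (\<lambda>i. e (\<sigma> i)))"
proof -
  obtain p where p: "\<And>e. P e \<longleftrightarrow> (\<exists>z::nat \<Rightarrow> nat. peval (\<lambda>i. int (e i)) (\<lambda>i. int (z i)) p = 0)"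
    using assms by (rule dioE) blast
  show ?thesis
    by (rule dioI[where p = "psubst (\<lambda>i. Par (\<sigma> i)) Unk p"]) (simp add: p peval_psubst)
qed

lemma dio_rename':
  assumes "dio P" "\<And>e. Q e = P (\<lambda>i. e (\<sigma> i))"
  shows "dio Q"
  using dio_rename[OF assms(1), of \<sigma>] unfolding assms(2)[symmetric] .

definition interleave :: "(nat \<Rightarrow> 'a) \<Rightarrow> (nat \<Rightarrow> 'a) \<Rightarrow> nat \<Rightarrow> 'a" where
  "interleave f g i = (if even i then f (i div 2) else g (i div 2))"

lemma interleave_simps [simp]: "interleave f g (2 * i) = f i" "interleave f g (Suc (2 * i)) = g i"
  by (auto simp: interleave_def)

lemma ex_pair_iff_ex_interleave:
  "(\<exists>z w. Q z w) \<longleftrightarrow> (\<exists>v::nat \<Rightarrow> 'a. Q (\<lambda>i. v (2 * i)) (\<lambda>i. v (Suc (2 * i))))"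
proof
  assume "\<exists>z w. Q z w"
  then obtain z w where "Q z w" by blast
  then show "\<exists>v::nat \<Rightarrow> 'a. Q (\<lambda>i. v (2 * i)) (\<lambda>i. v (Suc (2 * i)))"
    by (intro exI[of _ "interleave z w"]) simp
qed blast

text \<open>In the hypothesis, even entries of the environment are parameters and odd entries the
  sequence to be quantified; the odd ones are turned into additional unknowns of the
  polynomial.\<close>

lemma dio_ex_seq:
  assumes "dio (\<lambda>e. Q (\<lambda>i. e (2 * i)) (\<lambda>i. e (Suc (2 * i))))"
  shows "dio (\<lambda>e. \<exists>z::nat \<Rightarrow> nat. Q e z)"
proof -
  obtain p where p: "\<And>e. Q (\<lambda>i. e (2 * i)) (\<lambda>i. e (Suc (2 * i)))
      \<longleftrightarrow> (\<exists>w::nat \<Rightarrow> nat. peval (\<lambda>i. int (e i)) (\<lambda>i. int (w i)) p = 0)"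
    using assms by (rule dioE) blast
  have q: "Q e z \<longleftrightarrow> (\<exists>w::nat \<Rightarrow> nat. peval (\<lambda>i. int (interleave e z i)) (\<lambda>i. int (w i)) p = 0)" for e z
    using p[of "interleave e z"] by simp
  have "(\<exists>z. Q e z) \<longleftrightarrow> (\<exists>z w. peval (\<lambda>i. int (interleave e z i)) (\<lambda>i. int (w i)) p = 0)" for e
    using q by simp
  then have ex: "(\<exists>z. Q e z) \<longleftrightarrow> (\<exists>v. peval (\<lambda>i. int (interleave e (\<lambda>i. v (2 * i)) i))
      (\<lambda>i. int (v (Suc (2 * i)))) p = 0)" for e
    unfolding ex_pair_iff_ex_interleave .
  have int: "int (interleave e (\<lambda>i. v (2 * i)) i)
      = peval (\<lambda>i. int (e i)) (\<lambda>i. int (v i)) (interleave Par (\<lambda>i. Unk (2 * i)) i)" for e v i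
    by (simp add: interleave_def)
  show ?thesis
    by (rule dioI[where p = "psubst (interleave Par (\<lambda>i. Unk (2 * i))) (\<lambda>i. Unk (Suc (2 * i))) p"])
      (simp add: ex peval_psubst flip: int)
qed

lemma dio_ex:
  assumes "dio (\<lambda>e. Q (\<lambda>i. e (Suc i)) (e 0))"
  shows "dio (\<lambda>e. \<exists>x. Q e x)"
proof -
  have "dio (\<lambda>e. Q (\<lambda>i. e (2 * i)) (e (Suc (2 * 0))))"
    using dio_rename[OF assms, of "case_nat (Suc (2 * 0)) (\<lambda>i. 2 * i)"] by simp
  then have "dio (\<lambda>e. \<exists>z::nat \<Rightarrow> nat. Q e (z 0))"
    using dio_ex_seq[of "\<lambda>e z. Q e (z 0)"] by simp
  moreover have "(\<exists>z::nat \<Rightarrow> nat. Q e (z 0)) \<longleftrightarrow> (\<exists>x. Q e x)" for e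
  proof
    assume "\<exists>x. Q e x"
    then obtain x where "Q e x" ..
    then show "\<exists>z::nat \<Rightarrow> nat. Q e (z 0)" by (intro exI[of _ "\<lambda>_. x"])
  qed blast
  ultimately show ?thesis by simp
qed

text \<open>The unknowns of the two polynomials move to even and odd indices, so that they can be
  chosen independently.\<close>

lemma dio_conj:
  assumes "dio P" "dio Q"
  shows "dio (\<lambda>e. P e \<and> Q e)"
proof -
  obtain p where p: "\<And>e. P e \<longleftrightarrow> (\<exists>z::nat \<Rightarrow> nat. peval (\<lambda>i. int (e i)) (\<lambda>i. int (z i)) p = 0)"
    using assms(1) by (rule dioE) blast
  obtain q where q: "\<And>e. Q e \<longleftrightarrow> (\<exists>z::nat \<Rightarrow> nat. peval (\<lambda>i. int (e i)) (\<lambda>i. int (z i)) q = 0)"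
    using assms(2) by (rule dioE) blast
  have *: "P e \<and> Q e \<longleftrightarrow> (\<exists>z w::nat \<Rightarrow> nat. peval (\<lambda>i. int (e i)) (\<lambda>i. int (z i)) p = 0
      \<and> peval (\<lambda>i. int (e i)) (\<lambda>i. int (w i)) q = 0)" for e
    using p q by blast
  let ?p = "psubst Par (\<lambda>i. Unk (2 * i)) p" and ?q = "psubst Par (\<lambda>i. Unk (Suc (2 * i))) q"
  show ?thesis
    by (rule dioI[where p = "Add (Mul ?p ?p) (Mul ?q ?q)"], unfold * ex_pair_iff_ex_interleave)
      (simp add: peval_psubst sum_squares_eq_zero_iff)
qed

text \<open>A product vanishes when one factor does. Unlike for conjunction the factors may share
  their unknowns, since existence distributes over disjunction.\<close>

lemma dio_disj:
  assumes "dio P" "dio Q"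
  shows "dio (\<lambda>e. P e \<or> Q e)"
proof -
  obtain p where p: "\<And>e. P e \<longleftrightarrow> (\<exists>z::nat \<Rightarrow> nat. peval (\<lambda>i. int (e i)) (\<lambda>i. int (z i)) p = 0)"
    using assms(1) by (rule dioE) blast
  obtain q where q: "\<And>e. Q e \<longleftrightarrow> (\<exists>z::nat \<Rightarrow> nat. peval (\<lambda>i. int (e i)) (\<lambda>i. int (z i)) q = 0)"
    using assms(2) by (rule dioE) blast
  show ?thesis by (rule dioI[where p = "Mul p q"]) (auto simp: p q)
qed

lemma dio_triv: "dio (\<lambda>e. b)"
  by (rule dioI[where p = "Cst (if b then 0 else 1)"]) simp

lemma dio_all_less:
  fixes n :: nat
  assumes "\<And>i. i < n \<Longrightarrow> dio (P i)"
  shows "dio (\<lambda>e. \<forall>i<n. P i e)"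
  using assms
proof (induction n)
  case (Suc n)
  then have "dio (\<lambda>e. P n e \<and> (\<forall>i<n. P i e))" by (intro dio_conj) auto
  then show ?case unfolding All_less_Suc .
qed (simp add: dio_triv)

lemma dfunD: "dfun F \<Longrightarrow> dio (\<lambda>e. e i = F (\<lambda>j. e (\<sigma> j)))"
  unfolding dfun_def by (erule dio_rename'[where \<sigma> = "case_nat i \<sigma>"]) simp

text \<open>Infinitely many functions may be substituted because the polynomial reads only the first
  n entries: their values are quantified as a sequence w, of which P sees no more than those
  n.\<close>

lemma dio_comp:
  assumes "dio P" "\<And>i. dfun (\<lambda>e. S e i)"
  shows "dio (\<lambda>e. P (S e))"
proof -
  obtain p where p: "\<And>e. P e \<longleftrightarrow> (\<exists>z::nat \<Rightarrow> nat. peval (\<lambda>i. int (e i)) (\<lambda>i. int (z i)) p = 0)"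
    using assms(1) by (rule dioE) blast
  obtain n where n: "pars p \<subseteq> {..<n}" using pars_bounded by blast
  have P: "P w \<longleftrightarrow> P w'" if "\<forall>i<n. w i = w' i" for w w'
  proof -
    have "peval (\<lambda>i. int (w i)) z p = peval (\<lambda>i. int (w' i)) z p" for z
      using n that by (intro peval_cong) auto
    then show ?thesis by (simp add: p)
  qed
  have *: "(\<exists>w. (\<forall>i<n. w i = S e i) \<and> P w) \<longleftrightarrow> P (S e)" for e
    using P by blast
  have "dio (\<lambda>e. \<exists>w. (\<forall>i<n. w i = S e i) \<and> P w)"
    by (intro dio_ex_seq dio_conj dio_all_less dfunD assms dio_rename[OF assms(1)])
  then show ?thesis unfolding * .
qed

lemma dio_rel2:
  assumes "dio (\<lambda>e. R (e 0) (e 1))" "dfun F" "dfun G"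
  shows "dio (\<lambda>e. R (F e) (G e))"
proof -
  have "dfun (\<lambda>e. case_nat (F e) (\<lambda>i. G e) i)" for i
    using assms(2,3) by (cases i) auto
  from dio_comp[OF assms(1), of "\<lambda>e. case_nat (F e) (\<lambda>i. G e)", OF this] show ?thesis by simp
qed

lemma dio_rel3:
  assumes "dio (\<lambda>e. R (e 0) (e 1) (e 2))" "dfun F" "dfun G" "dfun H"
  shows "dio (\<lambda>e. R (F e) (G e) (H e))"
proof -
  have "dfun (\<lambda>e. case_nat (F e) (case_nat (G e) (\<lambda>i. H e)) i)" for i
  proof (cases i)
    case (Suc j)
    then show ?thesis using assms(3,4) by (cases j) auto
  qed (use assms(2) in simp)
  from dio_comp[OF assms(1), of "\<lambda>e. case_nat (F e) (case_nat (G e) (\<lambda>i. H e))", OF this]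
  show ?thesis by (simp add: numeral_2_eq_2)
qed

section \<open>Elementary Diophantine functions and relations\<close>

lemma dfun_var: "dfun (\<lambda>e. e i)"
  unfolding dfun_def
  by (rule dioI[where p = "Add (Par 0) (Mul (Cst (-1)) (Par (Suc i)))"]) simp

lemma dio_subst:
  assumes "dio (\<lambda>e. Q (\<lambda>i. e (Suc i)) (e 0))" "dfun F"
  shows "dio (\<lambda>e. Q e (F e))"
proof -
  have "dfun (\<lambda>e. case_nat (F e) e i)" for i
    using assms(2) dfun_var by (cases i) auto
  from dio_comp[OF assms(1), of "\<lambda>e. case_nat (F e) e", OF this] show ?thesis by simp
qed

lemma dfun_comp:
  assumes "dfun F" "\<And>i. dfun (\<lambda>e. S e i)"
  shows "dfun (\<lambda>e. F (S e))"
proof -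
  have S: "dfun (\<lambda>e. S (\<lambda>i. e (Suc i)) i)" for i
    using dio_rename'[OF assms(2)[unfolded dfun_def], where \<sigma> = "case_nat 0 (\<lambda>i. Suc (Suc i))"]
    unfolding dfun_def by simp
  have "dfun (\<lambda>e. case_nat (e 0) (S (\<lambda>i. e (Suc i))) i)" for i
    using S dfun_var by (cases i) auto
  from dio_comp[OF assms(1)[unfolded dfun_def], of "\<lambda>e. case_nat (e 0) (S (\<lambda>i. e (Suc i)))", OF this]
  show ?thesis unfolding dfun_def by simp
qed

lemma dfun_2:
  assumes "dio (\<lambda>e. e 0 = f (e 1) (e 2))" "dfun F" "dfun G"
  shows "dfun (\<lambda>e. f (F e) (G e))"
proof -
  have "dfun (\<lambda>e. f (e 0) (e 1))" using assms(1) by (simp add: dfun_def numeral_2_eq_2)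
  moreover have "dfun (\<lambda>e. case_nat (F e) (\<lambda>i. G e) i)" for i using assms by (cases i) auto
  ultimately show ?thesis
    using dfun_comp[of "\<lambda>e. f (e 0) (e 1)" "\<lambda>e. case_nat (F e) (\<lambda>i. G e)"] by simp
qed

lemma dfun_const: "dfun (\<lambda>e. c)"
  unfolding dfun_def
  by (rule dioI[where p = "Add (Par 0) (Cst (- int c))"]) simp

lemma dfun_add: "dfun F \<Longrightarrow> dfun G \<Longrightarrow> dfun (\<lambda>e. F e + G e)"
  by (rule dfun_2[where f = "(+)"],
      rule dioI[where p = "Add (Par 0) (Mul (Cst (-1)) (Add (Par 1) (Par 2)))"])
    (simp_all flip: of_nat_add of_nat_mult)

lemma dfun_mult: "dfun F \<Longrightarrow> dfun G \<Longrightarrow> dfun (\<lambda>e. F e * G e)"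
  by (rule dfun_2[where f = "(*)"],
      rule dioI[where p = "Add (Par 0) (Mul (Cst (-1)) (Mul (Par 1) (Par 2)))"])
    (simp_all flip: of_nat_add of_nat_mult)

lemma dfun_Suc: "dfun F \<Longrightarrow> dfun (\<lambda>e. Suc (F e))"
  using dfun_add[OF dfun_const[of 1]] by simp

lemma dfun_square: "dfun F \<Longrightarrow> dfun (\<lambda>e. (F e)\<^sup>2)"
  unfolding power2_eq_square by (rule dfun_mult)

lemma dio_eq: "dfun F \<Longrightarrow> dfun G \<Longrightarrow> dio (\<lambda>e. F e = G e)"
  by (rule dio_rel2[where R = "(=)"], rule dioI[where p = "Add (Par 0) (Mul (Cst (-1)) (Par 1))"]) simp_all

lemma dio_le:
  assumes "dfun F" "dfun G"
  shows "dio (\<lambda>e. F e \<le> G e)"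
proof -
  have "dio (\<lambda>e. \<exists>w. e 0 + w = e 1)" by (intro dio_ex dio_eq dfun_add dfun_var)
  then show ?thesis using dio_rel2[where R = "(\<le>)"] assms by (simp add: le_iff_add eq_commute)
qed

lemma dio_less: "dfun F \<Longrightarrow> dfun G \<Longrightarrow> dio (\<lambda>e. F e < G e)"
  unfolding Suc_le_eq[symmetric] by (intro dio_le dfun_Suc)

lemma dio_dvd:
  assumes "dfun F" "dfun G"
  shows "dio (\<lambda>e. F e dvd G e)"
proof -
  have "dio (\<lambda>e. \<exists>w. e 1 = e 0 * w)" by (intro dio_ex dio_eq dfun_mult dfun_var)
  then show ?thesis using dio_rel2[where R = "(dvd)"] assms by (simp add: dvd_def)
qed

lemma dio_cong:
  assumes "dfun F" "dfun G" "dfun H"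
  shows "dio (\<lambda>e. [F e = G e] (mod H e))"
proof -
  have "dio (\<lambda>e. \<exists>v w. e 1 + v * e 2 = e 0 + w * e 2)"
    by (intro dio_ex dio_eq dfun_add dfun_mult dfun_var)
  then show ?thesis using dio_rel3[where R = "\<lambda>a b m. [a = b] (mod m)"] assms
    unfolding cong_iff_lin_nat by blast
qed

lemmas dio_intros = dio_ex dio_conj dio_disj dio_eq dio_le dio_less dio_dvd dio_cong
  dfun_add dfun_mult dfun_Suc dfun_square dfun_var dfun_const

lemma dfun_diff:
  assumes "dfun F" "dfun G"
  shows "dfun (\<lambda>e. F e - G e)"
proof -
  have "dio (\<lambda>e. e 1 = e 2 + e 0 \<or> e 1 < e 2 \<and> e 0 = 0)" by (intro dio_intros)
  moreover have "e 1 = e 2 + e 0 \<or> e 1 < e 2 \<and> e 0 = 0 \<longleftrightarrow> e 0 = e 1 - e 2" for e :: "nat \<Rightarrow> nat" by auto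
  ultimately show ?thesis using dfun_2[where f = "(-)"] assms by simp
qed

lemma dfun_div:
  assumes "dfun F" "dfun G"
  shows "dfun (\<lambda>e. F e div G e)"
proof -
  \<comment> \<open>The first disjunct covers the convention that division by 0 gives 0.\<close>
  have "dio (\<lambda>e. e 2 = 0 \<and> e 0 = 0 \<or> (\<exists>r. e 1 = e 0 * e 2 + r \<and> r < e 2))" by (intro dio_intros)
  moreover have "e 2 = 0 \<and> e 0 = 0 \<or> (\<exists>r. e 1 = e 0 * e 2 + r \<and> r < e 2) \<longleftrightarrow> e 0 = e 1 div e 2"
    for e :: "nat \<Rightarrow> nat"
    by (cases "e 2 = 0") (auto intro!: exI[of _ "e 1 mod e 2"])
  ultimately show ?thesis using dfun_2[where f = "(div)"] assms by simp
qed

lemma dfun_mod: "dfun F \<Longrightarrow> dfun G \<Longrightarrow> dfun (\<lambda>e. F e mod G e)"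
  unfolding modulo_nat_def by (intro dfun_diff dfun_mult dfun_div)

text \<open>The bounds on base and index are part of the relation because the system has been shown
  to characterise \<open>pell_y\<close> under them.\<close>

lemma dio_pell_y:
  assumes "dfun A" "dfun K" "dfun Y"
  shows "dio (\<lambda>e. A e \<ge> 2 \<and> K e \<ge> 1 \<and> int (Y e) = pell_y (int (A e)) (K e))"
proof -
  have "dio (\<lambda>e. 2 \<le> e 0 \<and> 1 \<le> e 1 \<and>
     (\<exists>x u v b s t. x\<^sup>2 + (e 2)\<^sup>2 = (e 0)\<^sup>2 * (e 2)\<^sup>2 + 1 \<and> u\<^sup>2 + v\<^sup>2 = (e 0)\<^sup>2 * v\<^sup>2 + 1 \<and> s\<^sup>2 + t\<^sup>2 = b\<^sup>2 * t\<^sup>2 + 1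
    \<and> (e 2)\<^sup>2 dvd v \<and> v > 0 \<and> b \<ge> 2 \<and> [b = 1] (mod (4 * e 2)) \<and> [b = e 0] (mod u) \<and> [s = x] (mod u)
    \<and> [t = e 1] (mod (4 * e 2)) \<and> e 1 \<le> e 2 \<and> 2 * x < u))"
    by (intro dio_intros)
  moreover have "(\<exists>x u v b s t. x\<^sup>2 + y\<^sup>2 = a\<^sup>2 * y\<^sup>2 + 1 \<and> u\<^sup>2 + v\<^sup>2 = a\<^sup>2 * v\<^sup>2 + 1 \<and> s\<^sup>2 + t\<^sup>2 = b\<^sup>2 * t\<^sup>2 + 1
    \<and> y\<^sup>2 dvd v \<and> v > 0 \<and> b \<ge> 2 \<and> [b = 1] (mod (4 * y)) \<and> [b = a] (mod u) \<and> [s = x] (mod u)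
    \<and> [t = k] (mod (4 * y)) \<and> k \<le> y \<and> 2 * x < u) \<longleftrightarrow> int y = pell_y (int a) k"
    if "2 \<le> a" "1 \<le> k" for a k y :: nat
    using pell_y_imp_system[OF that, of y] system_imp_pell_y[OF that, of _ y]
    by (intro iffI) (elim exE conjE, assumption?, blast+)
  ultimately have "dio (\<lambda>e. 2 \<le> e 0 \<and> 1 \<le> e 1 \<and> int (e 2) = pell_y (int (e 0)) (e 1))"
    by (simp cong: conj_cong)
  from dio_rel3[where R = "\<lambda>a k y. 2 \<le> a \<and> 1 \<le> k \<and> int y = pell_y (int a) k", OF this assms]
  show ?thesis .
qed

lemma dfun_power:
  assumes "dfun F" "dfun G"
  shows "dfun (\<lambda>e. F e ^ G e)"
proof -
  \<comment> \<open>The conjuncts \<open>p + 2 \<ge> 2\<close>, \<open>k + 1 \<ge> 1\<close> and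
    \<open>a \<ge> 2\<close> add nothing to the meaning; they give both Pell conditions the shape of
    \<open>dio_pell_y\<close>.\<close>
  let ?S = "\<lambda>m p k. (\<exists>a x y w. (p + 2 \<ge> 2 \<and> k + 1 \<ge> 1 \<and> int a = pell_y (int (p + 2)) (k + 1))
    \<and> (a \<ge> 2 \<and> k \<ge> 1 \<and> int y = pell_y (int a) k)
    \<and> x\<^sup>2 + y\<^sup>2 = a\<^sup>2 * y\<^sup>2 + 1 \<and> w + p\<^sup>2 + 1 = 2 * a * p \<and> m < w \<and> [x + p * y = m + a * y] (mod w))"
  \<comment> \<open>Exponent 0 and base 0 lie outside \<open>power_iff_pell\<close> and are listed
    separately; 0 ^ 0 = 1 falls under the first disjunct.\<close>
  have "dio (\<lambda>e. e 2 = 0 \<and> e 0 = 1 \<or> e 2 \<ge> 1 \<and> e 1 = 0 \<and> e 0 = 0 \<or> e 2 \<ge> 1 \<and> e 1 \<ge> 1 \<and> ?S (e 0) (e 1) (e 2))"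
    by (intro dio_intros dio_pell_y)
  moreover have "k = 0 \<and> m = 1 \<or> k \<ge> 1 \<and> p = 0 \<and> m = 0 \<or> k \<ge> 1 \<and> p \<ge> 1 \<and> ?S m p k \<longleftrightarrow> m = p ^ k"
    for m p k :: nat
  proof (cases "p \<ge> 1 \<and> k \<ge> 1")
    case True
    have "a \<ge> 2" if "int a = pell_y (int (p + 2)) (k + 1)" for a
      using that pell_y_ge_index[of "int (p + 2)" "k + 1"] True by simp
    then have "?S m p k \<longleftrightarrow> m = p ^ k"
      unfolding power_iff_pell[OF conjunct1[OF True] conjunct2[OF True]]
      using True by (intro ex_cong1) (simp, blast)
    then show ?thesis using True by simp
  qed auto
  ultimately show ?thesis using dfun_2[where f = "(^)"] assms by simp
qed


section \<open>Binomial coefficients and factorials\<close>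

lemma sum_digits_less:
  fixes d :: "nat \<Rightarrow> nat"
  assumes "\<And>i. i < k \<Longrightarrow> d i < b"
  shows "(\<Sum>i<k. d i * b ^ i) < b ^ k"
  using assms
proof (induction k)
  case (Suc k)
  then have "(\<Sum>i<k. d i * b ^ i) < b ^ k" by simp
  moreover have "Suc (d k) * b ^ k \<le> b * b ^ k" using Suc.prems[of k] by (intro mult_right_mono) auto
  ultimately show ?case by simp
qed simp

lemma digit_sum_digits:
  fixes d :: "nat \<Rightarrow> nat"
  assumes d: "\<And>i. i < n \<Longrightarrow> d i < b" and k: "k < n"
  shows "(\<Sum>i<n. d i * b ^ i) div b ^ k mod b = d k"
proof -
  have b: "b > 0" using d[OF k] by simp
  have "(\<Sum>i<n. d i * b ^ i) = (\<Sum>i<k. d i * b ^ i) + (\<Sum>i=k..<n. d i * b ^ i)"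
    using k by (simp add: lessThan_atLeast0 sum.atLeastLessThan_concat)
  also have "(\<Sum>i=k..<n. d i * b ^ i) = d k * b ^ k + (\<Sum>i=Suc k..<n. d i * b ^ i)"
    using k by (simp add: sum.atLeast_Suc_lessThan)
  also have "(\<Sum>i=Suc k..<n. d i * b ^ i) = b ^ k * (b * (\<Sum>i=Suc k..<n. d i * b ^ (i - Suc k)))"
    unfolding sum_distrib_left
  proof (intro sum.cong refl)
    fix i assume "i \<in> {Suc k..<n}"
    then have "b ^ i = b ^ (k + 1 + (i - Suc k))" by simp
    then show "d i * b ^ i = b ^ k * (b * (d i * b ^ (i - Suc k)))" by (simp only: power_add) simp
  qed
  finally have "(\<Sum>i<n. d i * b ^ i)
      = (\<Sum>i<k. d i * b ^ i) + b ^ k * (d k + b * (\<Sum>i=Suc k..<n. d i * b ^ (i - Suc k)))"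
    by (simp add: algebra_simps)
  moreover have "(\<Sum>i<k. d i * b ^ i) < b ^ k" using d k by (intro sum_digits_less) auto
  ultimately have "(\<Sum>i<n. d i * b ^ i) div b ^ k = d k + b * (\<Sum>i=Suc k..<n. d i * b ^ (i - Suc k))"
    using b by (simp add: div_add)
  then show ?thesis using d[OF k] by simp
qed

lemma finite_sequence_digits:
  fixes w :: "nat \<Rightarrow> nat"
  shows "\<exists>x b. \<forall>i\<le>n. x div b ^ i mod b = w i"
proof -
  define b where "b = Suc (\<Sum>i\<le>n. w i)"
  have "w i < b" if "i < Suc n" for i
    using that member_le_sum[of i "{..n}" w] by (simp add: b_def)
  then have "\<forall>i\<le>n. (\<Sum>i<Suc n. w i * b ^ i) div b ^ i mod b = w i"
    using digit_sum_digits[of "Suc n" w b] by simp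
  then show ?thesis by blast
qed

text \<open>The base B = 2^n + 1 exceeds every coefficient in row n, so the base B digits of (B +
  1)^n are the binomial coefficients.\<close>

lemma binomial_eq_digit: "n choose k = (2 ^ n + 1 + 1) ^ n div (2 ^ n + 1) ^ k mod (2 ^ n + 1)"
proof -
  have "((2::nat) ^ n + 1 + 1) ^ n = (\<Sum>i\<le>n. (n choose i) * (2 ^ n + 1) ^ i)"
    using binomial[of "2 ^ n + 1" "1::nat" n] by simp
  \<comment> \<open>Padding with zero coefficients makes digit k available also for k > n.\<close>
  also have "\<dots> = (\<Sum>i<n + k + 1. (n choose i) * (2 ^ n + 1) ^ i)"
    by (rule sum.mono_neutral_left) (auto simp: not_le)
  finally have eq: "((2::nat) ^ n + 1 + 1) ^ n = (\<Sum>i<n + k + 1. (n choose i) * (2 ^ n + 1) ^ i)" .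
  have "n choose i < 2 ^ n + 1" for i
  proof (cases "i \<le> n")
    case True
    have "n choose i \<le> (\<Sum>i\<le>n. n choose i)" using True by (intro member_le_sum) auto
    then show ?thesis by (simp add: choose_row_sum)
  qed (simp add: binomial_eq_0)
  then show ?thesis unfolding eq by (subst digit_sum_digits) auto
qed

lemma dfun_binomial: "dfun F \<Longrightarrow> dfun G \<Longrightarrow> dfun (\<lambda>e. F e choose G e)"
  unfolding binomial_eq_digit
  by (intro dfun_mod dfun_div dfun_power dfun_add dfun_const)

section \<open>Factorials from binomial coefficients\<close>

lemma fact_Suc_binomial: "(fact (Suc j) :: nat) * (r choose Suc j) = fact j * (r choose j) * (r - j)"
proof -
  have "Suc j * (r choose Suc j) = (r - j) * (r choose j)"
  proof (cases r)
    case (Suc m)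
    then show ?thesis
      using Suc_times_binomial_eq[of m j] binomial_absorb_comp[of r j] by (metis diff_Suc_1 mult.commute)
  qed simp
  then have "fact j * (Suc j * (r choose Suc j)) = fact j * ((r - j) * (r choose j))" by (rule arg_cong)
  then show ?thesis unfolding fact_Suc by (simp only: of_nat_id mult_ac)
qed

text \<open>The falling factorial. For j > r both sides are 0, the right one because it contains the
  factor r - r.\<close>

lemma fact_binomial_eq_prod: "fact j * (r choose j) = (\<Prod>i<j. r - i)"
  by (induction j) (simp_all only: fact_Suc_binomial prod.lessThan_Suc, simp_all)

lemma prod_falling_le_power: "(\<Prod>i<j. r - i) \<le> (r::nat) ^ j"
  using prod_mono[of "{..<j}" "\<lambda>i. r - i" "\<lambda>i. r"] by simp

text \<open>A Bernoulli bound: the falling factorial is at least r^j (1 - j n / r), multiplied by r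
  to avoid fractions. Each factor r - i loses at most n against r.\<close>

lemma power_le_prod_falling:
  fixes r :: nat
  assumes "j \<le> n"
  shows "r ^ j * r \<le> (\<Prod>i<j. r - i) * r + j * n * r ^ j"
  using assms
proof (induction j)
  case (Suc j)
  let ?P = "\<Prod>i<j. r - i"
  have "?P * r \<le> ?P * ((r - j) + j)" by (rule mult_left_mono) auto
  then have "?P * r \<le> ?P * (r - j) + ?P * j" by (simp only: distrib_left)
  also have "?P * j \<le> r ^ j * n" using Suc.prems prod_falling_le_power by (intro mult_mono) auto
  finally have "?P * r \<le> ?P * (r - j) + r ^ j * n" by simp
  then have "?P * r * r \<le> (?P * (r - j) + r ^ j * n) * r" by (rule mult_right_mono) (rule le0)
  moreover have "r ^ j * r * r \<le> (?P * r + j * n * r ^ j) * r" using Suc by (intro mult_right_mono) auto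
  ultimately show ?case by (simp add: algebra_simps)
qed simp

text \<open>As r grows, r^n / (r choose n) tends to n! from above, so its floor is n! once the
  excess is below 1. This needs (n! + 1) n^2 < r; the choice of r uses n^n in place of n! because
  powers are already known to be Diophantine.\<close>

lemma fact_eq_div_binomial:
  fixes n :: nat
  defines "r \<equiv> (n ^ n + 1) * n\<^sup>2 + 1"
  shows "fact n = r ^ n div (r choose n)"
proof -
  let ?P = "\<Prod>i<n. r - i"
  have P: "fact n * (r choose n) = ?P" by (rule fact_binomial_eq_prod)
  have lower: "fact n * (r choose n) \<le> r ^ n" unfolding P by (rule prod_falling_le_power)
  have "fact n * r ^ n * r < (fact n + 1) * ?P * r"
  proof -
    have "fact n \<le> n ^ n" using fact_le_power[of n, where 'a = nat] by simp
    then have "(fact n + 1) * n\<^sup>2 < r" unfolding r_def by (simp add: le_imp_less_Suc add_mono)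
    then have "r ^ n * ((fact n + 1) * n\<^sup>2) < r ^ n * r" by (rule mult_strict_left_mono) (simp add: r_def)
    moreover have "(fact n + 1) * (r ^ n * r) \<le> (fact n + 1) * (?P * r + n * n * r ^ n)"
      by (intro mult_left_mono power_le_prod_falling) auto
    ultimately show ?thesis by (simp add: algebra_simps power2_eq_square)
  qed
  then have "fact n * r ^ n < (fact n + 1) * ?P" by (rule mult_right_less_imp_less) simp
  then have "fact n * r ^ n < fact n * ((fact n + 1) * (r choose n))"
    unfolding P[symmetric] by (simp only: mult_ac)
  then have "r ^ n < (fact n + 1) * (r choose n)" by simp
  then show ?thesis using lower by (intro div_nat_eqI[symmetric]) (simp_all add: mult.commute)
qed

lemma dfun_fact: "dfun F \<Longrightarrow> dfun (\<lambda>e. fact (F e))"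
  unfolding fact_eq_div_binomial
  by (intro dfun_div dfun_power dfun_binomial dfun_add dfun_mult dfun_square dfun_const)

section \<open>The bounded universal quantifier\<close>

text \<open>The polynomial with its constants replaced by absolute values. It is monotone, so a
  single value bounds the original one for all smaller arguments.\<close>

primrec pbound :: "(nat \<Rightarrow> nat) \<Rightarrow> (nat \<Rightarrow> nat) \<Rightarrow> pexp \<Rightarrow> nat" where
  "pbound e z (Par i) = e i"
| "pbound e z (Unk i) = z i"
| "pbound e z (Cst c) = nat \<bar>c\<bar>"
| "pbound e z (Add p q) = pbound e z p + pbound e z q"
| "pbound e z (Mul p q) = pbound e z p * pbound e z q"

lemma abs_peval_le_pbound:
  assumes "\<And>i. e i \<le> e' i" "\<And>i. z i \<le> z' i"
  shows "\<bar>peval (\<lambda>i. int (e i)) (\<lambda>i. int (z i)) p\<bar> \<le> int (pbound e' z' p)"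
proof (induction p)
  case (Add p q)
  then show ?case by simp
next
  case (Mul p q)
  then show ?case by (simp add: abs_mult mult_mono)
qed (use assms in simp_all)

lemma dfun_pbound:
  assumes "\<And>i. dfun (\<lambda>e. E e i)" "\<And>i. dfun (\<lambda>e. Z e i)"
  shows "dfun (\<lambda>e. pbound (E e) (Z e) p)"
  by (induction p) (simp_all add: assms dfun_const dfun_add dfun_mult)

text \<open>Values of a polynomial may be negative while \<open>dfun\<close> speaks of natural
  numbers, hence a difference of two functions.\<close>

lemma peval_eq_dfun_diff:
  assumes "\<And>i. dfun (\<lambda>e. E e i)" "\<And>i. dfun (\<lambda>e. Z e i)"
  shows "\<exists>F G. dfun F \<and> dfun G
    \<and> (\<forall>e. peval (\<lambda>i. int (E e i)) (\<lambda>i. int (Z e i)) p = int (F e) - int (G e))"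
proof (induction p)
  case (Par i)
  show ?case by (rule exI[of _ "\<lambda>e. E e i"], rule exI[of _ "\<lambda>e. 0"]) (simp add: assms dfun_const)
next
  case (Unk i)
  show ?case by (rule exI[of _ "\<lambda>e. Z e i"], rule exI[of _ "\<lambda>e. 0"]) (simp add: assms dfun_const)
next
  case (Cst c)
  show ?case by (rule exI[of _ "\<lambda>e. nat c"], rule exI[of _ "\<lambda>e. nat (- c)"]) (simp add: dfun_const)
next
  case (Add p q)
  then obtain F G F' G' where "dfun F" "dfun G" "dfun F'" "dfun G'"
    "\<forall>e. peval (\<lambda>i. int (E e i)) (\<lambda>i. int (Z e i)) p = int (F e) - int (G e)"
    "\<forall>e. peval (\<lambda>i. int (E e i)) (\<lambda>i. int (Z e i)) q = int (F' e) - int (G' e)" by blast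
  then show ?case
    by (intro exI[of _ "\<lambda>e. F e + F' e"] exI[of _ "\<lambda>e. G e + G' e"]) (simp add: dfun_add)
next
  case (Mul p q)
  then obtain F G F' G' where d: "dfun F" "dfun G" "dfun F'" "dfun G'"
    and p: "\<And>e. peval (\<lambda>i. int (E e i)) (\<lambda>i. int (Z e i)) p = int (F e) - int (G e)"
    and q: "\<And>e. peval (\<lambda>i. int (E e i)) (\<lambda>i. int (Z e i)) q = int (F' e) - int (G' e)" by metis
  have "dfun (\<lambda>e. F e * F' e + G e * G' e)" "dfun (\<lambda>e. F e * G' e + G e * F' e)"
    by (simp_all add: d dfun_add dfun_mult)
  moreover have "peval (\<lambda>i. int (E e i)) (\<lambda>i. int (Z e i)) (Mul p q)
      = int (F e * F' e + G e * G' e) - int (F e * G' e + G e * F' e)" for e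
    unfolding peval.simps p q by (simp add: algebra_simps)
  ultimately show ?case by (intro exI conjI allI)
qed

lemma dio_dvd_peval:
  assumes "dfun M" "\<And>i. dfun (\<lambda>e. E e i)" "\<And>i. dfun (\<lambda>e. Z e i)"
  shows "dio (\<lambda>e. int (M e) dvd peval (\<lambda>i. int (E e i)) (\<lambda>i. int (Z e i)) p)"
proof -
  obtain F G where F: "dfun F" "dfun G"
    and eq: "\<And>e. peval (\<lambda>i. int (E e i)) (\<lambda>i. int (Z e i)) p = int (F e) - int (G e)"
    using peval_eq_dfun_diff[of E Z p] assms(2,3) by blast
  have "int (M e) dvd int (F e) - int (G e) \<longleftrightarrow> [F e = G e] (mod M e)" for e
    by (metis cong_iff_dvd_diff cong_int_iff)
  then show ?thesis unfolding eq by (simp add: dio_cong F assms)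
qed

text \<open>A prime dividing a (a - 1) ... (a - u + 1) divides one of the factors, which bounds the
  residue of a.\<close>

lemma prime_dvd_binomial_imp_cong_less:
  fixes a u r :: nat
  assumes "prime r" "r dvd (a choose u)"
  shows "\<exists>z<u. [a = z] (mod r)"
proof -
  have "r dvd fact u * (a choose u)" using assms by simp
  then have "r dvd (\<Prod>i<u. a - i)" unfolding fact_binomial_eq_prod .
  then obtain i where i: "i < u" "r dvd a - i" using assms by (auto simp: prime_dvd_prod_iff)
  show ?thesis
  proof (cases "i \<le> a")
    case True
    then have "[a = i] (mod r)" using i by (simp add: cong_altdef_nat)
    then show ?thesis using i by blast
  next
    case False
    \<comment> \<open>Here a < i < u: the factor a - i is a truncated 0, and a is its own
      witness.\<close>
    then show ?thesis using i by (intro exI[of _ a]) simp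
  qed
qed

text \<open>The moduli \<open>1 + N / k\<close> for \<open>1 \<le> k \<le> y\<close>, where \<open>N\<close> is the square of a large factorial, play
  the role of \<open>1 + k t\<close> in Goedel's coding: they are pairwise coprime, free of small primes, and
  determine \<open>k\<close> through \<open>k \<equiv> - N\<close>. Their product is a single binomial coefficient.\<close>

locale binomial_moduli =
  fixes y Q :: nat
  assumes y_le: "y \<le> Q"
begin

text \<open>The square, so that \<open>N div k\<close> keeps the full factor \<open>fact Q\<close>
  and \<open>modulus k\<close> is 1 modulo every prime up to Q.\<close>

definition N :: nat where "N = (fact Q)\<^sup>2"

definition modulus :: "nat \<Rightarrow> nat" where "modulus k = 1 + N div k"

lemma dvd_fact_Q: "1 \<le> k \<Longrightarrow> k \<le> y \<Longrightarrow> k dvd fact Q"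
  using y_le by (simp add: dvd_fact)

lemma mult_modulus:
  assumes "1 \<le> k" "k \<le> y"
  shows "k * modulus k = N + k"
proof -
  have "k dvd N" unfolding N_def power2_eq_square using dvd_fact_Q[OF assms] by simp
  then show ?thesis by (simp add: modulus_def)
qed

lemma prime_dvd_modulus:
  assumes "1 \<le> k" "k \<le> y" "prime r" "r dvd modulus k"
  shows "r > Q"
proof (rule ccontr)
  assume "\<not> r > Q"
  then have "r dvd fact Q" using assms(3) by (simp add: prime_dvd_fact_iff)
  then have "r dvd fact Q * (fact Q div k)" by simp
  also have "fact Q * (fact Q div k) = N div k"
    unfolding N_def power2_eq_square using dvd_fact_Q[OF assms(1,2)] by (simp add: div_mult_swap)
  finally have "r dvd 1" using assms(4) unfolding modulus_def by (simp only: dvd_add_left_iff)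
  then show False using assms(3) by simp
qed

text \<open>A common prime divides (N + k) - (N + j) = k - j, which is at most Q, while prime
  factors of the moduli exceed Q.\<close>

lemma coprime_modulus:
  assumes "1 \<le> j" "j < k" "k \<le> y"
  shows "coprime (modulus j) (modulus k)"
proof (rule ccontr)
  assume "\<not> coprime (modulus j) (modulus k)"
  then obtain r where r: "prime r" "r dvd modulus j" "r dvd modulus k"
    using prime_factor_nat[of "gcd (modulus j) (modulus k)"] by (auto simp: coprime_iff_gcd_eq_1)
  then have "r dvd N + j" "r dvd N + k"
    using mult_modulus[of j] mult_modulus[of k] assms by (metis dvd_mult le_trans less_imp_le)+
  then have "r dvd (N + k) - (N + j)" by (intro dvd_diff_nat)
  then have "r dvd k - j" by simp
  then have "r \<le> k - j" using assms by (intro dvd_imp_le) auto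
  then show False using prime_dvd_modulus[of j r] r assms y_le by simp
qed

lemma pairwise_coprime_modulus:
  "i \<in> {1..y} \<Longrightarrow> j \<in> {1..y} \<Longrightarrow> i \<noteq> j \<Longrightarrow> coprime (modulus i) (modulus j)"
  using coprime_modulus[of i j] coprime_modulus[of j i] coprime_commute[of "modulus j" "modulus i"]
  by (cases i j rule: linorder_cases) auto

text \<open>Multiplied by y!, the product becomes (N + 1) ... (N + y), because k times the k-th
  modulus is N + k.\<close>

lemma prod_modulus: "(\<Prod>k\<in>{1..y}. modulus k) = (N + y choose y)"
proof -
  have "fact y * (\<Prod>k\<in>{1..y}. modulus k) = (\<Prod>k\<in>{1..y}. k * modulus k)"
    by (simp add: fact_prod prod.distrib)
  also have "\<dots> = (\<Prod>k\<in>{1..y}. N + k)" by (intro prod.cong) (auto simp: mult_modulus)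
  also have "\<dots> = (\<Prod>i<y. N + y - i)"
    by (rule prod.reindex_bij_witness[of _ "\<lambda>i. y - i" "\<lambda>k. y - k"]) auto
  also have "\<dots> = fact y * (N + y choose y)" by (rule fact_binomial_eq_prod[symmetric])
  finally show ?thesis by simp
qed

lemma modulus_dvd_binomial: "k \<in> {1..y} \<Longrightarrow> modulus k dvd (N + y choose y)"
  unfolding prod_modulus[symmetric] by (intro dvd_prodI) auto

text \<open>The modulus divides the factor a - z of the falling factorial, and it is coprime to u!
  because its primes exceed Q. If z > a, then a < u and the binomial coefficient is 0.\<close>

lemma modulus_dvd_binomial_if_cong_less:
  assumes "k \<in> {1..y}" "u \<le> Q" "z < u" "[a = z] (mod modulus k)"
  shows "modulus k dvd (a choose u)"
proof (cases "z \<le> a")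
  case True
  have "modulus k dvd a - z" using assms True by (simp add: cong_altdef_nat)
  also have "a - z dvd (\<Prod>i<u. a - i)" using assms by (intro dvd_prodI) auto
  also have "\<dots> = fact u * (a choose u)" by (rule fact_binomial_eq_prod[symmetric])
  finally have "modulus k dvd fact u * (a choose u)" .
  moreover have "coprime (modulus k) (fact u)"
  proof (rule ccontr)
    assume "\<not> coprime (modulus k) (fact u)"
    then obtain r where r: "prime r" "r dvd modulus k" "r dvd fact u"
      using prime_factor_nat[of "gcd (modulus k) (fact u)"] by (auto simp: coprime_iff_gcd_eq_1)
    then show False using prime_dvd_modulus[of k r] assms by (simp add: prime_dvd_fact_iff)
  qed
  ultimately show ?thesis by (simp add: coprime_dvd_mult_right_iff)
next
  case False
  then show ?thesis using assms by (simp add: binomial_eq_0)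
qed

end

text \<open>\<open>c\<close> and \<open>a i\<close> code, modulo the \<open>k\<close>-th modulus, the number \<open>k\<close> and the value of the \<open>i\<close>-th unknown
  that works for \<open>k\<close>. Divisibility of \<open>a i choose u\<close> expresses that this value is less than \<open>u\<close>
  modulo some prime factor, which exceeds \<open>Q\<close> and hence all values of the polynomial in question.\<close>

definition coded_zeros :: "pexp \<Rightarrow> nat \<Rightarrow> (nat \<Rightarrow> nat) \<Rightarrow> nat \<Rightarrow> nat \<Rightarrow> nat \<Rightarrow> nat \<Rightarrow> (nat \<Rightarrow> nat) \<Rightarrow> bool" where
  "coded_zeros p m e y u Q c a \<longleftrightarrow>
     pbound (case_nat y e) (\<lambda>_. u) p \<le> Q \<and> y \<le> Q \<and> u \<le> Q
     \<and> ((fact Q)\<^sup>2 + y choose y) dvd c + (fact Q)\<^sup>2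
     \<and> int ((fact Q)\<^sup>2 + y choose y) dvd peval (\<lambda>i. int (case_nat c e i)) (\<lambda>i. int (a i)) p
     \<and> (\<forall>i<m. ((fact Q)\<^sup>2 + y choose y) dvd (a i choose u))"

lemma zeros_imp_coded_zeros:
  assumes m: "unks p \<subseteq> {..<m}"
    and z: "\<And>k. k \<in> {1..y} \<Longrightarrow> peval (\<lambda>i. int (case_nat k e i)) (\<lambda>i. int (z k i)) p = 0"
  shows "\<exists>u Q c a. coded_zeros p m e y u Q c a"
proof -
  \<comment> \<open>Above every value of every unknown that occurs; Q then also bounds the
    polynomial for all k up to y and all unknowns up to u.\<close>
  define u where "u = Suc (\<Sum>k\<in>{1..y}. \<Sum>i<m. z k i)"
  define Q where "Q = pbound (case_nat y e) (\<lambda>_. u) p + y + u"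
  interpret binomial_moduli y Q by unfold_locales (simp add: Q_def)
  define M where "M = (N + y choose y)"
  have zu: "z k i < u" if "k \<in> {1..y}" "i < m" for k i
  proof -
    have "z k i \<le> (\<Sum>i<m. z k i)" using that by (intro member_le_sum) auto
    also have "\<dots> \<le> (\<Sum>k\<in>{1..y}. \<Sum>i<m. z k i)"
      using that member_le_sum[of k "{1..y}" "\<lambda>k. \<Sum>i<m. z k i"] by simp
    finally show ?thesis by (simp add: u_def)
  qed
  have "\<exists>x. \<forall>k\<in>{1..y}. [x = z k i] (mod modulus k)" for i
    by (rule chinese_remainder_nat) (use pairwise_coprime_modulus in auto)
  then obtain a where a: "\<And>i k. k \<in> {1..y} \<Longrightarrow> [a i = z k i] (mod modulus k)" by metis
  \<comment> \<open>Makes c + N the multiple M N of all moduli. Since k + N is a multiple of the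
    k-th modulus, c is congruent to k there.\<close>
  define c where "c = (M - 1) * N"
  have "M \<ge> 1" by (simp add: M_def Suc_le_eq)
  then have cN: "c + N = M * N" unfolding c_def by (simp add: diff_mult_distrib)
  have "modulus k dvd (a i choose u)" if "k \<in> {1..y}" "i < m" for k i
    by (rule modulus_dvd_binomial_if_cong_less[OF that(1) _ zu[OF that] a[OF that(1)]]) (simp add: Q_def)
  then have "[a i choose u = 0] (mod M)" if "i < m" for i
    unfolding M_def prod_modulus[symmetric] using that
    by (intro coprime_cong_prod_nat pairwise_coprime_modulus) (auto simp: cong_0_iff)
  then have 1: "M dvd (a i choose u)" if "i < m" for i using that by (simp add: cong_0_iff)
  have ck: "[int c = int k] (mod int (modulus k))" if "k \<in> {1..y}" for k
  proof -
    have "modulus k dvd c + N" unfolding cN M_def using modulus_dvd_binomial[OF that] by simp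
    moreover have "modulus k dvd k + N" using mult_modulus[of k] that by (metis add.commute atLeastAtMost_iff dvd_triv_right)
    ultimately have "[c + N = k + N] (mod modulus k)" by (metis cong_0_iff cong_sym cong_trans)
    then show ?thesis by (simp add: cong_add_rcancel_nat cong_int_iff)
  qed
  have pk: "[peval (\<lambda>i. int (case_nat c e i)) (\<lambda>i. int (a i)) p = 0] (mod int (modulus k))"
    if k: "k \<in> {1..y}" for k
  proof -
    have "[peval (\<lambda>i. int (case_nat c e i)) (\<lambda>i. int (a i)) p
        = peval (\<lambda>i. int (case_nat k e i)) (\<lambda>i. int (z k i)) p] (mod int (modulus k))"
    proof (rule peval_congruence)
      fix i
      show "[int (case_nat c e i) = int (case_nat k e i)] (mod int (modulus k))"
        using ck[OF k] by (cases i) auto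
      show "[int (a i) = int (z k i)] (mod int (modulus k))" using a[OF k] by (simp add: cong_int_iff)
    qed
    then show ?thesis using z[OF k] by simp
  qed
  \<comment> \<open>The Chinese remainder argument is run on natural numbers, hence the absolute
    value.\<close>
  have "[nat \<bar>peval (\<lambda>i. int (case_nat c e i)) (\<lambda>i. int (a i)) p\<bar> = 0] (mod (\<Prod>k\<in>{1..y}. modulus k))"
    by (rule coprime_cong_prod_nat)
      (use pk pairwise_coprime_modulus in \<open>simp_all add: cong_0_iff dvd_nat_abs_iff\<close>)
  then have 2: "int M dvd peval (\<lambda>i. int (case_nat c e i)) (\<lambda>i. int (a i)) p"
    unfolding M_def prod_modulus[symmetric] by (simp add: cong_0_iff dvd_nat_abs_iff)
  have "M dvd c + N" unfolding cN by simp
  then have "coded_zeros p m e y u Q c a"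
    using 1 2 unfolding coded_zeros_def M_def N_def by (simp add: Q_def)
  then show ?thesis by blast
qed

text \<open>Modulo a prime factor r of the k-th modulus, c becomes k and each a i becomes some z i <
  u. The value at (k, z) is divisible by r > Q and bounded by Q, hence 0.\<close>

lemma coded_zeros_imp_zeros:
  assumes m: "unks p \<subseteq> {..<m}" and coded: "coded_zeros p m e y u Q c a" and k: "k \<in> {1..y}"
  shows "\<exists>z. peval (\<lambda>i. int (case_nat k e i)) (\<lambda>i. int (z i)) p = 0"
proof -
  interpret binomial_moduli y Q using coded by unfold_locales (simp add: coded_zeros_def)
  have bound: "pbound (case_nat y e) (\<lambda>_. u) p \<le> Q" and cN: "(N + y choose y) dvd c + N"
    and p0: "int (N + y choose y) dvd peval (\<lambda>i. int (case_nat c e i)) (\<lambda>i. int (a i)) p"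
    and au: "\<And>i. i < m \<Longrightarrow> (N + y choose y) dvd (a i choose u)"
    using coded unfolding coded_zeros_def N_def by auto
  have "modulus k \<noteq> 1"
  proof -
    have "k dvd N" unfolding N_def power2_eq_square using dvd_fact_Q k by simp
    then have "N div k \<noteq> 0" using k by (auto simp: N_def dvd_div_eq_0_iff)
    then show ?thesis by (simp add: modulus_def)
  qed
  then obtain r where r: "prime r" "r dvd modulus k" using prime_factor_nat by blast
  have rQ: "r > Q" using prime_dvd_modulus[of k r] r k by simp
  have rM: "r dvd (N + y choose y)" using r modulus_dvd_binomial[OF k] dvd_trans by blast
  \<comment> \<open>The default 0 from index m on keeps all entries at most u, as the size bound
    asks of every index.\<close>
  have "\<exists>z. (i < m \<longrightarrow> z < u \<and> [a i = z] (mod r)) \<and> (\<not> i < m \<longrightarrow> z = 0)" for i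
  proof (cases "i < m")
    case True
    then have "r dvd (a i choose u)" using au rM dvd_trans by blast
    then show ?thesis using prime_dvd_binomial_imp_cong_less[OF r(1)] True by blast
  qed simp
  then obtain z where z: "\<And>i. i < m \<Longrightarrow> z i < u \<and> [a i = z i] (mod r)" "\<And>i. \<not> i < m \<Longrightarrow> z i = 0"
    by metis
  have "r dvd c + N" using cN rM dvd_trans by blast
  moreover have "r dvd k + N"
    using mult_modulus[of k] k r by (metis add.commute atLeastAtMost_iff dvd_mult)
  ultimately have "[c + N = k + N] (mod r)" by (metis cong_0_iff cong_sym cong_trans)
  then have ck: "[int c = int k] (mod int r)" by (simp add: cong_add_rcancel_nat cong_int_iff)
  have "[peval (\<lambda>i. int (case_nat c e i)) (\<lambda>i. int (a i)) p
      = peval (\<lambda>i. int (case_nat k e i)) (\<lambda>i. int (z i)) p] (mod int r)"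
  proof (rule peval_congruence)
    fix i
    show "[int (case_nat c e i) = int (case_nat k e i)] (mod int r)" using ck by (cases i) auto
    show "[int (a i) = int (z i)] (mod int r)" if "i \<in> unks p"
      using that z m by (auto simp: cong_int_iff)
  qed
  moreover have "int r dvd peval (\<lambda>i. int (case_nat c e i)) (\<lambda>i. int (a i)) p"
    using p0 rM by (meson dvd_trans of_nat_dvd_iff)
  ultimately have dvd: "int r dvd peval (\<lambda>i. int (case_nat k e i)) (\<lambda>i. int (z i)) p"
    using cong_dvd_iff by blast
  have "\<bar>peval (\<lambda>i. int (case_nat k e i)) (\<lambda>i. int (z i)) p\<bar> \<le> int (pbound (case_nat y e) (\<lambda>_. u) p)"
  proof (rule abs_peval_le_pbound)
    fix i
    show "case_nat k e i \<le> case_nat y e i" using k by (cases i) auto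
    show "z i \<le> u" using z[of i] by (cases "i < m") auto
  qed
  also have "\<dots> < int r" using bound rQ by simp
  finally have "peval (\<lambda>i. int (case_nat k e i)) (\<lambda>i. int (z i)) p = 0"
    using dvd by (metis abs_of_nat dvd_imp_le_int not_le)
  then show ?thesis by blast
qed

lemma dio_all_upto:
  assumes "dio P"
  shows "dio (\<lambda>e. \<forall>k\<in>{1..e 0}. P (case_nat k (\<lambda>i. e (Suc i))))"
proof -
  obtain p where p: "\<And>e. P e \<longleftrightarrow> (\<exists>z::nat \<Rightarrow> nat. peval (\<lambda>i. int (e i)) (\<lambda>i. int (z i)) p = 0)"
    using assms by (rule dioE) blast
  obtain m where m: "unks p \<subseteq> {..<m}" using unks_bounded by blast
  have "(\<forall>k\<in>{1..y}. P (case_nat k e)) \<longleftrightarrow> (\<exists>u Q c a. coded_zeros p m e y u Q c a)" for y e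
  proof
    assume "\<forall>k\<in>{1..y}. P (case_nat k e)"
    then obtain z where "\<And>k. k \<in> {1..y} \<Longrightarrow> peval (\<lambda>i. int (case_nat k e i)) (\<lambda>i. int (z k i)) p = 0"
      unfolding p by metis
    from zeros_imp_coded_zeros[OF m, OF this] show "\<exists>u Q c a. coded_zeros p m e y u Q c a" .
  next
    assume "\<exists>u Q c a. coded_zeros p m e y u Q c a"
    then show "\<forall>k\<in>{1..y}. P (case_nat k e)" unfolding p using coded_zeros_imp_zeros[OF m] by blast
  qed
  moreover have case_dfun: "dfun (\<lambda>e. case_nat (F e) (G e) i)" if "dfun F" "\<And>j. dfun (\<lambda>e. G e j)" for F G i
    using that by (cases i) auto
  have "dio (\<lambda>e. \<exists>u Q c a. coded_zeros p m (\<lambda>i. e (Suc i)) (e 0) u Q c a)"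
    unfolding coded_zeros_def
    by (intro dio_intros dio_ex_seq dio_all_less dio_dvd_peval dfun_pbound dfun_binomial dfun_fact case_dfun)
  ultimately show ?thesis by simp
qed

text \<open>The moduli divide by k, so the coded quantifier starts at 1; a shift by one moves the
  range to start at 0.\<close>

lemma dio_all:
  assumes "dio (\<lambda>e. Q (\<lambda>i. e (Suc i)) (e 0))" "dfun F"
  shows "dio (\<lambda>e. \<forall>k<F e. Q e k)"
proof -
  have "dio (\<lambda>e. Q (\<lambda>i. e (Suc (Suc i))) (e 0))"
    using dio_rename[OF assms(1), of "case_nat 0 (\<lambda>i. Suc (Suc i))"] by simp
  then have "dio (\<lambda>e. Q (\<lambda>i. e (Suc i)) (e 0 - 1))"
    by (rule dio_subst[where Q = "\<lambda>e x. Q (\<lambda>i. e (Suc i)) x"]) (intro dfun_diff dfun_var dfun_const)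
  from dio_all_upto[OF this]
  have "dio (\<lambda>e. \<forall>k\<in>{1..e 0}. Q (\<lambda>i. e (Suc i)) (k - 1))" by simp
  then have "dio (\<lambda>e. \<forall>k\<in>{1..F e}. Q e (k - 1))"
    by (rule dio_subst[where Q = "\<lambda>e y. \<forall>k\<in>{1..y}. Q e (k - 1)"]) (rule assms)
  moreover have "(\<forall>k\<in>{1..n}. Q e (k - 1)) \<longleftrightarrow> (\<forall>k<n. Q e k)" for n e
  proof
    assume *: "\<forall>k\<in>{1..n}. Q e (k - 1)"
    show "\<forall>k<n. Q e k" using *[rule_format, of "Suc _"] by simp
  qed auto
  ultimately show ?thesis by simp
qed


section \<open>Recursively enumerable sets are Diophantine\<close>

lemma map_case_nat_upt: "map (case_nat a X) [0..<Suc k] = a # map X [0..<k]"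
  unfolding upt_conv_Cons[OF zero_less_Suc] map_Suc_upt[symmetric] by simp

section \<open>Characterisations of the evaluation relation\<close>

inductive_cases computes_RZeroE: "computes RZero xs y"
inductive_cases computes_RSuccE: "computes RSucc xs y"
inductive_cases computes_RProjE: "computes (RProj i) xs y"
inductive_cases computes_RCompE: "computes (RComp f gs) xs y"
inductive_cases computes_RPrim_0E: "computes (RPrim f g) (0 # xs) y"
inductive_cases computes_RPrim_SucE: "computes (RPrim f g) (Suc n # xs) y"
inductive_cases computes_RMuE: "computes (RMu f) xs y"

lemma computes_RZero_iff: "computes RZero xs y \<longleftrightarrow> y = 0"
  by (auto elim: computes_RZeroE intro: computes.zero)

lemma computes_RSucc_iff: "computes RSucc [x] y \<longleftrightarrow> y = Suc x"
  by (auto elim: computes_RSuccE intro: computes.succ)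

lemma computes_RProj_iff: "i < length xs \<Longrightarrow> computes (RProj i) xs y \<longleftrightarrow> y = xs ! i"
  by (auto elim: computes_RProjE intro: computes.proj)

text \<open>The list of intermediate values becomes a total sequence w, the form in which
  \<open>dio_ex_seq\<close> quantifies.\<close>

lemma computes_RComp_iff:
  "computes (RComp f gs) xs y \<longleftrightarrow>
    (\<exists>w. (\<forall>j<length gs. computes (gs ! j) xs (w j)) \<and> computes f (map w [0..<length gs]) y)"
proof
  assume "computes (RComp f gs) xs y"
  then obtain ys where ys: "list_all2 (\<lambda>g y. computes g xs y) gs ys" "computes f ys y"
    by (rule computes_RCompE)
  then have "map (\<lambda>j. ys ! j) [0..<length gs] = ys" by (simp add: list_all2_lengthD map_nth)
  then show "\<exists>w. (\<forall>j<length gs. computes (gs ! j) xs (w j)) \<and> computes f (map w [0..<length gs]) y"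
    using ys by (intro exI[of _ "\<lambda>j. ys ! j"]) (simp add: list_all2_conv_all_nth)
next
  assume "\<exists>w. (\<forall>j<length gs. computes (gs ! j) xs (w j)) \<and> computes f (map w [0..<length gs]) y"
  then obtain w where "\<forall>j<length gs. computes (gs ! j) xs (w j)" "computes f (map w [0..<length gs]) y"
    by blast
  then show "computes (RComp f gs) xs y"
    by (intro computes.comp[where ys = "map w [0..<length gs]"]) (simp_all add: list_all2_conv_all_nth)
qed

lemma computes_RPrim_iff_sequence:
  "computes (RPrim f g) (n # xs) y \<longleftrightarrow>
    (\<exists>w. computes f xs (w 0) \<and> (\<forall>i<n. computes g (i # w i # xs) (w (Suc i))) \<and> y = w n)"
proof (induction n arbitrary: y)
  case 0
  show ?case by (auto elim: computes_RPrim_0E intro: computes.prim_0 exI[of _ "\<lambda>_. y"])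
next
  case (Suc n)
  show ?case
  proof
    assume "computes (RPrim f g) (Suc n # xs) y"
    then obtain v where v: "computes (RPrim f g) (n # xs) v" "computes g (n # v # xs) y"
      by (rule computes_RPrim_SucE)
    then obtain w where w: "computes f xs (w 0)" "\<forall>i<n. computes g (i # w i # xs) (w (Suc i))" "v = w n"
      using Suc by blast
    let ?w = "w(Suc n := y)"
    have "computes f xs (?w 0)" using w by simp
    moreover have "computes g (i # ?w i # xs) (?w (Suc i))" if "i < Suc n" for i
      using w v that by (cases "i = n") auto
    ultimately show "\<exists>w. computes f xs (w 0) \<and> (\<forall>i<Suc n. computes g (i # w i # xs) (w (Suc i))) \<and> y = w (Suc n)"
      by (intro exI[of _ ?w]) simp
  next
    assume "\<exists>w. computes f xs (w 0) \<and> (\<forall>i<Suc n. computes g (i # w i # xs) (w (Suc i))) \<and> y = w (Suc n)"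
    then obtain w where w: "computes f xs (w 0)" "\<forall>i<Suc n. computes g (i # w i # xs) (w (Suc i))" "y = w (Suc n)"
      by blast
    then have "computes (RPrim f g) (n # xs) (w n)" unfolding Suc by auto
    then show "computes (RPrim f g) (Suc n # xs) y" using w by (auto intro: computes.prim_Suc)
  qed
qed

text \<open>The sequence of intermediate values of a primitive recursion is coded by the base \<open>b\<close> digits
  of a single number \<open>x\<close>.\<close>

lemma computes_RPrim_iff:
  "computes (RPrim f g) (n # xs) y \<longleftrightarrow>
    (\<exists>x b. computes f xs (x div b ^ 0 mod b)
      \<and> (\<forall>i<n. computes g (i # (x div b ^ i mod b) # xs) (x div b ^ Suc i mod b)) \<and> y = x div b ^ n mod b)"
  (is "_ \<longleftrightarrow> ?R")
proof
  assume "computes (RPrim f g) (n # xs) y"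
  then obtain w where w: "computes f xs (w 0)" "\<forall>i<n. computes g (i # w i # xs) (w (Suc i))" "y = w n"
    unfolding computes_RPrim_iff_sequence by blast
  obtain x b where "\<forall>i\<le>n. x div b ^ i mod b = w i" using finite_sequence_digits by blast
  then have "computes f xs (x div b ^ 0 mod b)
      \<and> (\<forall>i<n. computes g (i # (x div b ^ i mod b) # xs) (x div b ^ Suc i mod b)) \<and> y = x div b ^ n mod b"
    using w by (simp del: power_Suc power_0)
  then show ?R by blast
next
  assume ?R
  then obtain x b where "computes f xs (x div b ^ 0 mod b)
      \<and> (\<forall>i<n. computes g (i # (x div b ^ i mod b) # xs) (x div b ^ Suc i mod b)) \<and> y = x div b ^ n mod b"
    by blast
  then show "computes (RPrim f g) (n # xs) y"
    unfolding computes_RPrim_iff_sequence by (intro exI[of _ "\<lambda>i. x div b ^ i mod b"])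
qed

lemma computes_RMu_iff:
  "computes (RMu f) xs n \<longleftrightarrow> computes f (n # xs) 0 \<and> (\<forall>i<n. \<exists>y. computes f (i # xs) (Suc y))"
  by (auto elim: computes_RMuE intro: computes.mu)

lemma dio_computes_args:
  assumes "dio (\<lambda>e. computes f (map (\<lambda>i. e (Suc i)) [0..<k]) (e 0))"
    and "\<And>i. dfun (\<lambda>e. X e i)" "dfun Y"
  shows "dio (\<lambda>e. computes f (map (X e) [0..<k]) (Y e))"
proof -
  have "dfun (\<lambda>e. case_nat (Y e) (X e) i)" for i using assms(2,3) by (cases i) auto
  from dio_comp[OF assms(1), of "\<lambda>e. case_nat (Y e) (X e)", OF this] show ?thesis by simp
qed

lemma dio_computes_Cons:
  assumes "dio (\<lambda>e. computes f (map (\<lambda>i. e (Suc i)) [0..<Suc k]) (e 0))"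
    and "dfun A" "\<And>i. dfun (\<lambda>e. X e i)" "dfun Y"
  shows "dio (\<lambda>e. computes f (A e # map (X e) [0..<k]) (Y e))"
  unfolding map_case_nat_upt[symmetric]
  by (rule dio_computes_args[OF assms(1)], case_tac i) (use assms(2-) in simp_all)

lemma dio_computes_Cons2:
  assumes "dio (\<lambda>e. computes f (map (\<lambda>i. e (Suc i)) [0..<Suc (Suc k)]) (e 0))"
    and "dfun A" "dfun B" "\<And>i. dfun (\<lambda>e. X e i)" "dfun Y"
  shows "dio (\<lambda>e. computes f (A e # B e # map (X e) [0..<k]) (Y e))"
  unfolding map_case_nat_upt[of "B _", symmetric]
  by (rule dio_computes_Cons[OF assms(1,2)], case_tac i) (use assms(3-) in simp_all)

lemma dio_computes:
  assumes "has_arity f k"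
  shows "dio (\<lambda>e. computes f (map (\<lambda>i. e (Suc i)) [0..<k]) (e 0))"
  using assms
proof (induction rule: has_arity.induct)
  case (1 k)
  show ?case unfolding computes_RZero_iff by (intro dio_intros)
next
  case 2
  have "dio (\<lambda>e. e 0 = Suc (e 1))" by (intro dio_intros)
  then show ?case by (simp add: computes_RSucc_iff)
next
  case (3 i k)
  then have "dio (\<lambda>e. e 0 = e (Suc i))" by (intro dio_intros)
  then show ?case using 3 by (simp add: computes_RProj_iff)
next
  case (4 f gs k)
  note g = "4.IH"(2)[OF nth_mem]
  show ?case unfolding computes_RComp_iff
    by (intro dio_ex_seq dio_conj dio_all_less dio_computes_args[OF g] dio_computes_args[OF "4.IH"(1)] dfun_var)
next
  case (5 f k g)
  have g: "dio (\<lambda>e. computes g (map (\<lambda>i. e (Suc i)) [0..<Suc (Suc k)]) (e 0))" using 5 by simp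
  have "dio (\<lambda>e. \<exists>x b. computes f (map (\<lambda>i. e (Suc (Suc i))) [0..<k]) (x div b ^ 0 mod b)
      \<and> (\<forall>i<e 1. computes g (i # (x div b ^ i mod b) # map (\<lambda>i. e (Suc (Suc i))) [0..<k]) (x div b ^ Suc i mod b))
      \<and> e 0 = x div b ^ e 1 mod b)"
    by (intro dio_ex dio_conj dio_all dio_computes_args[OF "5.IH"(1)] dio_computes_Cons2[OF g] dio_eq
        dfun_div dfun_mod dfun_power dfun_var dfun_const dfun_Suc)
  moreover have "map (\<lambda>i. e (Suc i)) [0..<Suc k] = e 1 # map (\<lambda>i. e (Suc (Suc i))) [0..<k]" for e :: "nat \<Rightarrow> nat"
    unfolding upt_conv_Cons[OF zero_less_Suc] map_Suc_upt[symmetric] by simp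
  ultimately show ?case unfolding Suc_eq_plus1[symmetric] by (simp only: computes_RPrim_iff)
next
  case (6 f k)
  have f: "dio (\<lambda>e. computes f (map (\<lambda>i. e (Suc i)) [0..<Suc k]) (e 0))" using 6 by simp
  show ?case unfolding computes_RMu_iff
    by (intro dio_conj dio_all dio_ex dio_computes_Cons[OF f] dfun_var dfun_const dfun_Suc)
qed

text \<open>The pivot of the equivalence: the parameters range over the integers, but the unknowns only over
  the natural numbers.\<close>

definition nat_diophantine :: "nat \<Rightarrow> int list set \<Rightarrow> bool" where
  "nat_diophantine r \<Omega> \<longleftrightarrow> (\<exists>p. pars p \<subseteq> {..<r} \<and>
     (\<forall>a. length a = r \<longrightarrow> (a \<in> \<Omega> \<longleftrightarrow> (\<exists>z::nat \<Rightarrow> nat. peval (nth a) (\<lambda>i. int (z i)) p = 0))))"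

primrec sum_squares :: "pexp list \<Rightarrow> pexp" where
  "sum_squares [] = Cst 0"
| "sum_squares (p # ps) = Add (Mul p p) (sum_squares ps)"

lemma peval_sum_squares_nonneg: "peval e z (sum_squares ps) \<ge> 0"
  by (induction ps) auto

lemma peval_sum_squares_eq_0: "peval e z (sum_squares ps) = 0 \<longleftrightarrow> (\<forall>p\<in>set ps. peval e z p = 0)"
proof (induction ps)
  case (Cons p ps)
  have "peval e z p * peval e z p \<ge> 0" by simp
  then have "peval e z (sum_squares (p # ps)) = 0
      \<longleftrightarrow> peval e z p * peval e z p = 0 \<and> peval e z (sum_squares ps) = 0"
    unfolding sum_squares.simps peval.simps using peval_sum_squares_nonneg[of e z ps] by linarith
  then show ?case using Cons by simp
qed simp

lemma pars_sum_squares: "pars (sum_squares ps) = (\<Union>p\<in>set ps. pars p)"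
  by (induction ps) auto

lemma pars_psubst: "pars (psubst s t p) = (\<Union>i\<in>pars p. pars (s i)) \<union> (\<Union>i\<in>unks p. pars (t i))"
  by (induction p) auto

text \<open>The code of x is 2 x for x >= 0 and -2 x - 1 otherwise. The sign of x needs no separate
  condition: as n is natural, the factor of the wrong branch is positive.\<close>

lemma int_encode_eq_iff: "n = int_encode x \<longleftrightarrow> (int n - 2 * x) * (int n + 2 * x + 1) = 0"
  by (auto simp: int_encode_def sum_encode_def)

lemma recursively_enumerable_imp_nat_diophantine:
  assumes "recursively_enumerable r \<Omega>"
  shows "nat_diophantine r \<Omega>"
proof -
  obtain f where f: "has_arity f r"
    and dom: "\<And>xs. length xs = r \<Longrightarrow> xs \<in> map int_encode ` \<Omega> \<longleftrightarrow> (\<exists>y. computes f xs y)"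
    using assms unfolding recursively_enumerable_def recursively_enumerable_nat_def by blast
  have "dio (\<lambda>e. \<exists>y. computes f (map e [0..<r]) y)"
    by (intro dio_ex dio_computes_args[OF dio_computes[OF f]] dfun_var)
  then obtain p where p: "\<And>e. (\<exists>y. computes f (map e [0..<r]) y)
      \<longleftrightarrow> (\<exists>z::nat \<Rightarrow> nat. peval (\<lambda>i. int (e i)) (\<lambda>i. int (z i)) p = 0)"
    by (rule dioE) blast
  have mem: "a \<in> \<Omega> \<longleftrightarrow> (\<exists>w z. (\<forall>i<r. w i = int_encode (a ! i)) \<and> peval (\<lambda>i. int (w i)) (\<lambda>i. int (z i)) p = 0)"
    if a: "length a = r" for a
  proof -
    have "a \<in> \<Omega> \<longleftrightarrow> map int_encode a \<in> map int_encode ` \<Omega>"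
      using inj_image_mem_iff[OF inj_mapI[OF inj_int_encode]] by blast
    also have "\<dots> \<longleftrightarrow> (\<exists>y. computes f (map int_encode a) y)" using a by (intro dom) simp
    also have "\<dots> \<longleftrightarrow> (\<exists>w. (\<forall>i<r. w i = int_encode (a ! i)) \<and> (\<exists>y. computes f (map w [0..<r]) y))"
    proof -
      have "map w [0..<r] = map int_encode a" if "\<forall>i<r. w i = int_encode (a ! i)" for w
        using a that by (intro nth_equalityI) auto
      from this this[of "\<lambda>i. int_encode (a ! i)"] show ?thesis
        by (intro iffI exI[of _ "\<lambda>i. int_encode (a ! i)"]) auto
    qed
    finally show ?thesis unfolding p by simp
  qed
  \<comment> \<open>The codes of the parameters become unknowns at even indices, tied to the
    integers by \<open>int_encode_eq_iff\<close>; the old unknowns move to odd indices.\<close>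
  define code where "code i = Mul (Add (Unk (2 * i)) (Mul (Cst (-2)) (Par i)))
      (Add (Unk (2 * i)) (Add (Mul (Cst 2) (Par i)) (Cst 1)))" for i
  let ?q = "sum_squares (psubst (\<lambda>i. Unk (2 * i)) (\<lambda>i. Unk (Suc (2 * i))) p # map code [0..<r])"
  have code_eval: "peval e z (code i) = (z (2 * i) - 2 * e i) * (z (2 * i) + 2 * e i + 1)" for e z i
    by (simp add: code_def)
  have "pars ?q \<subseteq> {..<r}" by (auto simp: pars_sum_squares pars_psubst code_def)
  moreover have "a \<in> \<Omega> \<longleftrightarrow> (\<exists>z::nat \<Rightarrow> nat. peval (nth a) (\<lambda>i. int (z i)) ?q = 0)"
    if "length a = r" for a
    unfolding mem[OF that] ex_pair_iff_ex_interleave peval_sum_squares_eq_0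
    by (simp add: peval_psubst code_eval int_encode_eq_iff conj_commute, simp add: Ball_def)
  ultimately show ?thesis unfolding nat_diophantine_def by blast
qed


section \<open>Lagrange's theorem: integer unknowns suffice\<close>

definition four_squares :: "int \<Rightarrow> bool" where
  "four_squares n \<longleftrightarrow> (\<exists>a b c d. n = a\<^sup>2 + b\<^sup>2 + c\<^sup>2 + d\<^sup>2)"

text \<open>Multiplicativity of the quaternion norm, with signs such that the last three terms
  vanish modulo m when the two quadruples agree modulo m.\<close>

lemma euler_four_squares:
  fixes a b c d w x y z :: int
  shows "(a\<^sup>2 + b\<^sup>2 + c\<^sup>2 + d\<^sup>2) * (w\<^sup>2 + x\<^sup>2 + y\<^sup>2 + z\<^sup>2)
    = (a * w + b * x + c * y + d * z)\<^sup>2 + (a * x - b * w + c * z - d * y)\<^sup>2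
    + (a * y - c * w + d * x - b * z)\<^sup>2 + (a * z - d * w + b * y - c * x)\<^sup>2"
  by (simp add: power2_eq_square algebra_simps)

lemma four_squares_mult: "four_squares m \<Longrightarrow> four_squares n \<Longrightarrow> four_squares (m * n)"
  unfolding four_squares_def by (elim exE) (simp only: euler_four_squares, blast)

text \<open>Pigeonhole: for x and y from 0 to (p - 1) / 2 the residues of x^2 and of -1 - y^2 number
  (p + 1) / 2 each, too many to be disjoint. The bounds on x and y later make the quotient smaller
  than p.\<close>

lemma ex_dvd_sum_two_squares_plus_1:
  fixes p :: nat
  assumes p: "prime p" "p > 2"
  shows "\<exists>x y::int. int p dvd x\<^sup>2 + y\<^sup>2 + 1 \<and> 0 \<le> x \<and> 2 * x < int p \<and> 0 \<le> y \<and> 2 * y < int p"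
proof -
  define h where "h = (int p - 1) div 2"
  have "odd p" using p prime_odd_nat by blast
  then have h: "int p = 2 * h + 1" unfolding h_def by simp
  define S T where "S = (\<lambda>x::int. x\<^sup>2 mod int p) ` {0..h}" and "T = (\<lambda>y::int. (- 1 - y\<^sup>2) mod int p) ` {0..h}"
  have inj: "x = y" if "int p dvd x\<^sup>2 - y\<^sup>2" "x \<in> {0..h}" "y \<in> {0..h}" for x y :: int
  proof -
    have "x\<^sup>2 - y\<^sup>2 = (x - y) * (x + y)" by (simp add: power2_eq_square algebra_simps)
    then have "int p dvd (x - y) \<or> int p dvd (x + y)"
      using that(1) p by (metis prime_dvd_multD prime_int_nat_transfer nat_int of_nat_0_le_iff)
    moreover have "\<bar>x - y\<bar> < int p" "\<bar>x + y\<bar> < int p" using that h by auto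
    ultimately have "x - y = 0 \<or> x + y = 0" by (metis abs_of_nat dvd_imp_le_int not_le)
    then show ?thesis using that by auto
  qed
  have "inj_on (\<lambda>x::int. x\<^sup>2 mod int p) {0..h}"
    by (rule inj_onI) (metis inj mod_eq_dvd_iff)
  then have cS: "card S = nat (h + 1)" unfolding S_def by (simp add: card_image)
  have "inj_on (\<lambda>y::int. (- 1 - y\<^sup>2) mod int p) {0..h}"
  proof (rule inj_onI)
    fix x y assume xy: "x \<in> {0..h}" "y \<in> {0..h}" "(- 1 - x\<^sup>2) mod int p = (- 1 - y\<^sup>2) mod int p"
    then have "int p dvd (- 1 - x\<^sup>2) - (- 1 - y\<^sup>2)" by (simp only: mod_eq_dvd_iff)
    then have "int p dvd y\<^sup>2 - x\<^sup>2" by simp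
    then show "x = y" using inj xy by blast
  qed
  then have cT: "card T = nat (h + 1)" unfolding T_def by (simp add: card_image)
  have "S \<inter> T \<noteq> {}"
  proof
    assume disj: "S \<inter> T = {}"
    have sub: "S \<union> T \<subseteq> {0..<int p}" using p unfolding S_def T_def by auto
    have "card (S \<union> T) = card S + card T" using disj by (intro card_Un_disjoint) (auto simp: S_def T_def)
    moreover have "card (S \<union> T) \<le> card {0..<int p}" using sub by (rule card_mono[rotated]) simp
    ultimately have "nat (h + 1) + nat (h + 1) \<le> p" using cS cT by simp
    then show False using h by linarith
  qed
  then obtain x y where xy: "x \<in> {0..h}" "y \<in> {0..h}" "x\<^sup>2 mod int p = (- 1 - y\<^sup>2) mod int p"
  proof -
    from \<open>S \<inter> T \<noteq> {}\<close> obtain v where "v \<in> S" "v \<in> T" by blast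
    then show ?thesis using that unfolding S_def T_def by blast
  qed
  then have "int p dvd x\<^sup>2 - (- 1 - y\<^sup>2)" by (simp only: mod_eq_dvd_iff)
  then have "int p dvd x\<^sup>2 + y\<^sup>2 + 1" by (simp add: algebra_simps)
  then show ?thesis using xy h by auto
qed

lemma ex_centered_residue:
  fixes x m :: int
  assumes "m > 0"
  shows "\<exists>y q. x = y + m * q \<and> 2 * \<bar>y\<bar> \<le> m"
proof -
  have r: "0 \<le> x mod m" "x mod m < m" using assms by simp_all
  show ?thesis
  proof (cases "2 * (x mod m) \<le> m")
    case True
    then show ?thesis using r by (intro exI[of _ "x mod m"] exI[of _ "x div m"]) simp
  next
    case False
    then show ?thesis using r
      by (intro exI[of _ "x mod m - m"] exI[of _ "x div m + 1"]) (simp add: distrib_left)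
  qed
qed

lemma square_le_of_centered: "2 * \<bar>y\<bar> \<le> m \<Longrightarrow> 4 * y\<^sup>2 \<le> (m::int)\<^sup>2"
  using power_mono[of "2 * \<bar>y\<bar>" m 2] by (simp add: power_mult_distrib)

text \<open>Centred residues w, x, y, z of a, b, c, d modulo m have a sum of squares m r. Euler's
  identity writes (m p)(m r) as four squares, each divisible by m^2, which is then
  cancelled.\<close>

lemma four_squares_descent:
  fixes p m :: int
  assumes p: "prime p" and m: "1 < m" "m < p" and f: "four_squares (m * p)"
  shows "\<exists>r. 0 < r \<and> r < m \<and> four_squares (r * p)"
proof -
  obtain a b c d where abcd: "m * p = a\<^sup>2 + b\<^sup>2 + c\<^sup>2 + d\<^sup>2" using f unfolding four_squares_def by blast
  obtain w w' where w': "a = w + m * w'" and w: "2 * \<bar>w\<bar> \<le> m"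
    using ex_centered_residue[of m a] m by auto
  obtain x x' where x': "b = x + m * x'" and x: "2 * \<bar>x\<bar> \<le> m"
    using ex_centered_residue[of m b] m by auto
  obtain y y' where y': "c = y + m * y'" and y: "2 * \<bar>y\<bar> \<le> m"
    using ex_centered_residue[of m c] m by auto
  obtain z z' where z': "d = z + m * z'" and z: "2 * \<bar>z\<bar> \<le> m"
    using ex_centered_residue[of m d] m by auto
  define s where "s = w\<^sup>2 + x\<^sup>2 + y\<^sup>2 + z\<^sup>2"
  define l where "l = w'\<^sup>2 + x'\<^sup>2 + y'\<^sup>2 + z'\<^sup>2"
  define k where "k = w * w' + x * x' + y * y' + z * z'"
  \<comment> \<open>Serves twice: modulo m it gives s = m r, and modulo m^2 it excludes s = 0 and s
    = m^2.\<close>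
  have mp: "m * p = s + 2 * m * k + m\<^sup>2 * l"
    unfolding abcd w' x' y' z' s_def l_def k_def by (simp add: power2_eq_square algebra_simps)
  have "s = m * (p - 2 * k - m * l)" using mp by (simp add: power2_eq_square algebra_simps)
  then obtain r where r: "s = m * r" by blast
  have mm: "\<not> m\<^sup>2 dvd m * p"
  proof
    assume "m\<^sup>2 dvd m * p"
    then have "m dvd p" using m by (simp add: power2_eq_square)
    then show False using p m by (metis prime_int_iff less_le_trans not_less order_less_le zdvd_not_zless prime_gt_0_int dvd_refl zero_less_one less_trans)
  qed
  have s4: "4 * s \<le> 4 * m\<^sup>2"
    using square_le_of_centered[OF w] square_le_of_centered[OF x] square_le_of_centered[OF y]
      square_le_of_centered[OF z] unfolding s_def by simp
  have "s \<ge> 0" by (simp add: s_def)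
  have "s \<noteq> 0"
  proof
    assume "s = 0"
    then have "w = 0" "x = 0" "y = 0" "z = 0" unfolding s_def
      by (smt (verit) zero_le_power2 power2_less_0 zero_eq_power2)+
    then have "m * p = m\<^sup>2 * l" using mp \<open>s = 0\<close> unfolding k_def by simp
    then show False using mm by simp
  qed
  \<comment> \<open>Equality would make every residue m / 2 in absolute value; then m divides 2 k,
    and m^2 divides m p. Excluding it makes r < m strict.\<close>
  moreover have "s \<noteq> m\<^sup>2"
  proof
    assume sm: "s = m\<^sup>2"
    have "4 * w\<^sup>2 = m\<^sup>2" "4 * x\<^sup>2 = m\<^sup>2" "4 * y\<^sup>2 = m\<^sup>2" "4 * z\<^sup>2 = m\<^sup>2"
      using square_le_of_centered[OF w] square_le_of_centered[OF x] square_le_of_centered[OF y]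
        square_le_of_centered[OF z] sm unfolding s_def by linarith+
    moreover have half: "m dvd 2 * v" if "4 * v\<^sup>2 = m\<^sup>2" for v
    proof -
      have "(2 * v)\<^sup>2 = m\<^sup>2" using that by (simp add: power_mult_distrib)
      then have "2 * v = m \<or> 2 * v = - m" by (simp only: power2_eq_iff)
      then show ?thesis by auto
    qed
    ultimately have "m dvd 2 * w" "m dvd 2 * x" "m dvd 2 * y" "m dvd 2 * z" by blast+
    then have "m dvd 2 * w * w' + 2 * x * x' + 2 * y * y' + 2 * z * z'"
      by (meson dvd_add dvd_mult2)
    also have "2 * w * w' + 2 * x * x' + 2 * y * y' + 2 * z * z' = 2 * k" unfolding k_def by simp
    finally have "m dvd 2 * k" .
    then have "m * m dvd m * (2 * k)" by (rule mult_dvd_mono[OF dvd_refl])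
    then have "m\<^sup>2 dvd s + 2 * m * k + m\<^sup>2 * l"
      unfolding sm by (intro dvd_add) (auto simp: power2_eq_square mult_ac)
    then show False using mm mp by simp
  qed
  ultimately have "0 < s" "s < m\<^sup>2" using s4 \<open>s \<ge> 0\<close> by linarith+
  then have "0 < m * r" "m * r < m * m" unfolding r power2_eq_square .
  then have r0: "0 < r" "r < m" using m by (auto simp: zero_less_mult_iff)
  have prod: "(m * p) * s = (a * w + b * x + c * y + d * z)\<^sup>2 + (a * x - b * w + c * z - d * y)\<^sup>2
    + (a * y - c * w + d * x - b * z)\<^sup>2 + (a * z - d * w + b * y - c * x)\<^sup>2"
    unfolding abcd s_def by (rule euler_four_squares)
  have "a * w + b * x + c * y + d * z = m * (r + k)"
    using r unfolding w' x' y' z' k_def s_def by (simp add: power2_eq_square algebra_simps)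
  moreover have "a * x - b * w + c * z - d * y = m * (w' * x - x' * w + y' * z - z' * y)"
    "a * y - c * w + d * x - b * z = m * (w' * y - y' * w + z' * x - x' * z)"
    "a * z - d * w + b * y - c * x = m * (w' * z - z' * w + x' * y - y' * x)"
    unfolding w' x' y' z' by (simp_all add: algebra_simps)
  ultimately have "m\<^sup>2 * (r * p) = m\<^sup>2 * ((r + k)\<^sup>2 + (w' * x - x' * w + y' * z - z' * y)\<^sup>2
      + (w' * y - y' * w + z' * x - x' * z)\<^sup>2 + (w' * z - z' * w + x' * y - y' * x)\<^sup>2)"
    using prod unfolding r by (simp add: power_mult_distrib distrib_left power2_eq_square mult_ac)
  moreover have "m\<^sup>2 \<noteq> 0" using m by simp
  ultimately have "four_squares (r * p)" unfolding four_squares_def mult_cancel_left by blast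
  then show ?thesis using r0 by blast
qed

text \<open>For odd p the sum x^2 + y^2 + 1^2 + 0^2 = m p starts the descent, and x, y < p / 2 gives
  m < p.\<close>

lemma four_squares_prime:
  fixes p :: nat
  assumes p: "prime p"
  shows "four_squares (int p)"
proof (cases "p = 2")
  case True
  have "(2::int) = 1\<^sup>2 + 1\<^sup>2 + 0\<^sup>2 + 0\<^sup>2" by simp
  then show ?thesis unfolding True four_squares_def by (metis of_nat_numeral)
next
  case False
  then have p2: "p > 2" using p prime_ge_2_nat[of p] by simp
  have pi: "prime (int p)" using p by simp
  have desc: "four_squares (int p)" if "0 < m" "m < p" "four_squares (int m * int p)" for m
    using that
  proof (induction m rule: less_induct)
    case (less m)
    show ?case
    proof (cases "m = 1")
      case True
      then show ?thesis using less.prems by simp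
    next
      case False
      then obtain r where r: "0 < r" "r < int m" "four_squares (r * int p)"
        using four_squares_descent[OF pi, of "int m"] less.prems by auto
      then show ?thesis using less.IH[of "nat r"] less.prems by (simp add: nat_less_iff)
    qed
  qed
  obtain x y where xy: "int p dvd x\<^sup>2 + y\<^sup>2 + 1" "0 \<le> x" "2 * x < int p" "0 \<le> y" "2 * y < int p"
    using ex_dvd_sum_two_squares_plus_1[OF p p2] by blast
  then obtain m where m: "x\<^sup>2 + y\<^sup>2 + 1 = int p * m" by blast
  have "four_squares (m * int p)"
    unfolding four_squares_def
    by (rule exI[of _ x], rule exI[of _ y], rule exI[of _ 1], rule exI[of _ 0]) (use m in \<open>simp add: mult.commute\<close>)
  moreover have "m > 0"
  proof -
    have "x\<^sup>2 + y\<^sup>2 + 1 > 0" using zero_le_power2[of x] zero_le_power2[of y] by linarith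
    then show ?thesis unfolding m using p2 by (simp add: zero_less_mult_iff)
  qed
  moreover have "m < int p"
  proof -
    have "4 * x\<^sup>2 \<le> (int p)\<^sup>2" "4 * y\<^sup>2 \<le> (int p)\<^sup>2" using xy by (auto intro!: square_le_of_centered)
    moreover have "(int p)\<^sup>2 \<ge> 9" using p2 power_mono[of 3 "int p" 2] by simp
    ultimately have "int p * m < int p * int p" using m by (simp add: power2_eq_square)
    then show ?thesis using p2 by simp
  qed
  ultimately show ?thesis using desc[of "nat m"] by (simp add: nat_less_iff)
qed

lemma four_squares_nat: "four_squares (int n)"
proof (induction n rule: less_induct)
  case (less n)
  consider "n = 0" | "n = 1" | "n > 1" by linarith
  then show ?case
  proof cases
    case 1
    then show ?thesis unfolding four_squares_def by (intro exI[of _ 0]) simp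
  next
    case 2
    have "int n = 1\<^sup>2 + 0\<^sup>2 + 0\<^sup>2 + 0\<^sup>2" using 2 by simp
    then show ?thesis unfolding four_squares_def by blast
  next
    case 3
    then obtain p where p: "prime p" "p dvd n" using prime_factor_nat[of n] by auto
    then obtain k where k: "n = p * k" by blast
    have "k > 0" using 3 k by (cases k) auto
    then have "k < n" using 3 k prime_gt_1_nat[OF p(1)] mult_strict_right_mono[of 1 p k] by simp
    then have "four_squares (int p * int k)" using less four_squares_prime[OF p(1)] by (intro four_squares_mult) auto
    then show ?thesis using k by simp
  qed
qed

section \<open>Polynomial expressions and polynomials\<close>

definition eval_monom :: "(nat \<Rightarrow> int) \<Rightarrow> (nat \<Rightarrow>\<^sub>0 nat) \<Rightarrow> int" where
  "eval_monom e m = (\<Prod>i\<in>Poly_Mapping.keys m. e i ^ Poly_Mapping.lookup m i)"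

lemma eval_monom_superset:
  assumes "finite A" "Poly_Mapping.keys m \<subseteq> A"
  shows "eval_monom e m = (\<Prod>i\<in>A. e i ^ Poly_Mapping.lookup m i)"
  unfolding eval_monom_def using assms
  by (intro prod.mono_neutral_left) (auto simp: in_keys_iff)

lemma eval_monom_add: "eval_monom e (m + n) = eval_monom e m * eval_monom e n"
proof -
  let ?A = "Poly_Mapping.keys m \<union> Poly_Mapping.keys n"
  have "Poly_Mapping.keys (m + n) \<subseteq> ?A" by (rule keys_add)
  then show ?thesis
    by (simp add: eval_monom_superset[of ?A] lookup_add power_add prod.distrib)
qed

lemma eval_mpoly_superset:
  assumes "finite A" "Poly_Mapping.keys H \<subseteq> A"
  shows "eval_mpoly e H = (\<Sum>m\<in>A. Poly_Mapping.lookup H m * eval_monom e m)"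
  unfolding eval_mpoly_def eval_monom_def[symmetric] using assms
  by (intro sum.mono_neutral_left) (auto simp: in_keys_iff)

lemma eval_mpoly_add: "eval_mpoly e (H + K) = eval_mpoly e H + eval_mpoly e K"
proof -
  let ?A = "Poly_Mapping.keys H \<union> Poly_Mapping.keys K"
  have "Poly_Mapping.keys (H + K) \<subseteq> ?A" by (rule keys_add)
  then show ?thesis
    by (simp add: eval_mpoly_superset[of ?A] lookup_add distrib_right sum.distrib)
qed

lemma eval_mpoly_single: "eval_mpoly e (Poly_Mapping.single m c) = c * eval_monom e m"
  by (simp add: eval_mpoly_superset[of "{m}"])

lemma vars_mpoly_add: "vars_mpoly (H + K) \<subseteq> vars_mpoly H \<union> vars_mpoly K"
  using keys_add[of H K] unfolding vars_mpoly_def by blast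

text \<open>Expansion into an uncollected list of monomials with coefficients turns multiplication
  into addition of exponents, so that only sums of single monomials remain to be evaluated. Unknowns
  are placed after the r parameters.\<close>

primrec terms_of_pexp :: "nat \<Rightarrow> pexp \<Rightarrow> ((nat \<Rightarrow>\<^sub>0 nat) \<times> int) list" where
  "terms_of_pexp r (Par i) = [(Poly_Mapping.single i 1, 1)]"
| "terms_of_pexp r (Unk i) = [(Poly_Mapping.single (r + i) 1, 1)]"
| "terms_of_pexp r (Cst c) = [(0, c)]"
| "terms_of_pexp r (Add p q) = terms_of_pexp r p @ terms_of_pexp r q"
| "terms_of_pexp r (Mul p q) =
    concat (map (\<lambda>(m, c). map (\<lambda>(n, d). (m + n, c * d)) (terms_of_pexp r q)) (terms_of_pexp r p))"

definition eval_terms :: "(nat \<Rightarrow> int) \<Rightarrow> ((nat \<Rightarrow>\<^sub>0 nat) \<times> int) list \<Rightarrow> int" where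
  "eval_terms e ts = sum_list (map (\<lambda>(m, c). c * eval_monom e m) ts)"

lemma eval_terms_simps:
  "eval_terms e [] = 0"
  "eval_terms e ((m, c) # ts) = c * eval_monom e m + eval_terms e ts"
  "eval_terms e (ts @ us) = eval_terms e ts + eval_terms e us"
  by (simp_all add: eval_terms_def)

lemma eval_terms_mult_monom:
  "eval_terms e (map (\<lambda>(n, d). (m + n, c * d)) us) = c * eval_monom e m * eval_terms e us"
  by (induction us) (auto simp: eval_terms_simps eval_monom_add algebra_simps)

lemma eval_terms_mult:
  "eval_terms e (concat (map (\<lambda>(m, c). map (\<lambda>(n, d). (m + n, c * d)) us) ts)) = eval_terms e ts * eval_terms e us"
  by (induction ts) (auto simp: eval_terms_simps eval_terms_mult_monom algebra_simps)

lemma eval_terms_of_pexp: "eval_terms e (terms_of_pexp r p) = peval e (\<lambda>i. e (r + i)) p"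
  by (induction p) (simp_all add: eval_terms_simps eval_terms_mult eval_monom_def)

lemma keys_terms_of_pexp:
  "(m, c) \<in> set (terms_of_pexp r p) \<Longrightarrow> Poly_Mapping.keys m \<subseteq> pars p \<union> (+) r ` unks p"
proof (induction p arbitrary: m c)
  case (Mul p q)
  then obtain m' c' n d where "(m', c') \<in> set (terms_of_pexp r p)" "(n, d) \<in> set (terms_of_pexp r q)"
    "m = m' + n" by auto
  then show ?case using Mul.IH keys_add[of m' n] by fastforce
qed fastforce+

lemma ex_mpoly_of_terms:
  "\<exists>H. vars_mpoly H \<subseteq> (\<Union>(m, c)\<in>set ts. Poly_Mapping.keys m) \<and> (\<forall>e. eval_mpoly e H = eval_terms e ts)"
proof (induction ts)
  case Nil
  show ?case by (rule exI[of _ 0]) (simp add: vars_mpoly_def eval_mpoly_def eval_terms_simps)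
next
  case (Cons t ts)
  obtain m c where t: "t = (m, c)" by fastforce
  obtain H where H: "vars_mpoly H \<subseteq> (\<Union>(m, c)\<in>set ts. Poly_Mapping.keys m)" "\<And>e. eval_mpoly e H = eval_terms e ts"
    using Cons by blast
  have "vars_mpoly (Poly_Mapping.single m c) \<subseteq> Poly_Mapping.keys m" by (simp add: vars_mpoly_def)
  then have "vars_mpoly (Poly_Mapping.single m c + H) \<subseteq> (\<Union>(m, c)\<in>set (t # ts). Poly_Mapping.keys m)"
    using vars_mpoly_add[of "Poly_Mapping.single m c" H] H(1) unfolding t by auto
  then show ?case
    by (intro exI[of _ "Poly_Mapping.single m c + H"]) (simp add: t eval_mpoly_add eval_mpoly_single H eval_terms_simps)
qed

lemma ex_mpoly_of_pexp:
  "\<exists>H. vars_mpoly H \<subseteq> pars p \<union> (+) r ` unks p \<and> (\<forall>e. eval_mpoly e H = peval e (\<lambda>i. e (r + i)) p)"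
proof -
  obtain H where "vars_mpoly H \<subseteq> (\<Union>(m, c)\<in>set (terms_of_pexp r p). Poly_Mapping.keys m)"
    "\<forall>e. eval_mpoly e H = eval_terms e (terms_of_pexp r p)"
    using ex_mpoly_of_terms by blast
  then show ?thesis
    using keys_terms_of_pexp[of _ _ r p] unfolding eval_terms_of_pexp by (intro exI[of _ H]) fastforce
qed

text \<open>Each unknown gets its own block of four indices. Lagrange's theorem gives the forward
  direction; conversely a sum of squares is non-negative.\<close>

lemma ex_nat_seq_iff_ex_int_seq:
  "(\<exists>z::nat \<Rightarrow> nat. Q (\<lambda>i. int (z i))) \<longleftrightarrow>
    (\<exists>v::nat \<Rightarrow> int. Q (\<lambda>i. (v (4 * i))\<^sup>2 + (v (4 * i + 1))\<^sup>2 + (v (4 * i + 2))\<^sup>2 + (v (4 * i + 3))\<^sup>2))"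
proof
  assume "\<exists>z::nat \<Rightarrow> nat. Q (\<lambda>i. int (z i))"
  then obtain z :: "nat \<Rightarrow> nat" where z: "Q (\<lambda>i. int (z i))" by blast
  have "\<forall>i. \<exists>a b c d. int (z i) = a\<^sup>2 + b\<^sup>2 + c\<^sup>2 + d\<^sup>2" using four_squares_nat unfolding four_squares_def by blast
  then obtain a b c d where abcd: "\<And>i. int (z i) = (a i)\<^sup>2 + (b i)\<^sup>2 + (c i)\<^sup>2 + (d i)\<^sup>2" by metis
  define v where "v j = (if j mod 4 = 0 then a (j div 4) else if j mod 4 = 1 then b (j div 4)
      else if j mod 4 = 2 then c (j div 4) else d (j div 4))" for j
  have "Suc (4 * i) mod 4 = 1" "Suc (Suc (4 * i)) mod 4 = 2" "(4 * i + 3) mod 4 = 3"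
    "Suc (4 * i) div 4 = i" "Suc (Suc (4 * i)) div 4 = i" "(4 * i + 3) div 4 = i" for i :: nat
    by presburger+
  then have "v (4 * i) = a i" "v (4 * i + 1) = b i" "v (4 * i + 2) = c i" "v (4 * i + 3) = d i" for i
    unfolding v_def by simp_all
  then show "\<exists>v::nat \<Rightarrow> int. Q (\<lambda>i. (v (4 * i))\<^sup>2 + (v (4 * i + 1))\<^sup>2 + (v (4 * i + 2))\<^sup>2 + (v (4 * i + 3))\<^sup>2)"
    using z unfolding abcd by (intro exI[of _ v]) simp
next
  assume "\<exists>v::nat \<Rightarrow> int. Q (\<lambda>i. (v (4 * i))\<^sup>2 + (v (4 * i + 1))\<^sup>2 + (v (4 * i + 2))\<^sup>2 + (v (4 * i + 3))\<^sup>2)"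
  then obtain v :: "nat \<Rightarrow> int"
    where "Q (\<lambda>i. (v (4 * i))\<^sup>2 + (v (4 * i + 1))\<^sup>2 + (v (4 * i + 2))\<^sup>2 + (v (4 * i + 3))\<^sup>2)" by blast
  then show "\<exists>z::nat \<Rightarrow> nat. Q (\<lambda>i. int (z i))"
    by (intro exI[of _ "\<lambda>i. nat ((v (4 * i))\<^sup>2 + (v (4 * i + 1))\<^sup>2 + (v (4 * i + 2))\<^sup>2 + (v (4 * i + 3))\<^sup>2)"]) simp
qed

lemma nat_diophantine_imp_diophantine:
  assumes "nat_diophantine r \<Omega>"
  shows "diophantine r \<Omega>"
proof -
  obtain p where pars: "pars p \<subseteq> {..<r}"
    and mem: "\<And>a. length a = r \<Longrightarrow> a \<in> \<Omega> \<longleftrightarrow> (\<exists>z::nat \<Rightarrow> nat. peval (nth a) (\<lambda>i. int (z i)) p = 0)"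
    using assms unfolding nat_diophantine_def by blast
  define sq where "sq j = Mul (Unk j) (Unk j)" for j
  define q where "q = psubst Par (\<lambda>i. Add (Add (Add (sq (4 * i)) (sq (4 * i + 1))) (sq (4 * i + 2))) (sq (4 * i + 3))) p"
  have q: "a \<in> \<Omega> \<longleftrightarrow> (\<exists>v. peval (nth a) v q = 0)" if "length a = r" for a
    unfolding mem[OF that] ex_nat_seq_iff_ex_int_seq[where Q = "\<lambda>z. peval (nth a) z p = 0"]
    by (simp add: q_def peval_psubst sq_def power2_eq_square)
  have parsq: "pars q \<subseteq> {..<r}" using pars by (auto simp: q_def pars_psubst sq_def)
  obtain w where w: "unks q \<subseteq> {..<w}" using unks_bounded by blast
  obtain H where H: "vars_mpoly H \<subseteq> pars q \<union> (+) r ` unks q"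
    and ev: "\<And>e. eval_mpoly e H = peval e (\<lambda>i. e (r + i)) q" using ex_mpoly_of_pexp by blast
  have "vars_mpoly H \<subseteq> {..<r + w}" using H parsq w by fastforce
  moreover have "y \<in> \<Omega> \<longleftrightarrow> (\<exists>x. length x = w \<and> eval_mpoly (nth (y @ x)) H = 0)" if y: "length y = r" for y
  proof -
    \<comment> \<open>Passage between total sequences and lists of length w: only entries below w
      are read.\<close>
    have eq: "eval_mpoly (nth (y @ x)) H = peval (nth y) v q"
      if "length x = w" "\<And>i. i < w \<Longrightarrow> x ! i = v i" for x v
      unfolding ev by (rule peval_cong) (use y that parsq w in \<open>auto simp: nth_append\<close>)
    show ?thesis unfolding q[OF y]
    proof
      assume "\<exists>v. peval ((!) y) v q = 0"
      then obtain v where "peval ((!) y) v q = 0" by blast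
      then show "\<exists>x. length x = w \<and> eval_mpoly (nth (y @ x)) H = 0"
        using eq[of "map v [0..<w]" v] by (intro exI[of _ "map v [0..<w]"]) simp
    next
      assume "\<exists>x. length x = w \<and> eval_mpoly (nth (y @ x)) H = 0"
      then show "\<exists>v. peval ((!) y) v q = 0" using eq by metis
    qed
  qed
  ultimately show ?thesis unfolding diophantine_def by blast
qed


section \<open>Functional conceptual substrata\<close>

lemma interp_int_struct [simp]: "fun_interp int_struct = int_fun_interp" "rel_interp int_struct = int_rel_interp"
  by (simp_all add: int_struct_def)

text \<open>Replaces the writing of syntactic terms by closure properties of the functions they
  denote.\<close>

definition term_definable :: "nat set \<Rightarrow> ((nat \<Rightarrow> int) \<Rightarrow> int) \<Rightarrow> bool" where
  "term_definable V F \<longleftrightarrow> (\<exists>t. is_term ordered_ring_language t \<and> vars_term t \<subseteq> V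
     \<and> (\<forall>e. eval_term int_struct e t = F e))"

lemma term_definable_var: "i \<in> V \<Longrightarrow> term_definable V (\<lambda>e. e i)"
  unfolding term_definable_def by (intro exI[of _ "Var i"]) simp

lemma term_definable_0: "term_definable V (\<lambda>e. 0)"
  unfolding term_definable_def
  by (intro exI[of _ "Fn Zero_sym []"]) (simp add: ordered_ring_language_def)

lemma term_definable_1: "term_definable V (\<lambda>e. 1)"
  unfolding term_definable_def
  by (intro exI[of _ "Fn One_sym []"]) (simp add: ordered_ring_language_def)

lemma term_definable_add:
  assumes "term_definable V F" "term_definable V G"
  shows "term_definable V (\<lambda>e. F e + G e)"
proof -
  obtain s t where "is_term ordered_ring_language s" "vars_term s \<subseteq> V" "\<And>e. eval_term int_struct e s = F e"
    "is_term ordered_ring_language t" "vars_term t \<subseteq> V" "\<And>e. eval_term int_struct e t = G e"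
    using assms unfolding term_definable_def by blast
  then show ?thesis unfolding term_definable_def
    by (intro exI[of _ "Fn Plus_sym [s, t]"]) (simp add: ordered_ring_language_def)
qed

lemma term_definable_mult:
  assumes "term_definable V F" "term_definable V G"
  shows "term_definable V (\<lambda>e. F e * G e)"
proof -
  obtain s t where "is_term ordered_ring_language s" "vars_term s \<subseteq> V" "\<And>e. eval_term int_struct e s = F e"
    "is_term ordered_ring_language t" "vars_term t \<subseteq> V" "\<And>e. eval_term int_struct e t = G e"
    using assms unfolding term_definable_def by blast
  then show ?thesis unfolding term_definable_def
    by (intro exI[of _ "Fn Times_sym [s, t]"]) (simp add: ordered_ring_language_def)
qed

lemma term_definable_minus:
  assumes "term_definable V F"
  shows "term_definable V (\<lambda>e. - F e)"
proof -
  obtain s where "is_term ordered_ring_language s" "vars_term s \<subseteq> V" "\<And>e. eval_term int_struct e s = F e"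
    using assms unfolding term_definable_def by blast
  then show ?thesis unfolding term_definable_def
    by (intro exI[of _ "Fn Minus_sym [s]"]) (simp add: ordered_ring_language_def)
qed

lemma term_definable_int: "term_definable V (\<lambda>e. c)"
proof (cases c)
  case (nonneg n)
  have "term_definable V (\<lambda>e. int n)"
    by (induction n) (simp_all add: term_definable_0 term_definable_1 term_definable_add)
  then show ?thesis using nonneg by simp
next
  case (neg n)
  have "term_definable V (\<lambda>e. int n)" for n
    by (induction n) (simp_all add: term_definable_0 term_definable_1 term_definable_add)
  from term_definable_minus[OF this[of "Suc n"]] show ?thesis using neg by simp
qed

lemma term_definable_power: "term_definable V F \<Longrightarrow> term_definable V (\<lambda>e. F e ^ n)"
  by (induction n) (simp_all add: term_definable_1 term_definable_mult)

lemma term_definable_sum: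
  assumes "finite A" "\<And>x. x \<in> A \<Longrightarrow> term_definable V (F x)"
  shows "term_definable V (\<lambda>e. \<Sum>x\<in>A. F x e)"
  using assms by (induction A rule: finite_induct) (simp_all add: term_definable_0 term_definable_add)

lemma term_definable_prod:
  assumes "finite A" "\<And>x. x \<in> A \<Longrightarrow> term_definable V (F x)"
  shows "term_definable V (\<lambda>e. \<Prod>x\<in>A. F x e)"
  using assms by (induction A rule: finite_induct) (simp_all add: term_definable_1 term_definable_mult)

lemma term_definable_mpoly: "term_definable (vars_mpoly H) (\<lambda>e. eval_mpoly e H)"
  unfolding eval_mpoly_def
  by (intro term_definable_sum term_definable_mult term_definable_int term_definable_prod
      term_definable_power term_definable_var finite_keys) (auto simp: vars_mpoly_def)

text \<open>The terms are the first r variables, which thereby copy the tuple a, and the only atom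
  is H = 0.\<close>

lemma diophantine_imp_functional_conceptual_substratum:
  assumes "diophantine r \<Omega>"
  shows "has_functional_conceptual_substratum ordered_ring_language int_struct r \<Omega>"
proof -
  obtain w H where vars: "vars_mpoly H \<subseteq> {..<r + w}"
    and mem: "\<And>y. length y = r \<Longrightarrow> y \<in> \<Omega> \<longleftrightarrow> (\<exists>x. length x = w \<and> eval_mpoly (nth (y @ x)) H = 0)"
    using assms unfolding diophantine_def by blast
  obtain t where t: "is_term ordered_ring_language t" "vars_term t \<subseteq> vars_mpoly H"
    "\<And>e. eval_term int_struct e t = eval_mpoly e H"
    using term_definable_mpoly[of H] unfolding term_definable_def by blast
  let ?ts = "map Var [0..<r] :: ring_fun trm list"
  let ?As = "[Eq t (Fn Zero_sym [])] :: (ring_fun, ring_rel) atom list"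
  have sat: "(\<forall>A\<in>set ?As. sat_atom int_struct e A) \<longleftrightarrow> eval_mpoly e H = 0" for e
    by (simp add: t)
  show ?thesis
    unfolding has_functional_conceptual_substratum_def
  proof (intro exI conjI allI impI)
    show "length ?ts = r" by simp
    show "\<forall>t\<in>set ?ts. is_term ordered_ring_language t \<and> vars_term t \<subseteq> {..<r + w}" by auto
    show "\<forall>A\<in>set ?As. is_atom ordered_ring_language A \<and> vars_atom A \<subseteq> {..<r + w}"
      using t vars by (auto simp: ordered_ring_language_def)
    fix a :: "int list" assume a: "length a = r"
    show "a \<in> \<Omega> \<longleftrightarrow> (\<exists>x. length x = r + w \<and> (\<forall>i<r. a ! i = eval_term int_struct (nth x) (?ts ! i))
        \<and> (\<forall>A\<in>set ?As. sat_atom int_struct (nth x) A))"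
      unfolding mem[OF a] sat
    proof
      assume "\<exists>x. length x = w \<and> eval_mpoly (nth (a @ x)) H = 0"
      then obtain x where "length x = w" "eval_mpoly (nth (a @ x)) H = 0" by blast
      then show "\<exists>x. length x = r + w \<and> (\<forall>i<r. a ! i = eval_term int_struct (nth x) (?ts ! i))
          \<and> eval_mpoly (nth x) H = 0"
        using a by (intro exI[of _ "a @ x"]) (simp add: nth_append)
    next
      assume "\<exists>x. length x = r + w \<and> (\<forall>i<r. a ! i = eval_term int_struct (nth x) (?ts ! i))
          \<and> eval_mpoly (nth x) H = 0"
      then obtain x where x: "length x = r + w" "\<forall>i<r. a ! i = x ! i" "eval_mpoly (nth x) H = 0" by auto
      then have "take r x = a" using a by (intro nth_equalityI) auto
      then have "x = a @ drop r x" by (metis append_take_drop_id)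
      then show "\<exists>x. length x = w \<and> eval_mpoly (nth (a @ x)) H = 0"
        using x by (intro exI[of _ "drop r x"]) simp
    qed
  qed
qed

section \<open>From substrata to polynomial equations\<close>

lemma eval_term_cong:
  "(\<And>i. i \<in> vars_term t \<Longrightarrow> e i = e' i) \<Longrightarrow> eval_term M e t = eval_term M e' t"
proof (induction t)
  case (Fn f ts)
  then have "map (eval_term M e) ts = map (eval_term M e') ts" by (intro map_cong) auto
  then show ?case by (simp only: eval_term.simps)
qed simp

lemma sat_atom_cong:
  assumes "\<And>i. i \<in> vars_atom A \<Longrightarrow> e i = e' i"
  shows "sat_atom M e A = sat_atom M e' A"
proof (cases A)
  case (Eq s t)
  then show ?thesis using assms eval_term_cong[of s e e' M] eval_term_cong[of t e e' M] by simp
next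
  case (Rel p ts)
  then have "map (eval_term M e) ts = map (eval_term M e') ts"
    using assms by (intro map_cong eval_term_cong) auto
  then show ?thesis using Rel by (simp only: sat_atom.simps)
qed

lemma ex_pexp_of_term:
  "is_term ordered_ring_language t \<Longrightarrow> \<exists>p. pars p = {} \<and> (\<forall>e z. eval_term int_struct z t = peval e z p)"
proof (induction t)
  case (Var i)
  show ?case by (intro exI[of _ "Unk i"]) simp
next
  case (Fn f ts)
  have len: "length ts = ring_fun_arity f" and ts: "\<And>t. t \<in> set ts \<Longrightarrow> is_term ordered_ring_language t"
    using Fn.prems by (auto simp: ordered_ring_language_def)
  note IH = Fn.IH[OF _ ts]
  show ?case
  proof (cases f)
    case Zero_sym
    then show ?thesis using len by (intro exI[of _ "Cst 0"]) simp
  next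
    case One_sym
    then show ?thesis using len by (intro exI[of _ "Cst 1"]) simp
  next
    case Minus_sym
    then obtain t where t: "ts = [t]" using len by (auto simp: length_Suc_conv)
    then obtain p where "pars p = {}" "\<And>e z. eval_term int_struct z t = peval e z p" using IH by auto
    then show ?thesis using Minus_sym t
      by (intro exI[of _ "Mul (Cst (-1)) p"]) simp
  next
    case Plus_sym
    then obtain s t where t: "ts = [s, t]" using len by (auto simp: length_Suc_conv numeral_2_eq_2)
    then obtain p q where "pars p = {}" "\<And>e z. eval_term int_struct z s = peval e z p"
      "pars q = {}" "\<And>e z. eval_term int_struct z t = peval e z q"
      using IH[of s] IH[of t] by auto
    then show ?thesis using Plus_sym t by (intro exI[of _ "Add p q"]) simp
  next
    case Times_sym
    then obtain s t where t: "ts = [s, t]" using len by (auto simp: length_Suc_conv numeral_2_eq_2)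
    then obtain p q where "pars p = {}" "\<And>e z. eval_term int_struct z s = peval e z p"
      "pars q = {}" "\<And>e z. eval_term int_struct z t = peval e z q"
      using IH[of s] IH[of t] by auto
    then show ?thesis using Times_sym t by (intro exI[of _ "Mul p q"]) simp
  qed
qed

text \<open>One shape for both kinds of atom: c = 0 gives an equation, and c = 1 with the slack w
  gives s < t in the form t - s - 1 = w.\<close>

lemma ex_pexp_of_atom:
  assumes "is_atom ordered_ring_language A"
  shows "\<exists>q c. pars q = {} \<and> (\<forall>e z. sat_atom int_struct z A \<longleftrightarrow> (\<exists>w::nat. peval e z q = c * int w))"
proof (cases A)
  case (Eq s t)
  then obtain p q where "pars p = {}" "\<And>e z. eval_term int_struct z s = peval e z p"
      "pars q = {}" "\<And>e z. eval_term int_struct z t = peval e z q"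
    using ex_pexp_of_term[of s] ex_pexp_of_term[of t] assms by auto
  then show ?thesis
    using Eq by (intro exI[of _ "Add p (Mul (Cst (-1)) q)"] exI[of _ 0]) auto
next
  case (Rel l ts)
  then obtain s t where t: "ts = [s, t]"
    using assms by (cases l) (auto simp: length_Suc_conv numeral_2_eq_2 ordered_ring_language_def)
  then obtain p q where p: "pars p = {}" "\<And>e z. eval_term int_struct z s = peval e z p"
      and q: "pars q = {}" "\<And>e z. eval_term int_struct z t = peval e z q"
    using ex_pexp_of_term[of s] ex_pexp_of_term[of t] assms Rel by auto
  have "sat_atom int_struct z A \<longleftrightarrow> peval e z p < peval e z q" for e z
    using Rel t p(2)[of z e] q(2)[of z e] by (cases l) simp
  moreover have "a < b \<longleftrightarrow> (\<exists>w::nat. b - a - 1 = int w)" for a b :: int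
    by (auto intro: exI[of _ "nat (b - a - 1)"])
  ultimately show ?thesis
    using p q by (intro exI[of _ "Add (Add q (Mul (Cst (-1)) p)) (Cst (-1))"] exI[of _ 1]) simp
qed

lemma ex_int_seq_iff_ex_nat_seq_diff:
  "(\<exists>v::nat \<Rightarrow> int. Q v) \<longleftrightarrow> (\<exists>x y::nat \<Rightarrow> nat. Q (\<lambda>i. int (x i) - int (y i)))"
proof
  assume "\<exists>v. Q v"
  then obtain v where "Q v" by blast
  moreover have "(\<lambda>i. int (nat (v i)) - int (nat (- v i))) = v" by auto
  ultimately show "\<exists>x y::nat \<Rightarrow> nat. Q (\<lambda>i. int (x i) - int (y i))"
    by (intro exI[of _ "\<lambda>i. nat (v i)"] exI[of _ "\<lambda>i. nat (- v i)"]) simp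
qed blast

lemma functional_conceptual_substratum_imp_nat_diophantine:
  assumes "has_functional_conceptual_substratum ordered_ring_language int_struct r \<Omega>"
  shows "nat_diophantine r \<Omega>"
proof -
  obtain n and ts :: "ring_fun trm list" and As :: "(ring_fun, ring_rel) atom list" where
    len: "length ts = r" and ts': "\<forall>t\<in>set ts. is_term ordered_ring_language t \<and> vars_term t \<subseteq> {..<n}"
    and As': "\<forall>A\<in>set As. is_atom ordered_ring_language A \<and> vars_atom A \<subseteq> {..<n}"
    and mem': "\<forall>a. length a = r \<longrightarrow> (a \<in> \<Omega> \<longleftrightarrow> (\<exists>x. length x = n
      \<and> (\<forall>i<r. a ! i = eval_term int_struct (nth x) (ts ! i)) \<and> (\<forall>A\<in>set As. sat_atom int_struct (nth x) A)))"
    using assms unfolding has_functional_conceptual_substratum_def by (elim exE conjE)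
  note ts = len ts'[rule_format] and As = As'[rule_format] and mem = mem'[rule_format]
  define l where "l = length As"
  have "\<exists>p. pars p = {} \<and> (\<forall>e z. eval_term int_struct z (ts ! i) = peval e z p)" if "i < r" for i
    using ex_pexp_of_term ts that nth_mem by blast
  then obtain T where T: "\<And>i. i < r \<Longrightarrow> pars (T i) = {}"
    "\<And>i e z. i < r \<Longrightarrow> eval_term int_struct z (ts ! i) = peval e z (T i)" by metis
  have "\<exists>q c. pars q = {} \<and> (\<forall>e z. sat_atom int_struct z (As ! j) \<longleftrightarrow> (\<exists>w::nat. peval e z q = c * int w))"
    if "j < l" for j
    using ex_pexp_of_atom As that nth_mem unfolding l_def by blast
  then obtain q c where q: "\<And>j. j < l \<Longrightarrow> pars (q j) = {}"
    "\<And>j e z. j < l \<Longrightarrow> sat_atom int_struct z (As ! j) \<longleftrightarrow> (\<exists>w::nat. peval e z (q j) = c j * int w)" by metis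
  \<comment> \<open>An integer unknown is x i - y i. Two interleavings put x i at index 2 i and the
    second sequence at odd indices, which splits again into y at its even and the slacks w at its
    odd places.\<close>
  define sub where "sub = psubst Par (\<lambda>i. Add (Unk (2 * i)) (Mul (Cst (-1)) (Unk (Suc (2 * (2 * i))))))"
  define ps where "ps = map (\<lambda>i. Add (Par i) (Mul (Cst (-1)) (sub (T i)))) [0..<r]
    @ map (\<lambda>j. Add (sub (q j)) (Mul (Cst (- c j)) (Unk (Suc (2 * Suc (2 * j)))))) [0..<l]"
  have "pars (sum_squares ps) \<subseteq> {..<r}"
    by (auto simp: pars_sum_squares ps_def sub_def pars_psubst T q)
  moreover have "a \<in> \<Omega> \<longleftrightarrow> (\<exists>z::nat \<Rightarrow> nat. peval (nth a) (\<lambda>i. int (z i)) (sum_squares ps) = 0)"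
    if a: "length a = r" for a
  proof -
    let ?sol = "\<lambda>v. (\<forall>i<r. a ! i = eval_term int_struct v (ts ! i)) \<and> (\<forall>A\<in>set As. sat_atom int_struct v A)"
    have "a \<in> \<Omega> \<longleftrightarrow> (\<exists>v. ?sol v)"
      unfolding mem[OF a]
    proof
      assume "\<exists>v. ?sol v"
      then obtain v where v: "?sol v" by blast
      let ?x = "map v [0..<n]"
      have "eval_term int_struct (nth ?x) t = eval_term int_struct v t" if "t \<in> set ts" for t
        using ts(2)[OF that] by (intro eval_term_cong) auto
      moreover have "sat_atom int_struct (nth ?x) A = sat_atom int_struct v A" if "A \<in> set As" for A
        using As[OF that] by (intro sat_atom_cong) auto
      ultimately show "\<exists>x. length x = n \<and> ?sol (nth x)"
        using v ts(1) by (intro exI[of _ ?x]) simp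
    qed blast
    also have "\<dots> \<longleftrightarrow> (\<exists>v. (\<forall>i<r. a ! i = peval (nth a) v (T i))
        \<and> (\<forall>j<l. \<exists>w::nat. peval (nth a) v (q j) = c j * int w))"
      unfolding all_set_conv_all_nth l_def[symmetric] using T(2) q(2) by (intro ex_cong1) metis
    also have "\<dots> \<longleftrightarrow> (\<exists>v. \<exists>w::nat \<Rightarrow> nat. (\<forall>i<r. a ! i = peval (nth a) v (T i))
        \<and> (\<forall>j<l. peval (nth a) v (q j) = c j * int (w j)))"
      by (intro ex_cong1) metis
    also have "\<dots> \<longleftrightarrow> (\<exists>z::nat \<Rightarrow> nat. \<forall>p\<in>set ps. peval (nth a) (\<lambda>i. int (z i)) p = 0)"
      unfolding ex_int_seq_iff_ex_nat_seq_diff ex_pair_iff_ex_interleave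
      unfolding ex_pair_iff_ex_interleave[of "\<lambda>x u. _ x (\<lambda>i. u (2 * i)) (\<lambda>i. u (Suc (2 * i)))"]
      by (simp add: ps_def sub_def peval_psubst ball_Un, simp add: Ball_def)
    finally show ?thesis unfolding peval_sum_squares_eq_0 .
  qed
  ultimately show ?thesis unfolding nat_diophantine_def by blast
qed


section \<open>Diophantine sets are recursively enumerable\<close>

definition total_recursive :: "nat \<Rightarrow> (nat list \<Rightarrow> nat) \<Rightarrow> bool" where
  "total_recursive k F \<longleftrightarrow> (\<exists>f. has_arity f k \<and> (\<forall>xs y. length xs = k \<longrightarrow> (computes f xs y \<longleftrightarrow> y = F xs)))"

lemma total_recursive_cong:
  assumes "total_recursive k F" "\<And>xs. length xs = k \<Longrightarrow> F xs = G xs"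
  shows "total_recursive k G"
  using assms unfolding total_recursive_def by metis

lemma total_recursive_nth: "i < k \<Longrightarrow> total_recursive k (\<lambda>xs. xs ! i)"
  unfolding total_recursive_def
  by (intro exI[of _ "RProj i"]) (simp add: has_arity.intros computes_RProj_iff)

lemma total_recursive_comp:
  assumes F: "total_recursive (length Gs) F" and Gs: "\<And>G. G \<in> set Gs \<Longrightarrow> total_recursive k G"
  shows "total_recursive k (\<lambda>xs. F (map (\<lambda>G. G xs) Gs))"
proof -
  obtain f where f: "has_arity f (length Gs)" "\<And>xs y. length xs = length Gs \<Longrightarrow> computes f xs y \<longleftrightarrow> y = F xs"
    using F unfolding total_recursive_def by blast
  obtain g where g: "\<And>G. G \<in> set Gs \<Longrightarrow> has_arity (g G) k"
    "\<And>G xs y. G \<in> set Gs \<Longrightarrow> length xs = k \<Longrightarrow> computes (g G) xs y \<longleftrightarrow> y = G xs"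
    using Gs unfolding total_recursive_def by metis
  have "computes (RComp f (map g Gs)) xs y \<longleftrightarrow> y = F (map (\<lambda>G. G xs) Gs)" if xs: "length xs = k" for xs y
  proof -
    have "computes (RComp f (map g Gs)) xs y
        \<longleftrightarrow> (\<exists>w. (\<forall>j<length Gs. w j = (Gs ! j) xs) \<and> y = F (map w [0..<length Gs]))"
      unfolding computes_RComp_iff using xs by (simp add: g(2) f(2))
    also have "\<dots> \<longleftrightarrow> y = F (map (\<lambda>G. G xs) Gs)"
    proof -
      have "map w [0..<length Gs] = map (\<lambda>G. G xs) Gs" if "\<forall>j<length Gs. w j = (Gs ! j) xs" for w
        using that by (intro nth_equalityI) auto
      from this this[of "\<lambda>j. (Gs ! j) xs"] show ?thesis
        by (intro iffI exI[of _ "\<lambda>j. (Gs ! j) xs"]) auto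
    qed
    finally show ?thesis .
  qed
  moreover have "has_arity (RComp f (map g Gs)) k" using f(1) g(1) by (auto intro!: has_arity.intros)
  ultimately show ?thesis unfolding total_recursive_def by blast
qed

lemma total_recursive_prim:
  assumes "total_recursive k F" "total_recursive (Suc (Suc k)) G"
  shows "total_recursive (Suc k) (\<lambda>xs. rec_nat (F (tl xs)) (\<lambda>n y. G (n # y # tl xs)) (hd xs))"
proof -
  obtain f where f: "has_arity f k" "\<And>xs y. length xs = k \<Longrightarrow> computes f xs y \<longleftrightarrow> y = F xs"
    using assms unfolding total_recursive_def by blast
  obtain g where g: "has_arity g (Suc (Suc k))"
    "\<And>xs y. length xs = Suc (Suc k) \<Longrightarrow> computes g xs y \<longleftrightarrow> y = G xs"
    using assms unfolding total_recursive_def by blast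
  have rec: "computes (RPrim f g) (n # xs) y \<longleftrightarrow> y = rec_nat (F xs) (\<lambda>n y. G (n # y # xs)) n"
    if xs: "length xs = k" for n xs y
  proof (induction n arbitrary: y)
    case 0
    show ?case using xs by (auto simp: f(2) elim: computes_RPrim_0E intro: computes.prim_0)
  next
    case (Suc n)
    have "computes (RPrim f g) (Suc n # xs) y
        \<longleftrightarrow> (\<exists>v. computes (RPrim f g) (n # xs) v \<and> computes g (n # v # xs) y)"
      by (blast elim: computes_RPrim_SucE intro: computes.prim_Suc)
    then show ?case using xs by (simp add: Suc g(2))
  qed
  have "computes (RPrim f g) xs y \<longleftrightarrow> y = rec_nat (F (tl xs)) (\<lambda>n y. G (n # y # tl xs)) (hd xs)"
    if "length xs = Suc k" for xs y
    using that rec[of "tl xs" "hd xs" y] by (cases xs) auto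
  moreover have "has_arity (RPrim f g) (Suc k)"
    using has_arity.intros(5)[of f k g] f(1) g(1) by simp
  ultimately show ?thesis unfolding total_recursive_def by blast
qed

section \<open>Arithmetic of total recursive functions\<close>

lemma total_recursive_1:
  assumes "total_recursive 1 (\<lambda>xs. h (xs ! 0))" "total_recursive k F"
  shows "total_recursive k (\<lambda>xs. h (F xs))"
  using total_recursive_comp[of "[F]" "\<lambda>xs. h (xs ! 0)" k] assms by simp

lemma total_recursive_2:
  assumes "total_recursive 2 (\<lambda>xs. h (xs ! 0) (xs ! 1))" "total_recursive k F" "total_recursive k G"
  shows "total_recursive k (\<lambda>xs. h (F xs) (G xs))"
  using total_recursive_comp[of "[F, G]" "\<lambda>xs. h (xs ! 0) (xs ! 1)" k] assms
  by (auto simp: numeral_2_eq_2)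

lemma total_recursive_Suc: "total_recursive k F \<Longrightarrow> total_recursive k (\<lambda>xs. Suc (F xs))"
proof (rule total_recursive_1[where h = Suc])
  have "computes RSucc xs y \<longleftrightarrow> y = Suc (xs ! 0)" if "length xs = 1" for xs y
    using that by (cases xs) (auto simp: computes_RSucc_iff)
  then show "total_recursive 1 (\<lambda>xs. Suc (xs ! 0))"
    unfolding total_recursive_def using has_arity.intros(2) by blast
qed

lemma total_recursive_const: "total_recursive k (\<lambda>xs. c)"
proof (induction c)
  case 0
  show ?case unfolding total_recursive_def
    by (intro exI[of _ RZero]) (simp add: has_arity.intros computes_RZero_iff)
qed (rule total_recursive_Suc)

lemma total_recursive_add:
  "total_recursive k F \<Longrightarrow> total_recursive k G \<Longrightarrow> total_recursive k (\<lambda>xs. F xs + G xs)"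
proof (rule total_recursive_2[where h = "(+)"])
  have rec: "rec_nat x (\<lambda>n y. Suc y) n = n + x" for x n :: nat by (induction n) auto
  have "total_recursive (Suc 1) (\<lambda>xs. rec_nat (tl xs ! 0) (\<lambda>n y. Suc ((n # y # tl xs) ! 1)) (hd xs))"
    by (rule total_recursive_prim[where G = "\<lambda>xs. Suc (xs ! 1)"])
      (intro total_recursive_Suc total_recursive_nth; simp)+
  then show "total_recursive 2 (\<lambda>xs. xs ! 0 + xs ! 1)"
    unfolding Suc_1 by (rule total_recursive_cong) (auto simp: rec length_Suc_conv numeral_2_eq_2)
qed

lemma total_recursive_mult:
  "total_recursive k F \<Longrightarrow> total_recursive k G \<Longrightarrow> total_recursive k (\<lambda>xs. F xs * G xs)"
proof (rule total_recursive_2[where h = "(*)"])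
  have rec: "rec_nat 0 (\<lambda>n y. y + x) n = n * x" for x n :: nat by (induction n) auto
  have "total_recursive (Suc 1) (\<lambda>xs. rec_nat 0 (\<lambda>n y. (n # y # tl xs) ! 1 + (n # y # tl xs) ! 2) (hd xs))"
    by (rule total_recursive_prim[where G = "\<lambda>xs. xs ! 1 + xs ! 2"], rule total_recursive_const,
        intro total_recursive_add total_recursive_nth) simp_all
  then show "total_recursive 2 (\<lambda>xs. xs ! 0 * xs ! 1)"
    unfolding Suc_1 by (rule total_recursive_cong) (auto simp: rec length_Suc_conv numeral_2_eq_2)
qed

lemma total_recursive_diff:
  "total_recursive k F \<Longrightarrow> total_recursive k G \<Longrightarrow> total_recursive k (\<lambda>xs. F xs - G xs)"
\<comment> \<open>Recursion runs on the first argument, so the subtrahend comes first and the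
  predecessor is iterated.\<close>
proof (rule total_recursive_2[where h = "\<lambda>n x. x - n"])
  have rec_pred: "rec_nat 0 (\<lambda>n y. n) n = n - 1" for n :: nat by (induction n) auto
  have "total_recursive (Suc 0) (\<lambda>xs. rec_nat 0 (\<lambda>n y. (n # y # tl xs) ! 0) (hd xs))"
    by (rule total_recursive_prim[where G = "\<lambda>xs. xs ! 0"], rule total_recursive_const,
        intro total_recursive_nth) simp
  then have pred: "total_recursive 1 (\<lambda>xs. xs ! 0 - 1)"
    unfolding One_nat_def by (rule total_recursive_cong) (auto simp: rec_pred length_Suc_conv)
  have rec: "rec_nat x (\<lambda>n y. y - 1) n = x - n" for x n :: nat by (induction n) auto
  have "total_recursive (Suc 1) (\<lambda>xs. rec_nat (tl xs ! 0) (\<lambda>n y. (n # y # tl xs) ! 1 - 1) (hd xs))"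
    by (rule total_recursive_prim[where G = "\<lambda>xs. xs ! 1 - 1"], rule total_recursive_nth, simp,
        rule total_recursive_1[OF pred], rule total_recursive_nth) simp
  then show "total_recursive 2 (\<lambda>xs. xs ! 1 - xs ! 0)"
    unfolding Suc_1 by (rule total_recursive_cong) (auto simp: rec[simplified] length_Suc_conv numeral_2_eq_2)
qed

lemma total_recursive_half: "total_recursive k F \<Longrightarrow> total_recursive k (\<lambda>xs. F xs div 2)"
proof (rule total_recursive_1[where h = "\<lambda>n. n div 2"])
  \<comment> \<open>Since (n + 1) div 2 = n - n div 2, halving satisfies a recursion without a
    parity test.\<close>
  have rec: "rec_nat 0 (\<lambda>n y. n - y) n = n div 2" for n :: nat by (induction n) auto
  have "total_recursive (Suc 0) (\<lambda>xs. rec_nat 0 (\<lambda>n y. (n # y # tl xs) ! 0 - (n # y # tl xs) ! 1) (hd xs))"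
    by (rule total_recursive_prim[where G = "\<lambda>xs. xs ! 0 - xs ! 1"], rule total_recursive_const,
        intro total_recursive_diff total_recursive_nth) simp_all
  then show "total_recursive 1 (\<lambda>xs. xs ! 0 div 2)"
    unfolding One_nat_def by (rule total_recursive_cong) (auto simp: rec length_Suc_conv)
qed

lemma total_recursive_mod_2: "total_recursive k F \<Longrightarrow> total_recursive k (\<lambda>xs. F xs mod 2)"
  unfolding modulo_nat_def
  by (intro total_recursive_diff total_recursive_mult total_recursive_half total_recursive_const)

lemma total_recursive_prod_less:
  assumes "total_recursive (Suc k) H"
  shows "total_recursive (Suc k) (\<lambda>xs. \<Prod>x<hd xs. H (x # tl xs))"
proof -
  \<comment> \<open>The step function receives counter, accumulator and parameters; index 1, the
    accumulator, is not passed on to H.\<close>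
  let ?Gs = "map (\<lambda>i xs. xs ! i) (0 # [2..<Suc (Suc k)]) :: (nat list \<Rightarrow> nat) list"
  have "total_recursive (Suc (Suc k)) (\<lambda>xs. H (map (\<lambda>G. G xs) ?Gs))"
  proof (rule total_recursive_comp)
    have "length ?Gs = Suc k" by (simp del: upt_Suc)
    then show "total_recursive (length ?Gs) H" using assms by (simp only:)
  qed (auto intro: total_recursive_nth)
  then have "total_recursive (Suc (Suc k)) (\<lambda>xs. H (xs ! 0 # tl (tl xs)))"
  proof (rule total_recursive_cong)
    fix xs :: "nat list" assume xs: "length xs = Suc (Suc k)"
    have "map (\<lambda>i. xs ! i) [2..<Suc (Suc k)] = drop 2 xs"
      unfolding xs[symmetric] by (intro nth_equalityI) auto
    also have "drop 2 xs = tl (tl xs)" by (simp add: numeral_2_eq_2 drop_Suc)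
    finally have "map (\<lambda>G. G xs) ?Gs = xs ! 0 # tl (tl xs)" by (simp only: list.map map_map comp_def)
    then show "H (map (\<lambda>G. G xs) ?Gs) = H (xs ! 0 # tl (tl xs))" by (rule arg_cong)
  qed
  then have "total_recursive (Suc (Suc k)) (\<lambda>xs. xs ! 1 * H (xs ! 0 # tl (tl xs)))"
    by (intro total_recursive_mult total_recursive_nth) simp_all
  from total_recursive_prim[OF total_recursive_const this]
  have "total_recursive (Suc k) (\<lambda>xs. rec_nat 1 (\<lambda>n y. y * H (n # tl xs)) (hd xs))" by simp
  moreover have "rec_nat 1 (\<lambda>n y. y * H (n # xs)) b = (\<Prod>x<b. H (x # xs))" for b xs
    by (induction b) auto
  ultimately show ?thesis by simp
qed

text \<open>With the convention that \<open>0\<close> means true, a bounded existential quantifier is a product. All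
  unknowns share one bound \<open>b\<close>, over which a single minimisation then searches.\<close>

lemma total_recursive_bounded_search:
  assumes "total_recursive (m + Suc r) H"
  shows "\<exists>H'. total_recursive (Suc r) H' \<and> (\<forall>b xs. length xs = r \<longrightarrow>
    (H' (b # xs) = 0 \<longleftrightarrow> (\<exists>zs. length zs = m \<and> (\<forall>z\<in>set zs. z < b) \<and> H (zs @ b # xs) = 0)))"
  using assms
proof (induction m arbitrary: H)
  case 0
  then show ?case by (intro exI[of _ H]) simp
next
  case (Suc m)
  let ?K = "m + Suc r"
  \<comment> \<open>After m unknowns, entry m is the common bound b; its copy in front serves as the
    range of the product.\<close>
  let ?Gs = "(\<lambda>ys. ys ! m) # map (\<lambda>i ys. ys ! i) [0..<?K]"
  have "total_recursive (length ?Gs) (\<lambda>xs. \<Prod>x<hd xs. H (x # tl xs))"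
    using Suc.prems total_recursive_prod_less[of ?K H] by simp
  then have "total_recursive ?K (\<lambda>ys. \<Prod>x<hd (map (\<lambda>G. G ys) ?Gs). H (x # tl (map (\<lambda>G. G ys) ?Gs)))"
    by (rule total_recursive_comp) (auto intro: total_recursive_nth)
  then have "total_recursive ?K (\<lambda>ys. \<Prod>x<ys ! m. H (x # ys))"
  proof (rule total_recursive_cong)
    fix ys :: "nat list" assume ys: "length ys = ?K"
    have "map (\<lambda>i. ys ! i) [0..<?K] = ys" unfolding ys[symmetric] by (rule map_nth)
    then have "map (\<lambda>G. G ys) ?Gs = ys ! m # ys" by (simp only: list.map map_map comp_def)
    then show "(\<Prod>x<hd (map (\<lambda>G. G ys) ?Gs). H (x # tl (map (\<lambda>G. G ys) ?Gs))) = (\<Prod>x<ys ! m. H (x # ys))"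
      by (simp only: list.sel)
  qed
  from Suc.IH[OF this] obtain H' where H': "total_recursive (Suc r) H'"
    "\<And>b xs. length xs = r \<Longrightarrow> H' (b # xs) = 0 \<longleftrightarrow> (\<exists>zs. length zs = m \<and> (\<forall>z\<in>set zs. z < b)
        \<and> (\<Prod>x<(zs @ b # xs) ! m. H (x # zs @ b # xs)) = 0)" by blast
  have "(\<exists>zs. length zs = m \<and> (\<forall>z\<in>set zs. z < b) \<and> (\<Prod>x<(zs @ b # xs) ! m. H (x # zs @ b # xs)) = 0)
      \<longleftrightarrow> (\<exists>zs. length zs = Suc m \<and> (\<forall>z\<in>set zs. z < b) \<and> H (zs @ b # xs) = 0)" (is "?A \<longleftrightarrow> ?B") for b xs
  proof
    assume ?A
    then obtain zs x where "length zs = m" "\<forall>z\<in>set zs. z < b" "x < b" "H (x # zs @ b # xs) = 0"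
      by (auto simp: nth_append)
    then show ?B by (intro exI[of _ "x # zs"]) simp
  next
    assume ?B
    then obtain x zs where "length zs = m" "\<forall>z\<in>set zs. z < b" "x < b" "H (x # zs @ b # xs) = 0"
      by (auto simp: length_Suc_conv)
    then show ?A by (intro exI[of _ zs]) (auto simp: nth_append)
  qed
  then show ?case using H' by (intro exI[of _ H']) simp
qed

lemma ex_recf_domain_search:
  assumes "total_recursive (Suc r) H"
  shows "\<exists>f. has_arity f r \<and> (\<forall>xs. length xs = r \<longrightarrow> ((\<exists>y. computes f xs y) \<longleftrightarrow> (\<exists>b. H (b # xs) = 0)))"
proof -
  obtain h where h: "has_arity h (Suc r)" "\<And>xs y. length xs = Suc r \<Longrightarrow> computes h xs y \<longleftrightarrow> y = H xs"
    using assms unfolding total_recursive_def by blast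
  have "(\<exists>y. computes (RMu h) xs y) \<longleftrightarrow> (\<exists>b. H (b # xs) = 0)" if "length xs = r" for xs
  proof -
    have *: "computes (RMu h) xs n \<longleftrightarrow> H (n # xs) = 0 \<and> (\<forall>i<n. H (i # xs) \<noteq> 0)" for n
    proof -
      have "(\<exists>y. computes h (i # xs) (Suc y)) \<longleftrightarrow> H (i # xs) \<noteq> 0" for i
        using that by (auto simp: h(2) intro: exI[of _ "H (i # xs) - 1"])
      then show ?thesis unfolding computes_RMu_iff using that by (auto simp: h(2))
    qed
    show ?thesis
    proof
      assume "\<exists>b. H (b # xs) = 0"
      then have "computes (RMu h) xs (LEAST b. H (b # xs) = 0)"
        unfolding * by (auto intro: LeastI_ex dest: not_less_Least)
      then show "\<exists>y. computes (RMu h) xs y" by blast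
    qed (auto simp: *)
  qed
  moreover have "has_arity (RMu h) r" using h(1) by (intro has_arity.intros(6)) simp
  ultimately show ?thesis by blast
qed

text \<open>The remainder n mod 2 switches between the two branches, n div 2 for even and -(n div 2
  + 1) for odd n, so that natural arithmetic suffices.\<close>

lemma int_decode_eq_diff:
  "int_decode n = int (n div 2 * (1 - n mod 2)) - int (n mod 2 * Suc (n div 2))"
  by (auto simp: int_decode_def sum_decode_def odd_iff_mod_2_eq_one)

text \<open>The list holds m unknowns, then the search bound, then the codes of the parameters; this
  explains the offset \<open>m + Suc i\<close>.\<close>

lemma peval_eq_total_recursive_diff:
  assumes "pars p \<subseteq> {..<r}" "unks p \<subseteq> {..<m}"
  shows "\<exists>F G. total_recursive (m + Suc r) F \<and> total_recursive (m + Suc r) G \<and> (\<forall>ys.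
    peval (\<lambda>i. int_decode (ys ! (m + Suc i))) (\<lambda>i. int (ys ! i)) p = int (F ys) - int (G ys))"
  using assms
proof (induction p)
  case (Par i)
  have n: "total_recursive (m + Suc r) (\<lambda>ys. ys ! (m + Suc i))" using Par by (intro total_recursive_nth) simp
  show ?case unfolding peval.simps int_decode_eq_diff
    by (intro exI conjI allI, rule_tac[3] refl)
      (intro total_recursive_mult total_recursive_half total_recursive_diff total_recursive_mod_2
        total_recursive_Suc total_recursive_const n)+
next
  case (Unk i)
  have "total_recursive (m + Suc r) (\<lambda>ys. ys ! i)" using Unk by (intro total_recursive_nth) simp
  then show ?case by (intro exI[of _ "\<lambda>ys. ys ! i"] exI[of _ "\<lambda>ys. 0"]) (simp add: total_recursive_const)
next
  case (Cst c)
  show ?case by (intro exI[of _ "\<lambda>ys. nat c"] exI[of _ "\<lambda>ys. nat (- c)"]) (simp add: total_recursive_const)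
next
  case (Add p q)
  then obtain F G F' G' where "total_recursive (m + Suc r) F" "total_recursive (m + Suc r) G"
    "\<forall>ys. peval (\<lambda>i. int_decode (ys ! (m + Suc i))) (\<lambda>i. int (ys ! i)) p = int (F ys) - int (G ys)"
    "total_recursive (m + Suc r) F'" "total_recursive (m + Suc r) G'"
    "\<forall>ys. peval (\<lambda>i. int_decode (ys ! (m + Suc i))) (\<lambda>i. int (ys ! i)) q = int (F' ys) - int (G' ys)"
    by auto
  then show ?case
    by (intro exI[of _ "\<lambda>ys. F ys + F' ys"] exI[of _ "\<lambda>ys. G ys + G' ys"]) (simp add: total_recursive_add)
next
  case (Mul p q)
  then obtain F G F' G' where t: "total_recursive (m + Suc r) F" "total_recursive (m + Suc r) G"
    "total_recursive (m + Suc r) F'" "total_recursive (m + Suc r) G'"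
    and p: "\<forall>ys. peval (\<lambda>i. int_decode (ys ! (m + Suc i))) (\<lambda>i. int (ys ! i)) p = int (F ys) - int (G ys)"
    and q: "\<forall>ys. peval (\<lambda>i. int_decode (ys ! (m + Suc i))) (\<lambda>i. int (ys ! i)) q = int (F' ys) - int (G' ys)"
    by auto
  have "peval (\<lambda>i. int_decode (ys ! (m + Suc i))) (\<lambda>i. int (ys ! i)) (Mul p q)
      = int (F ys * F' ys + G ys * G' ys) - int (F ys * G' ys + G ys * F' ys)" for ys
    unfolding peval.simps p[rule_format] q[rule_format] by (simp add: algebra_simps)
  moreover have "total_recursive (m + Suc r) (\<lambda>ys. F ys * F' ys + G ys * G' ys)"
    "total_recursive (m + Suc r) (\<lambda>ys. F ys * G' ys + G ys * F' ys)"
    by (intro total_recursive_add total_recursive_mult t)+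
  ultimately show ?case by (intro exI conjI allI)
qed

lemma nat_diophantine_imp_recursively_enumerable:
  assumes "nat_diophantine r \<Omega>" and "\<Omega> \<subseteq> {a. length a = r}"
  shows "recursively_enumerable r \<Omega>"
proof -
  obtain p where pars: "pars p \<subseteq> {..<r}"
    and mem: "\<And>a. length a = r \<Longrightarrow> a \<in> \<Omega> \<longleftrightarrow> (\<exists>z::nat \<Rightarrow> nat. peval (nth a) (\<lambda>i. int (z i)) p = 0)"
    using assms(1) unfolding nat_diophantine_def by blast
  obtain m where unks: "unks p \<subseteq> {..<m}" using unks_bounded by blast
  obtain F G where "total_recursive (m + Suc r) F" "total_recursive (m + Suc r) G"
    and FG: "\<And>ys. peval (\<lambda>i. int_decode (ys ! (m + Suc i))) (\<lambda>i. int (ys ! i)) p = int (F ys) - int (G ys)"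
    using peval_eq_total_recursive_diff[OF pars unks] by blast
  \<comment> \<open>The two truncated differences add up to |F - G|, which is 0 exactly where the
    polynomial vanishes.\<close>
  then have "total_recursive (m + Suc r) (\<lambda>ys. (F ys - G ys) + (G ys - F ys))"
    by (intro total_recursive_add total_recursive_diff)
  from total_recursive_bounded_search[OF this] obtain H where H: "total_recursive (Suc r) H"
    "\<And>b xs. length xs = r \<Longrightarrow> H (b # xs) = 0 \<longleftrightarrow> (\<exists>zs. length zs = m \<and> (\<forall>z\<in>set zs. z < b)
      \<and> (F (zs @ b # xs) - G (zs @ b # xs)) + (G (zs @ b # xs) - F (zs @ b # xs)) = 0)" by blast
  obtain f where f: "has_arity f r"
    "\<And>xs. length xs = r \<Longrightarrow> (\<exists>y. computes f xs y) \<longleftrightarrow> (\<exists>b. H (b # xs) = 0)"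
    using ex_recf_domain_search[OF H(1)] by blast
  have "xs \<in> map int_encode ` \<Omega> \<longleftrightarrow> (\<exists>y. computes f xs y)" if xs: "length xs = r" for xs
  proof -
    let ?P = "\<lambda>z::nat \<Rightarrow> nat. peval (nth (map int_decode xs)) (\<lambda>i. int (z i)) p = 0"
    have zero: "(F (zs @ b # xs) - G (zs @ b # xs)) + (G (zs @ b # xs) - F (zs @ b # xs)) = 0 \<longleftrightarrow> ?P z"
      if "length zs = m" "\<And>i. i < m \<Longrightarrow> zs ! i = z i" for zs b z
    proof -
      let ?ys = "zs @ b # xs"
      have "peval (\<lambda>i. int_decode (?ys ! (m + Suc i))) (\<lambda>i. int (?ys ! i)) p
          = peval (nth (map int_decode xs)) (\<lambda>i. int (z i)) p"
        using pars unks that xs by (intro peval_cong) (auto simp: nth_append)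
      then show ?thesis using FG[of ?ys] by auto
    qed
    have "xs \<in> map int_encode ` \<Omega> \<longleftrightarrow> map int_decode xs \<in> \<Omega>"
    proof
      assume "map int_decode xs \<in> \<Omega>"
      then have "map int_encode (map int_decode xs) \<in> map int_encode ` \<Omega>" by (rule imageI)
      then show "xs \<in> map int_encode ` \<Omega>" by (simp add: o_def)
    qed (auto simp: o_def)
    also have "\<dots> \<longleftrightarrow> (\<exists>z. ?P z)" using mem[of "map int_decode xs"] xs by simp
    also have "\<dots> \<longleftrightarrow> (\<exists>b. H (b # xs) = 0)"
    proof
      assume "\<exists>z. ?P z"
      then obtain z where z: "?P z" by blast
      \<comment> \<open>A single bound above all m unknowns of the solution.\<close>
      let ?b = "Suc (\<Sum>i<m. z i)"
      have "z i < ?b" if "i < m" for i using that member_le_sum[of i "{..<m}" z] by simp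
      then have "\<forall>v\<in>set (map z [0..<m]). v < ?b" by auto
      then have "H (?b # xs) = 0"
        unfolding H(2)[OF xs] using zero[of "map z [0..<m]" z ?b] z by (intro exI[of _ "map z [0..<m]"]) simp
      then show "\<exists>b. H (b # xs) = 0" by blast
    next
      assume "\<exists>b. H (b # xs) = 0"
      then obtain b where "H (b # xs) = 0" ..
      from iffD1[OF H(2)[OF xs, of b] this] obtain zs where zs: "length zs = m"
        and 0: "(F (zs @ b # xs) - G (zs @ b # xs)) + (G (zs @ b # xs) - F (zs @ b # xs)) = 0"
        by (elim exE conjE)
      have "?P (nth zs)" using zero[OF zs refl, of b] 0 by (rule iffD1)
      then show "\<exists>z. ?P z" by (intro exI[of _ "nth zs"])
    qed
    finally show ?thesis unfolding f(2)[OF xs] .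
  qed
  then show ?thesis
    unfolding recursively_enumerable_def recursively_enumerable_nat_def using f(1) by blast
qed

theorem mainTheorem1:
  fixes r :: nat and \<Omega> :: "int list set"
  assumes "r \<ge> 1"
    and "\<Omega> \<subseteq> {a. length a = r}"
  shows "(has_functional_conceptual_substratum ordered_ring_language int_struct r \<Omega>
            \<longleftrightarrow> recursively_enumerable r \<Omega>)
       \<and> (recursively_enumerable r \<Omega> \<longleftrightarrow> diophantine r \<Omega>)"
  using functional_conceptual_substratum_imp_nat_diophantine
    nat_diophantine_imp_recursively_enumerable[OF _ assms(2)]
    recursively_enumerable_imp_nat_diophantine nat_diophantine_imp_diophantine
    diophantine_imp_functional_conceptual_substratum
  by blast

end
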